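(* Let $f:\mathbb{R}^n\to\mathbb{R}$ be continuously differentiable with locally Lipschitz continuous gradient, let $P_1:\mathbb{R}^n\to(-\infty,\infty]$ be proper, closed (lower semicontinuous) and prox-bounded (there is $\gamma>0$ with $\inf\{P_1+\frac{\gamma}{2}\|\cdot\|^2\}>-\infty$), let $P_2:\mathbb{R}^n\to\mathbb{R}$ be convex, and suppose $F:=f+P_1-P_2$ is bounded from below on $\mathrm{dom}\,P_1$. Let $\mathcal{S}$ be the set of stationary points of $\min_{\bm{x}\in\mathbb{R}^n}F(\bm{x})$, and suppose that $P_2$ is continuously differentiable on an open set $\mathcal{N}_{\mathcal{S}}$ containing $\mathcal{S}$ and that $\nabla P_2$ is locally Lipschitz continuous on $\mathcal{N}_{\mathcal{S}}$. Let the parameters satisfy $0<\gamma_{\min}\leq\gamma_{\max}<\infty$, $\beta_{\max}\geq0$, $0<p_{\min}<1$, $0\leq\delta<1$, $\tau>1$, $0<\eta<\frac{1}{\sqrt{\tau}}$, and let $\{\bm{x}^k\}$ be a sequence generated by the algorithm nexPGA. Suppose that $\{\bm{x}^k\}$ has an accumulation point $\bm{x}^*$ and that the potential function $H_\delta(\bm{u},\bm{v},\gamma)=F(\bm{u})+\frac{\delta\gamma}{8}\|\bm{u}-\bm{v}\|^2$ is a KL function with an exponent $\theta\in[0,1)$. Then: (i) If $\theta\in[0,\frac12]$, there exist $d_1>0$ and $\varrho\in(0,1)$ such that $\|\bm{x}^k-\bm{x}^*\|\le d_1\varrho^k$ for all sufficiently large $k$. (ii) If $\theta\in(\frac12,1)$,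 there exists $d_2>0$ such that $\|\bm{x}^k-\bm{x}^*\|\le d_2k^{-\frac{1-\theta}{2\theta-1}}$ for all sufficiently large $k$.
   Context: $\|\cdot\|$ is the Euclidean norm. For a proper function $h$, $\partial h$ is the limiting subdifferential: for $\bm{x}\in\mathrm{dom}\,h$, $\bm{d}\in\partial h(\bm{x})$ iff there are $\bm{x}^k\to\bm{x}$ with $h(\bm{x}^k)\to h(\bm{x})$ and $\bm{d}^k\to\bm{d}$ with $\bm{d}^k\in\widehat\partial h(\bm{x}^k)$ for all $k$, where $\widehat\partial h(\bm{y})$ is the Fréchet subdifferential, i.e. the set of $\bm{d}$ with $\liminf_{\bm{z}\to\bm{y},\bm{z}\neq\bm{y}}\frac{h(\bm{z})-h(\bm{y})-\langle\bm{d},\bm{z}-\bm{y}\rangle}{\|\bm{z}-\bm{y}\|}\ge0$. For convex $h$ it is the usual convex subdifferential. Stationary point: $\bm{x}^*\in\mathrm{dom}\,F$ with $0\in\nabla f(\bm{x}^* )+\partial P_1(\bm{x}^* )-\partial P_2(\bm{x}^* )$. Potential function: $H_\delta(\bm{u},\bm{v},\gamma):=F(\bm{u})+\frac{\delta\gamma}{8}\|\bm{u}-\bm{v}\|^2$ for $\bm{u},\bm{v}\in\mathbb{R}^n$, $\gamma>0$ (a function on $\mathbb{R}^n\times\mathbb{R}^n\times(0,\infty)$; its subdifferential and the KL property are taken at points with $\gamma>0$, with respect to all three variables). KL property: for $\nu>0$ let $\Phi_\nu$ be the class of concave $\varphi:[0,\nu)\to\mathbb{R}_+$ with $\varphi(0)=0$,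 $\varphi$ continuous at $0$ and continuously differentiable on $(0,\nu)$, and $\varphi'>0$ on $(0,\nu)$. A proper closed function $h$ has the KL property at $\tilde{\bm{x}}\in\mathrm{dom}\,\partial h$ if there are $\nu\in(0,+\infty]$, a neighborhood $\mathcal{V}$ of $\tilde{\bm{x}}$ and $\varphi\in\Phi_\nu$ such that $\varphi'(h(\bm{x})-h(\tilde{\bm{x}}))\,\mathrm{dist}(\bm{0},\partial h(\bm{x}))\ge1$ for all $\bm{x}\in\mathcal{V}$ with $h(\tilde{\bm{x}})<h(\bm{x})<h(\tilde{\bm{x}})+\nu$. $h$ is a KL function if it has the KL property at each point of $\mathrm{dom}\,\partial h$; it is a KL function with an exponent $\theta\in[0,1)$ if moreover $\varphi$ can be chosen (at each such point) as $\varphi(t)=\tilde{a}t^{1-\theta}$ for some $\tilde{a}>0$. Algorithm nexPGA. Start from $\bm{x}^0\in\mathrm{dom}\,P_1$; set $\bm{x}^{-1}=\bm{x}^0$, $\overline\gamma_{-1}=\gamma_{\min}$, $\mathcal{R}_0=F(\bm{x}^0)$. For $k=0,1,2,\dots$ (run indefinitely): Step 1: take any $\bm{\xi}^k\in\partial P_2(\bm{x}^k)$ and arbitrary $\beta_{k,0}\in[0,\delta\beta_{\max}]$, $\gamma_{k,0}\in[\gamma_{\min},\gamma_{\max}]$. For $i=0,1,2,\dots$, with $\beta_{k,i}=\eta^i\beta_{k,0}$ and $\gamma_{k,i}=\tau^i\gamma_{k,0}$, set $\bm{y}^{k,i}=\bm{x}^k+\beta_{k,i}(\bm{x}^k-\bm{x}^{k-1})$,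 and take any global minimizer $$\bm{x}^{k,i}\in\arg\min_{\bm{x}\in\mathbb{R}^n}\Big\{\langle\nabla f(\bm{y}^{k,i})-\bm{\xi}^k,\bm{x}-\bm{y}^{k,i}\rangle+\tfrac{\gamma_{k,i}}{2}\|\bm{x}-\bm{y}^{k,i}\|^2+P_1(\bm{x})\Big\}$$ (if no minimizer exists, trial $i$ counts as failed). Stop the inner loop at the first $i$ for which the line search criterion $H_\delta(\bm{x}^{k,i},\bm{x}^k,\gamma_{k,i})-\mathcal{R}_k\le-\frac{(1-\delta)\gamma_{k,i}}{8}\|\bm{x}^{k,i}-\bm{x}^k\|^2$ holds. Step 2: with that $i$, set $\overline\beta_k=\beta_{k,i}$, $\overline\gamma_k=\gamma_{k,i}$, $\bm{x}^{k+1}=\bm{x}^{k,i}$; choose any $p_{k+1}\in[p_{\min},1]$ and set $\mathcal{R}_{k+1}=(1-p_{k+1})\mathcal{R}_k+p_{k+1}H_\delta(\bm{x}^{k+1},\bm{x}^k,\overline\gamma_k)$. *)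

theory Defs
  imports "HOL-Analysis.Analysis"
begin

section \<open>Extended-real-valued functions and subdifferentials\<close>

definition domain_of :: "('a \<Rightarrow> ereal) \<Rightarrow> 'a set" where
  "domain_of h = {x. h x < \<infinity>}"

definition proper_fun :: "('a \<Rightarrow> ereal) \<Rightarrow> bool" where
  "proper_fun h \<longleftrightarrow> (\<forall>x. h x \<noteq> -\<infinity>) \<and> domain_of h \<noteq> {}"

definition lower_semicontinuous :: "('a::euclidean_space \<Rightarrow> ereal) \<Rightarrow> bool" where
  "lower_semicontinuous h \<longleftrightarrow> (\<forall>x. h x \<le> Liminf (at x) h)"

definition prox_bounded :: "('a::euclidean_space \<Rightarrow> ereal) \<Rightarrow> bool" where
  "prox_bounded h \<longleftrightarrow>
     (\<exists>\<gamma>>0. (INF x. h x + ereal (\<gamma> / 2 * (norm x)\<^sup>2)) > -\<infinity>)"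

(* The finiteness guard gives the empty set outside the domain; without it the convention
   \<infinity> - \<infinity> = \<infinity> of ereal would make every vector a Frechet subgradient there. *)
definition frechet_subdiff :: "('a::euclidean_space \<Rightarrow> ereal) \<Rightarrow> 'a \<Rightarrow> 'a set" where
  "frechet_subdiff h y =
     {d. \<bar>h y\<bar> \<noteq> \<infinity> \<and>
         Liminf (at y) (\<lambda>z. (h z - h y - ereal (d \<bullet> (z - y))) / ereal (norm (z - y))) \<ge> 0}"

definition limiting_subdiff :: "('a::euclidean_space \<Rightarrow> ereal) \<Rightarrow> 'a \<Rightarrow> 'a set" where
  "limiting_subdiff h x =
     {d. \<bar>h x\<bar> \<noteq> \<infinity> \<and>
         (\<exists>X D. X \<longlonglongrightarrow> x \<and> (\<lambda>k. h (X k)) \<longlonglongrightarrow> h x \<and> D \<longlonglongrightarrow> d \<and>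
                (\<forall>k. D k \<in> frechet_subdiff h (X k)))}"

definition locally_lipschitz_on ::
  "'a::euclidean_space set \<Rightarrow> ('a \<Rightarrow> 'b::euclidean_space) \<Rightarrow> bool" where
  "locally_lipschitz_on S g \<longleftrightarrow>
     (\<forall>x\<in>S. \<exists>u>0. \<exists>L. L-lipschitz_on (cball x u \<inter> S) g)"

section \<open>The Kurdyka-Lojasiewicz property\<close>

definition desingularizing :: "ereal \<Rightarrow> (real \<Rightarrow> real) set" where
  "desingularizing \<nu> =
     {\<phi>. concave_on {t. 0 \<le> t \<and> ereal t < \<nu>} \<phi> \<and>
         (\<forall>t. 0 \<le> t \<and> ereal t < \<nu> \<longrightarrow> \<phi> t \<ge> 0) \<and>
         \<phi> 0 = 0 \<and>
         continuous (at 0 within {t. 0 \<le> t \<and> ereal t < \<nu>}) \<phi> \<and>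
         (\<forall>t. 0 < t \<and> ereal t < \<nu> \<longrightarrow> \<phi> differentiable (at t)) \<and>
         continuous_on {t. 0 < t \<and> ereal t < \<nu>} (deriv \<phi>) \<and>
         (\<forall>t. 0 < t \<and> ereal t < \<nu> \<longrightarrow> deriv \<phi> t > 0)}"

(* The distance from 0 to A, with value \<infinity> for A = {} (infdist and setdist give 0 there). *)
definition dist0 :: "'a::euclidean_space set \<Rightarrow> ereal" where
  "dist0 A = (INF d\<in>A. ereal (dist 0 d))"

definition KL_inequality ::
  "('a::euclidean_space \<Rightarrow> ereal) \<Rightarrow> 'a \<Rightarrow> ereal \<Rightarrow> (real \<Rightarrow> real) \<Rightarrow> bool" where
  "KL_inequality h x \<nu> \<phi> \<longleftrightarrow>
     (\<exists>V. open V \<and> x \<in> V \<and>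
        (\<forall>y\<in>V. h x < h y \<and> h y < h x + \<nu> \<longrightarrow>
           ereal (deriv \<phi> (real_of_ereal (h y - h x))) * dist0 (limiting_subdiff h y) \<ge> 1))"

definition KL_property_at :: "('a::euclidean_space \<Rightarrow> ereal) \<Rightarrow> 'a \<Rightarrow> bool" where
  "KL_property_at h x \<longleftrightarrow>
     (\<exists>\<nu>>0. \<exists>\<phi>\<in>desingularizing \<nu>. KL_inequality h x \<nu> \<phi>)"

(* U is an open set on which h is regarded as being defined. The subdifferential and the KL
   property at a point of U depend only on h near that point, so the values of h off U are
   irrelevant. *)
definition KL_function_on :: "'a::euclidean_space set \<Rightarrow> ('a \<Rightarrow> ereal) \<Rightarrow> bool" where
  "KL_function_on U h \<longleftrightarrow> (\<forall>x\<in>U. limiting_subdiff h x \<noteq> {} \<longrightarrow> KL_property_at h x)"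

definition KL_function_exponent_on ::
  "'a::euclidean_space set \<Rightarrow> ('a \<Rightarrow> ereal) \<Rightarrow> real \<Rightarrow> bool" where
  "KL_function_exponent_on U h \<theta> \<longleftrightarrow>
     KL_function_on U h \<and>
     (\<forall>x\<in>U. limiting_subdiff h x \<noteq> {} \<longrightarrow>
        (\<exists>\<nu>>0. \<exists>a>0. (\<lambda>t. a * t powr (1 - \<theta>)) \<in> desingularizing \<nu> \<and>
                       KL_inequality h x \<nu> (\<lambda>t. a * t powr (1 - \<theta>))))"

section \<open>The optimization problem and the algorithm\<close>

definition objective ::
  "('a \<Rightarrow> real) \<Rightarrow> ('a \<Rightarrow> ereal) \<Rightarrow> ('a \<Rightarrow> real) \<Rightarrow> 'a \<Rightarrow> ereal" where
  "objective f P1 P2 x = ereal (f x) + P1 x - ereal (P2 x)"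

definition stationary_points ::
  "('a::euclidean_space \<Rightarrow> real) \<Rightarrow> ('a \<Rightarrow> 'a) \<Rightarrow> ('a \<Rightarrow> ereal) \<Rightarrow> ('a \<Rightarrow> real) \<Rightarrow> 'a set" where
  "stationary_points f grad_f P1 P2 =
     {x \<in> domain_of (objective f P1 P2).
        0 \<in> {grad_f x + v - w | v w.
               v \<in> limiting_subdiff P1 x \<and> w \<in> limiting_subdiff (\<lambda>z. ereal (P2 z)) x}}"

definition potential ::
  "('a::euclidean_space \<Rightarrow> ereal) \<Rightarrow> real \<Rightarrow> 'a \<times> 'a \<times> real \<Rightarrow> ereal" where
  "potential F \<delta> = (\<lambda>(u, v, \<gamma>). F u + ereal (\<delta> * \<gamma> / 8 * (norm (u - v))\<^sup>2))"

definition prox_model ::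
  "('a::euclidean_space \<Rightarrow> 'a) \<Rightarrow> ('a \<Rightarrow> ereal) \<Rightarrow> 'a \<Rightarrow> 'a \<Rightarrow> real \<Rightarrow> 'a \<Rightarrow> ereal" where
  "prox_model grad_f P1 \<xi> y \<gamma> x =
     ereal ((grad_f y - \<xi>) \<bullet> (x - y) + \<gamma> / 2 * (norm (x - y))\<^sup>2) + P1 x"

definition line_search ::
  "('a::euclidean_space \<Rightarrow> ereal) \<Rightarrow> real \<Rightarrow> real \<Rightarrow> real \<Rightarrow> 'a \<Rightarrow> 'a \<Rightarrow> bool" where
  "line_search F \<delta> R \<gamma> xk z \<longleftrightarrow>
     potential F \<delta> (z, xk, \<gamma>) - ereal R \<le> ereal (- ((1 - \<delta>) * \<gamma> / 8 * (norm (z - xk))\<^sup>2))"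

(* The sequence x is an (infinite) output of nexPGA for some admissible run. Here j k is the
   index at which the inner loop of iteration k stops, and xt k i is the minimizer taken in
   trial i; the latter is unconstrained in those failed trials that have no minimizer.
   With truncated subtraction, x (k - 1) is x 0 for k = 0, which is the initialization
   of the iterate with index -1. *)
definition nexPGA ::
  "('a::euclidean_space \<Rightarrow> real) \<Rightarrow> ('a \<Rightarrow> 'a) \<Rightarrow> ('a \<Rightarrow> ereal) \<Rightarrow> ('a \<Rightarrow> real) \<Rightarrow>
   real \<Rightarrow> real \<Rightarrow> real \<Rightarrow> real \<Rightarrow> real \<Rightarrow> real \<Rightarrow> real \<Rightarrow> (nat \<Rightarrow> 'a) \<Rightarrow> bool" where
  "nexPGA f grad_f P1 P2 \<gamma>min \<gamma>max \<beta>max pmin \<delta> \<tau> \<eta> x \<longleftrightarrow>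
     (\<exists>\<xi> \<beta>0 \<gamma>0 p R j xt.
        let F = objective f P1 P2;
            \<beta> = (\<lambda>k i. \<eta> ^ i * \<beta>0 k);
            \<gamma> = (\<lambda>k i. \<tau> ^ i * \<gamma>0 k);
            y = (\<lambda>k i. x k + \<beta> k i *\<^sub>R (x k - x (k - 1)));
            minimizer = (\<lambda>k i z. is_arg_min (prox_model grad_f P1 (\<xi> k) (y k i) (\<gamma> k i))
                                   (\<lambda>_. True) z);
            accepted = (\<lambda>k i z. line_search F \<delta> (R k) (\<gamma> k i) (x k) z)
        in x 0 \<in> domain_of P1 \<and>
           ereal (R 0) = F (x 0) \<and>
           (\<forall>k::nat.
              \<xi> k \<in> limiting_subdiff (\<lambda>z. ereal (P2 z)) (x k) \<and>
              \<beta>0 k \<in> {0..\<delta> * \<beta>max} \<and>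
              \<gamma>0 k \<in> {\<gamma>min..\<gamma>max} \<and>
              (\<forall>i < j k. (\<nexists>z. minimizer k i z) \<or>
                         (minimizer k i (xt k i) \<and> \<not> accepted k i (xt k i))) \<and>
              minimizer k (j k) (xt k (j k)) \<and>
              accepted k (j k) (xt k (j k)) \<and>
              x (Suc k) = xt k (j k) \<and>
              p (Suc k) \<in> {pmin..1} \<and>
              ereal (R (Suc k)) =
                ereal ((1 - p (Suc k)) * R k)
                + ereal (p (Suc k)) * potential F \<delta> (x (Suc k), x k, \<gamma> k (j k))))"

end

(* Write r(k) = R(k) - lim R and a = max(1, 2 theta).

   Near the accumulation point the backtracking stops after a bounded number of trials: a trial with
   a large proximal parameter lands close to the current iterate, where the gradient of f is
   Lipschitz, and (tau eta^2)^i tends to 0, so the extrapolation error is absorbed by the distance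
   term of the potential. With bounded step sizes the accumulation point is stationary, P2 is smooth
   around it, and the potential has a subgradient of the size of two consecutive steps. The KL
   inequality, uniform over the compact interval of step sizes, then gives
   (H(k+2) - lim R)^a <= const (r(k) - r(k+2)) whenever the left base is positive. The potential
   may drop below lim R, but then, or if it is small compared with r(k+2), the averaging step defining R
   decreases r by a fixed factor. Either way r(k+2)^a <= const (r(k) - r(k+2)), and both the finite
   length of the tail and the rates follow from this scalar recursion. *)
theory Submission
  imports Defs
begin

section \<open>Subdifferential calculus\<close>

text \<open>No boundedness of the iterates is assumed, so Lipschitz constants, step size bounds and
  the KL inequality are available only near the accumulation point. Convergence therefore has to be
  won along with the rate: a bound on the remaining length traps the sequence in a small ball. All
  estimates run through \<open>R\<close>, which is monotone although the objective and the potential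
  need not be. The recursion skips an index because extrapolation bounds the subgradient at
  \<open>x (k + 2)\<close> only by the last two steps, whose squares are paid for by
  \<open>R k - R (k + 2)\<close>. The exponent is kept at least 1 because averaging alone yields no
  more than a linear decrease, and it stays below 2 because \<open>\<theta> < 1\<close>. Steps are
  at most multiples of square roots of decreases of \<open>r\<close>; what telescopes is
  \<open>r\<close> to the power \<open>1 - a / 2\<close>, and this power bounds the distance to the
  limit.\<close>

lemma frechet_subdiff_iff:
  "d \<in> frechet_subdiff h y \<longleftrightarrow>
     (\<exists>a. h y = ereal a \<and>
        (\<forall>e>0. \<forall>\<^sub>F z in at y. ereal (a + d \<bullet> (z - y) - e * norm (z - y)) \<le> h z))"
proof -
  \<comment> \<open>\<open>H\<close> ranges over the extended reals; clearing the quotient once, by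
    cases on \<open>H\<close>, leaves only lower bounds with a real left-hand side for the later
    arguments.\<close>
  have quot: "ereal c < (H - ereal a - ereal b) / ereal n \<longleftrightarrow> ereal (a + b + c * n) < H"
    if "n > 0" for a b c n :: real and H
    using that by (cases H) (auto simp: ereal_less_divide_iff field_simps)
  have "0 \<le> Liminf (at y) (\<lambda>z. (h z - ereal a - ereal (d \<bullet> (z - y))) / ereal (norm (z - y))) \<longleftrightarrow>
      (\<forall>e>0. \<forall>\<^sub>F z in at y. ereal (a + d \<bullet> (z - y) - e * norm (z - y)) \<le> h z)"
    (is "?L \<longleftrightarrow> ?R") for a
  proof
    assume L: ?L
    show ?R
    proof (intro allI impI)
      fix e :: real assume "e > 0"
      then have "\<forall>\<^sub>F z in at y. ereal (- e) < (h z - ereal a - ereal (d \<bullet> (z - y))) / ereal (norm (z - y))"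
        using L by (auto simp: le_Liminf_iff)
      moreover have "\<forall>\<^sub>F z in at y. z \<noteq> y" by (simp add: eventually_at_filter)
      ultimately show "\<forall>\<^sub>F z in at y. ereal (a + d \<bullet> (z - y) - e * norm (z - y)) \<le> h z"
        by eventually_elim (auto simp: quot less_imp_le)
    qed
  next
    assume R: ?R
    have "\<forall>\<^sub>F z in at y. c < (h z - ereal a - ereal (d \<bullet> (z - y))) / ereal (norm (z - y))"
      if "c < 0" for c
    proof -
      obtain e where e: "e > 0" "c < ereal (- e)"
      proof (cases c)
        case (real r)
        then show ?thesis using \<open>c < 0\<close> by (intro that[of "- r / 2"]) auto
      qed (use \<open>c < 0\<close> in \<open>auto intro: that[of 1]\<close>)
      have "\<forall>\<^sub>F z in at y. ereal (a + d \<bullet> (z - y) - e / 2 * norm (z - y)) \<le> h z"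
        using R e half_gt_zero by blast
      moreover have "\<forall>\<^sub>F z in at y. z \<noteq> y" by (simp add: eventually_at_filter)
      ultimately show ?thesis
      proof eventually_elim
        case (elim z)
        then have n: "norm (z - y) > 0" by auto
        then have "ereal (a + d \<bullet> (z - y) + (- e) * norm (z - y))
            < ereal (a + d \<bullet> (z - y) - e / 2 * norm (z - y))"
          using e(1) by simp
        also note elim(1)
        finally show ?case using quot[OF n] e(2) order.strict_trans by blast
      qed
    qed
    then show ?L by (auto simp: le_Liminf_iff)
  qed
  then show ?thesis
    unfolding frechet_subdiff_def by (cases "h y") auto
qed

lemma frechet_subdiff_finite: "d \<in> frechet_subdiff h y \<Longrightarrow> \<bar>h y\<bar> \<noteq> \<infinity>"
  by (simp add: frechet_subdiff_def)

lemma limiting_subdiffI: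
  assumes "\<bar>h x\<bar> \<noteq> \<infinity>" "X \<longlonglongrightarrow> x" "(\<lambda>n. h (X n)) \<longlonglongrightarrow> h x" "D \<longlonglongrightarrow> d"
    "\<And>n. D n \<in> frechet_subdiff h (X n)"
  shows "d \<in> limiting_subdiff h x"
  unfolding limiting_subdiff_def
  using assms by (intro CollectI conjI exI[of _ X] exI[of _ D]) simp_all

lemma frechet_subdiff_subset_limiting: "frechet_subdiff h y \<subseteq> limiting_subdiff h y"
proof
  fix d assume "d \<in> frechet_subdiff h y"
  then show "d \<in> limiting_subdiff h y"
    using frechet_subdiff_finite[OF \<open>d \<in> _\<close>]
    by (intro limiting_subdiffI[where X = "\<lambda>_. y" and D = "\<lambda>_. d"]) simp_all
qed

text \<open>The first-order error of \<open>g\<close> takes one half of \<open>e\<close>, the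
  minorant of \<open>h\<close> the other. Applied with a negated smooth part, the inclusion also
  removes a smooth term, which is how optimality in a subproblem becomes a subgradient of
  \<open>P1\<close>.\<close>

lemma frechet_subdiff_add_smooth:
  assumes d: "d \<in> frechet_subdiff h y" and g: "GDERIV g y :> G"
  shows "d + G \<in> frechet_subdiff (\<lambda>z. h z + ereal (g z)) y"
proof -
  obtain a where a: "h y = ereal a"
    and ev: "\<And>e. e > 0 \<Longrightarrow> \<forall>\<^sub>F z in at y. ereal (a + d \<bullet> (z - y) - e * norm (z - y)) \<le> h z"
    using d unfolding frechet_subdiff_iff by auto
  have der: "(g has_derivative (\<lambda>h. h \<bullet> G)) (at y)"
    using g by (simp add: gderiv_def)
  have "\<forall>\<^sub>F z in at y. ereal ((a + g y) + (d + G) \<bullet> (z - y) - e * norm (z - y)) \<le> h z + ereal (g z)"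
    if "e > 0" for e
  proof -
    have "\<forall>\<^sub>F z in at y. norm (g z - g y - (z - y) \<bullet> G) \<le> e / 2 * norm (z - y)"
    proof -
      have "e / 2 > 0" using that by simp
      then obtain r where "r > 0"
        "\<And>z. norm (z - y) < r \<Longrightarrow> norm (g z - g y - (z - y) \<bullet> G) \<le> e / 2 * norm (z - y)"
        using der unfolding has_derivative_at_alt by blast
      then show ?thesis unfolding eventually_at dist_norm by blast
    qed
    moreover have "\<forall>\<^sub>F z in at y. ereal (a + d \<bullet> (z - y) - e / 2 * norm (z - y)) \<le> h z"
      using that by (intro ev) simp
    ultimately show ?thesis
    proof eventually_elim
      case (elim z)
      note h = elim(2)
      have gz': "(z - y) \<bullet> G - e / 2 * norm (z - y) \<le> g z - g y"
        using elim(1) unfolding real_norm_def by linarith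
      have "ereal ((a + g y) + (d + G) \<bullet> (z - y) - e * norm (z - y))
          \<le> ereal (a + d \<bullet> (z - y) - e / 2 * norm (z - y)) + ereal (g z)"
        using gz' by (simp add: inner_add_left inner_commute[of G])
      also have "\<dots> \<le> h z + ereal (g z)"
        using h by (intro add_right_mono)
      finally show ?case .
    qed
  qed
  then show ?thesis
    unfolding frechet_subdiff_iff using a by auto
qed

lemma frechet_subdiff_fst:
  fixes h :: "'a::euclidean_space \<Rightarrow> ereal" and w :: "'b::euclidean_space"
  assumes "d \<in> frechet_subdiff h u"
  shows "(d, 0) \<in> frechet_subdiff (\<lambda>z. h (fst z)) (u, w)"
proof -
  obtain a where a: "h u = ereal a"
    and ev: "\<And>e. e > 0 \<Longrightarrow> \<forall>\<^sub>F z in at u. ereal (a + d \<bullet> (z - u) - e * norm (z - u)) \<le> h z"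
    using assms unfolding frechet_subdiff_iff by auto
  have "\<forall>\<^sub>F z in at (u, w). ereal (a + (d, 0) \<bullet> (z - (u, w)) - e * norm (z - (u, w))) \<le> h (fst z)"
    if "e > 0" for e
  proof -
    \<comment> \<open>The inequality is trivial at \<open>u\<close>, so it passes to
      \<open>nhds u\<close>; this matters because \<open>fst z\<close> may equal \<open>u\<close>
      although \<open>z\<close> differs from \<open>(u, w)\<close>.\<close>
    have "\<forall>\<^sub>F z in nhds u. ereal (a + d \<bullet> (z - u) - e * norm (z - u)) \<le> h z"
      using ev[OF that] by (auto simp: eventually_at_filter a elim!: eventually_mono)
    then have "\<forall>\<^sub>F z in at (u, w). ereal (a + d \<bullet> (fst z - u) - e * norm (fst z - u)) \<le> h (fst z)"
      by (rule eventually_compose_filterlim)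
        (auto intro!: tendsto_eq_intros)
    then show ?thesis
    proof eventually_elim
      case (elim z)
      have "norm (fst z - u) \<le> norm (z - (u, w))"
        using norm_fst_le[of "fst z - u" "snd z - w"] by (cases z) auto
      then have "ereal (a + (d, 0) \<bullet> (z - (u, w)) - e * norm (z - (u, w)))
          \<le> ereal (a + d \<bullet> (fst z - u) - e * norm (fst z - u))"
        using that by (cases z) simp
      then show ?case using elim order_trans by blast
    qed
  qed
  then show ?thesis unfolding frechet_subdiff_iff using a by auto
qed

lemma frechet_subdiff_global_min:
  assumes "\<bar>h y\<bar> \<noteq> \<infinity>" "\<And>z. h y \<le> h z"
  shows "0 \<in> frechet_subdiff h y"
  unfolding frechet_subdiff_iff
proof -
  obtain a where a: "h y = ereal a" using assms(1) by auto
  have "ereal (a + 0 \<bullet> (z - y) - e * norm (z - y)) \<le> h z" if "e > 0" for e z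
  proof -
    have "ereal (a + 0 \<bullet> (z - y) - e * norm (z - y)) \<le> ereal a" using that by simp
    also have "\<dots> \<le> h z" using assms(2) a by metis
    finally show ?thesis .
  qed
  then show "\<exists>a. h y = ereal a \<and> (\<forall>e>0. \<forall>\<^sub>F z in at y. ereal (a + 0 \<bullet> (z - y) - e * norm (z - y)) \<le> h z)"
    using a by auto
qed

text \<open>On the segment from \<open>x\<close> to \<open>z\<close> convexity bounds the increment
  of \<open>g\<close> by \<open>t\<close> times the full one, and the local minorant scales with
  \<open>t\<close> as well; dividing by a small \<open>t\<close> makes the local bound
  global.\<close>

lemma frechet_subdiff_convexD:
  fixes g :: "'a::euclidean_space \<Rightarrow> real"
  assumes conv: "convex_on UNIV g" and d: "d \<in> frechet_subdiff (\<lambda>z. ereal (g z)) x"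
  shows "g x + d \<bullet> (z - x) \<le> g z"
proof (cases "z = x")
  case False
  have "g x + d \<bullet> (z - x) - e \<le> g z" if "e > 0" for e
  proof -
    define e' where "e' = e / norm (z - x)"
    have e': "e' > 0" "e' * norm (z - x) = e" using that False by (auto simp: e'_def)
    have "\<forall>\<^sub>F v in at x. g x + d \<bullet> (v - x) - e' * norm (v - x) \<le> g v"
      using d e'(1) unfolding frechet_subdiff_iff by auto
    then have "\<forall>\<^sub>F v in nhds x. g x + d \<bullet> (v - x) - e' * norm (v - x) \<le> g v"
      by (auto simp: eventually_at_filter elim!: eventually_mono)
    then have "\<forall>\<^sub>F t in at_right 0. g x + d \<bullet> (x + t *\<^sub>R (z - x) - x)
        - e' * norm (x + t *\<^sub>R (z - x) - x) \<le> g (x + t *\<^sub>R (z - x))"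
      by (rule eventually_compose_filterlim) (auto intro!: tendsto_eq_intros)
    moreover have "\<forall>\<^sub>F t in at_right (0::real). t < 1" "\<forall>\<^sub>F t in at_right (0::real). t > 0"
      by (auto simp: eventually_at_right_less intro: eventually_at_right_real[of 0 1, THEN eventually_mono])
    ultimately have "\<forall>\<^sub>F t in at_right (0::real). g x + d \<bullet> (z - x) - e \<le> g z"
    proof eventually_elim
      case (elim t)
      have "g x + t * (d \<bullet> (z - x)) - t * e \<le> g (x + t *\<^sub>R (z - x))"
        using elim by (simp add: mult.left_commute[of e'] flip: e'(2))
      also have "x + t *\<^sub>R (z - x) = (1 - t) *\<^sub>R x + t *\<^sub>R z" by (simp add: algebra_simps)
      also have "g \<dots> \<le> (1 - t) * g x + t * g z"
        using conv elim by (intro convex_onD) auto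
      finally have "t * (g x + d \<bullet> (z - x) - e) \<le> t * g z" by (simp add: algebra_simps)
      then show ?case using elim by simp
    qed
    then show ?thesis by simp
  qed
  then show ?thesis by (meson diff_le_eq field_le_epsilon)
qed simp

lemma frechet_subdiff_convexI:
  fixes g :: "'a::euclidean_space \<Rightarrow> real"
  assumes "\<And>z. g x + d \<bullet> (z - x) \<le> g z"
  shows "d \<in> frechet_subdiff (\<lambda>z. ereal (g z)) x"
proof -
  have "g x + d \<bullet> (z - x) - e * norm (z - x) \<le> g z" if "e > 0" for e z
    using assms[of z] that by (smt (verit) mult_nonneg_nonneg norm_ge_zero)
  then show ?thesis unfolding frechet_subdiff_iff by auto
qed

text \<open>A global affine minorant survives limits of base points and slopes, so the limiting
  construction adds nothing to the convex subdifferential.\<close>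

lemma limiting_subdiff_convex_iff:
  fixes g :: "'a::euclidean_space \<Rightarrow> real"
  assumes conv: "convex_on UNIV g"
  shows "d \<in> limiting_subdiff (\<lambda>z. ereal (g z)) x \<longleftrightarrow> (\<forall>z. g x + d \<bullet> (z - x) \<le> g z)"
proof
  assume "d \<in> limiting_subdiff (\<lambda>z. ereal (g z)) x"
  then obtain X D where X: "X \<longlonglongrightarrow> x" "(\<lambda>k. g (X k)) \<longlonglongrightarrow> g x" "D \<longlonglongrightarrow> d"
    and D: "\<And>k. D k \<in> frechet_subdiff (\<lambda>z. ereal (g z)) (X k)"
    unfolding limiting_subdiff_def by auto
  show "\<forall>z. g x + d \<bullet> (z - x) \<le> g z"
  proof
    fix z
    have "(\<lambda>k. g (X k) + D k \<bullet> (z - X k)) \<longlonglongrightarrow> g x + d \<bullet> (z - x)"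
      by (intro tendsto_intros X)
    then show "g x + d \<bullet> (z - x) \<le> g z"
      by (rule LIMSEQ_le_const2) (use frechet_subdiff_convexD[OF conv D] in auto)
  qed
next
  assume "\<forall>z. g x + d \<bullet> (z - x) \<le> g z"
  then show "d \<in> limiting_subdiff (\<lambda>z. ereal (g z)) x"
    using frechet_subdiff_convexI frechet_subdiff_subset_limiting by blast
qed

text \<open>\<open>x\<close> minimises \<open>g\<close> minus the affine function with slope
  \<open>d\<close>, so the derivative vanishes there; testing it on \<open>G - d\<close> gives the
  claim. This later turns the arbitrary choice \<open>\<xi> k\<close> into the gradient of
  \<open>P2\<close>.\<close>

lemma convex_subgradient_eq_gradient:
  fixes g :: "'a::euclidean_space \<Rightarrow> real"
  assumes sub: "\<And>z. g x + d \<bullet> (z - x) \<le> g z" and der: "GDERIV g x :> G"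
  shows "d = G"
proof -
  have "((\<lambda>z. g z - d \<bullet> (z - x)) has_derivative (\<lambda>h. h \<bullet> G - d \<bullet> h)) (at x)"
    using der unfolding gderiv_def by (auto intro!: derivative_eq_intros)
  moreover have "\<forall>z\<in>UNIV. g x - d \<bullet> (x - x) \<le> g z - d \<bullet> (z - x)"
    using sub by (auto simp: le_diff_eq)
  ultimately have "(\<lambda>h. h \<bullet> G - d \<bullet> h) = (\<lambda>h. 0)"
    by (intro differential_zero_maxmin[of x UNIV "\<lambda>z. g z - d \<bullet> (z - x)"]) auto
  then have "(G - d) \<bullet> G - d \<bullet> (G - d) = 0" by metis
  then have "(G - d) \<bullet> (G - d) = 0" by (simp add: algebra_simps inner_commute)
  then show ?thesis by simp
qed

text \<open>One unit step in the direction of \<open>d\<close> raises the minorant by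
  \<open>norm d\<close>, while \<open>g\<close> varies by at most \<open>2 * B\<close> on the unit
  ball.\<close>

lemma convex_subgradient_norm_le:
  fixes g :: "'a::euclidean_space \<Rightarrow> real"
  assumes sub: "\<And>z. g x + d \<bullet> (z - x) \<le> g z"
    and bound: "\<And>z. norm (z - x) \<le> 1 \<Longrightarrow> \<bar>g z\<bar> \<le> B"
  shows "norm d \<le> 2 * B"
proof (cases "d = 0")
  case True
  then show ?thesis using bound[of x] by auto
next
  case False
  have "d \<bullet> sgn d = norm d"
    using False by (simp add: sgn_div_norm dot_square_norm power2_eq_square)
  then show ?thesis
    using sub[of "x + sgn d"] bound[of "x + sgn d"] bound[of x] False
    by (simp add: norm_sgn)
qed

lemma potential_frechet_subgradient:
  fixes F :: "'a::euclidean_space \<Rightarrow> ereal"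
  assumes "d \<in> frechet_subdiff F u"
  shows "(d + (\<delta> * \<gamma> / 4) *\<^sub>R (u - v), - ((\<delta> * \<gamma> / 4) *\<^sub>R (u - v)), \<delta> / 8 * (norm (u - v))\<^sup>2)
           \<in> frechet_subdiff (potential F \<delta>) (u, v, \<gamma>)"
proof -
  \<comment> \<open>The squared norm is written as an inner product, so that the differentiation
    rules apply also where the two points coincide.\<close>
  define q where "q z = \<delta> * snd (snd z) / 8 * ((fst z - fst (snd z)) \<bullet> (fst z - fst (snd z)))"
    for z :: "'a \<times> 'a \<times> real"
  have "potential F \<delta> = (\<lambda>z. F (fst z) + ereal (q z))"
    by (auto simp: potential_def q_def dot_square_norm)
  moreover have "GDERIV q (u, v, \<gamma>) :>
      ((\<delta> * \<gamma> / 4) *\<^sub>R (u - v), - ((\<delta> * \<gamma> / 4) *\<^sub>R (u - v)), \<delta> / 8 * ((u - v) \<bullet> (u - v)))"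
    unfolding q_def gderiv_def
    by (auto intro!: derivative_eq_intros simp: fun_eq_iff field_simps inner_commute inner_diff_left inner_diff_right)
  moreover have "(d, 0) \<in> frechet_subdiff (\<lambda>z. F (fst z)) (u, v, \<gamma>)"
    using assms by (rule frechet_subdiff_fst)
  ultimately show ?thesis
    using frechet_subdiff_add_smooth by (fastforce simp: dot_square_norm zero_prod_def)
qed

text \<open>Regrouping as \<open>P1\<close> plus the smooth \<open>f - P2\<close> is what permits a
  subgradient of a difference; it requires \<open>P2\<close> to be differentiable at
  \<open>u\<close>, hence the smooth neighbourhood of the stationary points.\<close>

lemma objective_frechet_subgradient:
  assumes d: "d \<in> frechet_subdiff P1 u" and f: "GDERIV f u :> a" and P2: "GDERIV P2 u :> b"
  shows "d + (a - b) \<in> frechet_subdiff (objective f P1 P2) u"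
proof -
  have "objective f P1 P2 z = P1 z + ereal (f z - P2 z)" for z
    by (cases "P1 z") (auto simp: objective_def)
  then have "objective f P1 P2 = (\<lambda>z. P1 z + ereal (f z - P2 z))" by blast
  then show ?thesis
    using frechet_subdiff_add_smooth[OF d GDERIV_diff[OF f P2]] by simp
qed

section \<open>The Kurdyka-Lojasiewicz inequality on compact sets\<close>

text \<open>Differentiating \<open>a * t powr (1 - \<theta>)\<close> turns the inequality into a
  power bound with \<open>M = a * (1 - \<theta>)\<close>; since \<open>dist0\<close> is an infimum,
  the norm of any single subgradient may replace it.\<close>

lemma KL_exponent_inequality:
  fixes h :: "'a::euclidean_space \<Rightarrow> ereal"
  assumes KL: "KL_function_exponent_on U h \<theta>" and \<theta>: "\<theta> < 1"
    and s: "s \<in> U" "limiting_subdiff h s \<noteq> {}" "h s = ereal l"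
  obtains V \<nu> M where "open V" "s \<in> V" "\<nu> > 0"
    "\<forall>y t d. y \<in> V \<and> h y = ereal t \<and> l < t \<and> t < l + \<nu> \<and> d \<in> limiting_subdiff h y \<longrightarrow>
       (t - l) powr \<theta> \<le> M * norm d"
proof -
  obtain \<nu> a where \<nu>: "\<nu> > 0" and a: "a > 0" and ineq: "KL_inequality h s \<nu> (\<lambda>t. a * t powr (1 - \<theta>))"
    using KL s(1,2) unfolding KL_function_exponent_on_def by blast
  from ineq obtain V where V: "open V" "s \<in> V" and
    Vy: "\<And>y. \<lbrakk>y \<in> V; h s < h y; h y < h s + \<nu>\<rbrakk> \<Longrightarrow>
      ereal (deriv (\<lambda>t. a * t powr (1 - \<theta>)) (real_of_ereal (h y - h s))) * dist0 (limiting_subdiff h y) \<ge> 1"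
    unfolding KL_inequality_def by blast
  \<comment> \<open>\<open>\<nu>\<close> may be infinite; a finite positive number below it gives a
    window in real terms.\<close>
  obtain \<nu>' where \<nu>': "\<nu>' > 0" "ereal \<nu>' < \<nu>"
    using ereal_dense2[OF \<nu>] by (metis ereal_less(2))
  have "(t - l) powr \<theta> \<le> a * (1 - \<theta>) * norm d"
    if y: "y \<in> V" "h y = ereal t" "l < t" "t < l + \<nu>'" "d \<in> limiting_subdiff h y" for y t d
  proof -
    have "ereal t < ereal l + \<nu>"
      using y(4) \<nu>'(2) by (cases \<nu>) auto
    then have 1: "1 \<le> ereal (deriv (\<lambda>t. a * t powr (1 - \<theta>)) (t - l)) * dist0 (limiting_subdiff h y)"
      using Vy[OF y(1)] y s(3) by simp
    have "((\<lambda>t. a * t powr (1 - \<theta>)) has_real_derivative a * ((1 - \<theta>) * (t - l) powr (1 - \<theta> - 1))) (at (t - l))"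
      using y(3) by (intro DERIV_cmult has_real_derivative_powr) auto
    then have deriv: "deriv (\<lambda>t. a * t powr (1 - \<theta>)) (t - l) = a * (1 - \<theta>) * (t - l) powr (- \<theta>)"
      by (simp add: DERIV_imp_deriv)
    have "dist0 (limiting_subdiff h y) \<le> ereal (norm d)"
      unfolding dist0_def using y(5) by (intro INF_lower2[of d]) auto
    then have "ereal (a * (1 - \<theta>) * (t - l) powr (- \<theta>)) * dist0 (limiting_subdiff h y)
        \<le> ereal (a * (1 - \<theta>) * (t - l) powr (- \<theta>)) * ereal (norm d)"
      using a \<theta> by (intro ereal_mult_left_mono) auto
    with 1 have "1 \<le> ereal (a * (1 - \<theta>) * (t - l) powr (- \<theta>) * norm d)"
      unfolding deriv by (metis order_trans times_ereal.simps(1))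
    then have "1 \<le> (t - l) powr (- \<theta>) * (a * (1 - \<theta>) * norm d)"
      by (simp add: one_ereal_def mult_ac)
    then have "(t - l) powr \<theta> * 1 \<le> (t - l) powr \<theta> * ((t - l) powr (- \<theta>) * (a * (1 - \<theta>) * norm d))"
      by (intro mult_left_mono) auto
    moreover have "(t - l) powr \<theta> * (t - l) powr (- \<theta>) = 1"
      using y(3) by (simp add: powr_minus)
    ultimately show ?thesis by (simp add: mult.assoc[symmetric])
  qed
  then show ?thesis using that V \<nu>'(1) by blast
qed

text \<open>The potential is constant along \<open>(z, z, \<gamma>)\<close>, and the step sizes only stay in a compact
  interval, so the desingularizing constants have to be made uniform in \<open>\<gamma>\<close>.\<close>

lemma KL_exponent_uniform:
  fixes h :: "'a::euclidean_space \<Rightarrow> ereal"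
  assumes KL: "KL_function_exponent_on U h \<theta>" and \<theta>: "\<theta> < 1"
    and S: "compact S" "S \<subseteq> U" "\<And>s. s \<in> S \<Longrightarrow> limiting_subdiff h s \<noteq> {}" "\<And>s. s \<in> S \<Longrightarrow> h s = ereal l"
  obtains \<epsilon> M where "\<epsilon> > 0" "M > 0"
    "\<forall>s y t d. s \<in> S \<and> dist y s < \<epsilon> \<and> h y = ereal t \<and> l < t \<and> t < l + \<epsilon> \<and>
       d \<in> limiting_subdiff h y \<longrightarrow> (t - l) powr \<theta> \<le> M * norm d"
proof -
  \<comment> \<open>One natural number is reciprocal radius, reciprocal window and constant at once,
    so failure for every \<open>n\<close> produces a single sequence of violations. Its centres
    accumulate at some \<open>s0\<close>, whose own KL neighbourhood contradicts the late
    terms.\<close>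
  have "\<exists>n::nat. \<forall>s y t d. s \<in> S \<and> dist y s < 1 / Suc n \<and> h y = ereal t \<and> l < t \<and> t < l + 1 / Suc n \<and>
      d \<in> limiting_subdiff h y \<longrightarrow> (t - l) powr \<theta> \<le> Suc n * norm d"
  proof (rule ccontr)
    assume "\<not> ?thesis"
    then have "\<forall>n::nat. \<exists>s y t d. s \<in> S \<and> dist y s < 1 / Suc n \<and> h y = ereal t \<and> l < t \<and> t < l + 1 / Suc n \<and>
      d \<in> limiting_subdiff h y \<and> (t - l) powr \<theta> > Suc n * norm d" by (simp add: not_le)
    then obtain s y t d where bad: "\<And>n::nat. s n \<in> S" "\<And>n. dist (y n) (s n) < 1 / Suc n"
      "\<And>n. h (y n) = ereal (t n)" "\<And>n. l < t n" "\<And>n. t n < l + 1 / Suc n"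
      "\<And>n. d n \<in> limiting_subdiff h (y n)" "\<And>n. (t n - l) powr \<theta> > Suc n * norm (d n)"
      by metis
    have "\<forall>n. s n \<in> S" using bad(1) by blast
    then obtain s0 \<sigma> where s0: "s0 \<in> S" and \<sigma>: "strict_mono \<sigma>" "(s \<circ> \<sigma>) \<longlonglongrightarrow> s0"
      using S(1) unfolding compact_def by metis
    obtain V \<nu> M where V: "open V" "s0 \<in> V" and \<nu>: "\<nu> > 0" and
      ineq: "\<forall>y t d. y \<in> V \<and> h y = ereal t \<and> l < t \<and> t < l + \<nu> \<and> d \<in> limiting_subdiff h y \<longrightarrow>
        (t - l) powr \<theta> \<le> M * norm d"
      by (rule KL_exponent_inequality[OF KL \<theta> subsetD[OF S(2) s0] S(3)[OF s0] S(4)[OF s0]])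
    have inv: "(\<lambda>n. 1 / real (Suc (\<sigma> n))) \<longlonglongrightarrow> 0"
      using LIMSEQ_subseq_LIMSEQ[OF LIMSEQ_Suc[OF lim_1_over_n] \<sigma>(1)] by (simp add: o_def)
    have "(\<lambda>n. dist (y (\<sigma> n)) (s (\<sigma> n))) \<longlonglongrightarrow> 0"
      by (rule tendsto_sandwich[OF _ _ tendsto_const inv]) (use less_imp_le[OF bad(2)] in auto)
    then have "(\<lambda>n. y (\<sigma> n) - s (\<sigma> n)) \<longlonglongrightarrow> 0"
      unfolding dist_norm by (rule tendsto_norm_zero_cancel)
    from tendsto_add[OF this \<sigma>(2)[unfolded o_def]] have "(\<lambda>n. y (\<sigma> n)) \<longlonglongrightarrow> s0" by simp
    then have "\<forall>\<^sub>F n in sequentially. y (\<sigma> n) \<in> V" using V by (rule topological_tendstoD)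
    moreover have "\<forall>\<^sub>F n in sequentially. 1 / real (Suc (\<sigma> n)) < \<nu>"
      using \<nu> by (rule order_tendstoD(2)[OF inv])
    moreover have "\<forall>\<^sub>F n in sequentially. \<sigma> n \<ge> nat \<lceil>M\<rceil>"
      using filterlim_subseq[OF \<sigma>(1)] unfolding filterlim_at_top by blast
    ultimately have "\<forall>\<^sub>F n in sequentially. False"
    proof eventually_elim
      case (elim n)
      have "(t (\<sigma> n) - l) powr \<theta> \<le> M * norm (d (\<sigma> n))"
        using ineq elim bad(3,4,6)[of "\<sigma> n"] bad(5)[of "\<sigma> n"] by auto
      also have "M \<le> real (Suc (\<sigma> n))" using elim(3) by linarith
      then have "M * norm (d (\<sigma> n)) \<le> Suc (\<sigma> n) * norm (d (\<sigma> n))" by (intro mult_right_mono) auto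
      finally show False using bad(7)[of "\<sigma> n"] by simp
    qed
    then show False by simp
  qed
  then obtain n :: nat where n: "\<forall>s y t d. s \<in> S \<and> dist y s < 1 / Suc n \<and> h y = ereal t \<and> l < t \<and> t < l + 1 / Suc n \<and>
      d \<in> limiting_subdiff h y \<longrightarrow> (t - l) powr \<theta> \<le> Suc n * norm d" by blast
  show ?thesis by (rule that[of "1 / Suc n" "Suc n"]) (use n in auto)
qed

section \<open>A scalar recursion\<close>

text \<open>At the intermediate point of the mean value theorem, \<open>z powr (s - 1)\<close> is at
  least \<open>a powr (s - 1)\<close> because \<open>s \<le> 1\<close>; the sign of \<open>s\<close>
  decides which way the inequality turns.\<close>

lemma powr_diff_ge_real:
  fixes a b s :: real
  assumes "0 < b" "b \<le> a" "s \<le> 1"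
  shows "s \<ge> 0 \<Longrightarrow> s * a powr (s - 1) * (a - b) \<le> a powr s - b powr s"
    and "s \<le> 0 \<Longrightarrow> a powr s - b powr s \<le> s * a powr (s - 1) * (a - b)"
proof -
  obtain z where z: "0 < z" "z \<le> a" "a powr s - b powr s = (a - b) * (s * z powr (s - 1))"
  proof (cases "a = b")
    case False
    then have "b < a" using assms by simp
    then obtain z where "b < z" "z < a" "a powr s - b powr s = (a - b) * (s * z powr (s - 1))"
      using MVT2[of b a "\<lambda>t. t powr s" "\<lambda>t. s * t powr (s - 1)"] assms(1)
      by (auto simp: has_real_derivative_powr)
    then show ?thesis using assms(1) by (intro that[of z]) auto
  qed (use assms in \<open>auto intro: that[of a]\<close>)
  have *: "(a - b) * a powr (s - 1) \<le> (a - b) * z powr (s - 1)"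
    using z assms by (intro mult_left_mono powr_mono2') auto
  show "s * a powr (s - 1) * (a - b) \<le> a powr s - b powr s" if "s \<ge> 0"
    using mult_left_mono[OF * that] z(3) by (simp add: mult_ac)
  show "a powr s - b powr s \<le> s * a powr (s - 1) * (a - b)" if "s \<le> 0"
    using mult_left_mono_neg[OF * that] z(3) by (simp add: mult_ac)
qed

text \<open>If \<open>a\<close> and \<open>b\<close> are comparable, this is the mean value theorem; otherwise \<open>a - b\<close> is comparable
  with \<open>a\<close>. No arithmetic-geometric mean step is needed, and the bound telescopes directly.\<close>

lemma sqrt_diff_le_powr_diff:
  fixes \<alpha> C :: real
  assumes "1 \<le> \<alpha>" "\<alpha> < 2" "C > 0"
  obtains M where "M > 0"
    "\<And>a b. \<lbrakk>0 \<le> b; b \<le> a; a \<le> 1; b powr \<alpha> \<le> C * (a - b)\<rbrakk> \<Longrightarrow>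
       sqrt (a - b) \<le> M * (a powr (1 - \<alpha> / 2) - b powr (1 - \<alpha> / 2))"
proof -
  define s where "s = 1 - \<alpha> / 2"
  have s: "0 < s" "s \<le> 1 / 2" using assms by (auto simp: s_def)
  \<comment> \<open>\<open>M1\<close> serves \<open>2 * b < a\<close>, where
    \<open>sqrt a \<le> a powr s\<close> and \<open>b powr s\<close> is at most
    \<open>2 powr (- s)\<close> times \<open>a powr s\<close>. \<open>M2\<close> serves
    \<open>a \<le> 2 * b\<close>, where the hypothesis bounds \<open>a powr (\<alpha> / 2)\<close>
    by a multiple of \<open>sqrt (a - b)\<close>.\<close>
  define M1 where "M1 = 1 / (1 - 2 powr (- s))"
  define M2 where "M2 = 2 powr (\<alpha> / 2) * sqrt C / s"
  have "2 powr (- s) < 1" using s by (simp add: powr_less_one)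
  then have M1: "M1 > 0" "M1 * (1 - 2 powr (- s)) = 1" by (auto simp: M1_def)
  have M2: "M2 > 0" using s assms by (auto simp: M2_def)
  show ?thesis
  proof (rule that[of "max M1 M2"])
    show "max M1 M2 > 0" using M1 by simp
  next
    fix a b :: real
    assume ab: "0 \<le> b" "b \<le> a" "a \<le> 1" and h: "b powr \<alpha> \<le> C * (a - b)"
    have nonneg: "0 \<le> a powr s - b powr s"
      using powr_mono2[of s b a] ab s by simp
    consider "a \<le> 2 * b" "b > 0" | "2 * b < a" | "a = 0" "b = 0"
      using ab by linarith
    then have "sqrt (a - b) \<le> max M1 M2 * (a powr s - b powr s)"
    proof cases
      case 1
      have "b powr (\<alpha> / 2) = sqrt (b powr \<alpha>)"
        using 1 by (simp add: powr_half_sqrt[symmetric] powr_powr)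
      also have "\<dots> \<le> sqrt (C * (a - b))" using h by simp
      finally have b: "b powr (\<alpha> / 2) \<le> sqrt C * sqrt (a - b)" by (simp add: real_sqrt_mult)
      have "(a / 2) powr (\<alpha> / 2) \<le> b powr (\<alpha> / 2)"
        using 1 ab assms by (intro powr_mono2) auto
      then have "a powr (\<alpha> / 2) \<le> 2 powr (\<alpha> / 2) * b powr (\<alpha> / 2)"
        using 1 ab by (simp add: powr_divide field_simps)
      also have "\<dots> \<le> 2 powr (\<alpha> / 2) * (sqrt C * sqrt (a - b))"
        using b by (intro mult_left_mono) auto
      finally have "a powr (\<alpha> / 2) \<le> M2 * s * sqrt (a - b)"
        using s by (simp add: M2_def)
      then have "a powr (\<alpha> / 2) * sqrt (a - b) \<le> M2 * s * sqrt (a - b) * sqrt (a - b)"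
        using ab by (intro mult_right_mono) auto
      then have "a powr (\<alpha> / 2) * sqrt (a - b) \<le> M2 * s * (a - b)"
        using ab by (simp add: mult.assoc)
      then have "a powr (- (\<alpha> / 2)) * (a powr (\<alpha> / 2) * sqrt (a - b))
          \<le> a powr (- (\<alpha> / 2)) * (M2 * s * (a - b))"
        by (intro mult_left_mono) auto
      moreover have "a powr (- (\<alpha> / 2)) * a powr (\<alpha> / 2) = 1"
        using 1 ab by (simp add: powr_minus)
      ultimately have "sqrt (a - b) \<le> a powr (- (\<alpha> / 2)) * (M2 * s * (a - b))"
        unfolding mult.assoc[symmetric, of "a powr (- (\<alpha> / 2))" "a powr (\<alpha> / 2)"] by simp
      also have "\<dots> = M2 * (s * a powr (s - 1) * (a - b))" by (simp add: s_def)
      also have "\<dots> \<le> M2 * (a powr s - b powr s)"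
        using powr_diff_ge_real(1)[of b a s] 1 ab s M2 by (intro mult_left_mono) auto
      also have "\<dots> \<le> max M1 M2 * (a powr s - b powr s)"
        using nonneg by (intro mult_right_mono) auto
      finally show ?thesis .
    next
      case 2
      have "b powr s \<le> (a / 2) powr s" using 2 ab s by (intro powr_mono2) auto
      also have "\<dots> = a powr s * 2 powr (- s)"
        using 2 ab by (simp add: powr_divide powr_minus_divide)
      finally have *: "a powr s * (1 - 2 powr (- s)) \<le> a powr s - b powr s"
        by (simp add: algebra_simps)
      have "sqrt (a - b) \<le> sqrt a" using ab by simp
      also have "\<dots> = a powr (1 / 2)" using ab by (simp add: powr_half_sqrt)
      also have "\<dots> \<le> a powr s" using s ab by (intro powr_mono') auto
      also have "\<dots> = M1 * (a powr s * (1 - 2 powr (- s)))" using M1(2) by simp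
      also have "\<dots> \<le> M1 * (a powr s - b powr s)"
        using * M1(1) by (intro mult_left_mono) auto
      also have "\<dots> \<le> max M1 M2 * (a powr s - b powr s)"
        using nonneg by (intro mult_right_mono) auto
      finally show ?thesis .
    qed simp
    then show "sqrt (a - b) \<le> max M1 M2 * (a powr (1 - \<alpha> / 2) - b powr (1 - \<alpha> / 2))"
      by (simp add: s_def)
  qed
qed

text \<open>Discrete form of the differential inequality
  \<open>u' \<le> - (u powr \<alpha>) / C\<close>, along which \<open>u powr (1 - \<alpha>)\<close>
  grows at least linearly. For comparable \<open>a\<close> and \<open>b\<close> the mean value
  theorem gives \<open>c1\<close>; if \<open>b\<close> is below \<open>a / 2\<close>, the power
  grows by the factor \<open>2 powr (\<alpha> - 1)\<close>, and \<open>a \<le> 1\<close> turns this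
  into the additive \<open>c2\<close>.\<close>

lemma powr_neg_diff_ge:
  fixes \<alpha> C :: real
  assumes "1 < \<alpha>" "C > 0"
  obtains c where "c > 0"
    "\<And>a b. \<lbrakk>0 < b; b \<le> a; a \<le> 1; b powr \<alpha> \<le> C * (a - b)\<rbrakk> \<Longrightarrow>
       a powr (1 - \<alpha>) + c \<le> b powr (1 - \<alpha>)"
proof -
  define c1 where "c1 = (\<alpha> - 1) * 2 powr (- \<alpha>) / C"
  define c2 where "c2 = 2 powr (\<alpha> - 1) - 1"
  have c1: "c1 > 0" using assms by (simp add: c1_def)
  have c2: "c2 > 0" using assms by (simp add: c2_def)
  show ?thesis
  proof (rule that[of "min c1 c2"])
    show "min c1 c2 > 0" using c1 c2 by simp
  next
    fix a b :: real
    assume ab: "0 < b" "b \<le> a" "a \<le> 1" and h: "b powr \<alpha> \<le> C * (a - b)"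
    show "a powr (1 - \<alpha>) + min c1 c2 \<le> b powr (1 - \<alpha>)"
    proof (cases "a \<le> 2 * b")
      case True
      have "2 powr (- \<alpha>) * b powr (- \<alpha>) = (2 * b) powr (- \<alpha>)"
        using ab by (simp add: powr_mult)
      also have "\<dots> \<le> a powr (- \<alpha>)"
        using True ab assms by (intro powr_mono2') auto
      finally have *: "2 powr (- \<alpha>) * b powr (- \<alpha>) \<le> a powr (- \<alpha>)" .
      have "1 / C = b powr (- \<alpha>) * (b powr \<alpha> / C)"
        using ab by (simp add: powr_minus)
      also have "\<dots> \<le> b powr (- \<alpha>) * (a - b)"
        using h assms by (intro mult_left_mono) (auto simp: field_simps)
      finally have "(\<alpha> - 1) * 2 powr (- \<alpha>) * (1 / C)
          \<le> (\<alpha> - 1) * 2 powr (- \<alpha>) * (b powr (- \<alpha>) * (a - b))"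
        using assms by (intro mult_left_mono) auto
      also have "\<dots> = (\<alpha> - 1) * (2 powr (- \<alpha>) * b powr (- \<alpha>)) * (a - b)" by simp
      also have "\<dots> \<le> (\<alpha> - 1) * a powr (- \<alpha>) * (a - b)"
        using * ab assms by (intro mult_right_mono mult_left_mono) auto
      also have "\<dots> \<le> b powr (1 - \<alpha>) - a powr (1 - \<alpha>)"
        using powr_diff_ge_real(2)[of b a "1 - \<alpha>"] ab assms by (simp add: algebra_simps)
      finally show ?thesis by (simp add: c1_def)
    next
      case False
      have "2 powr (\<alpha> - 1) * a powr (1 - \<alpha>) = (a / 2) powr (1 - \<alpha>)"
        using ab by (simp add: powr_divide powr_diff)
      also have "\<dots> \<le> b powr (1 - \<alpha>)"
        using False ab assms by (intro powr_mono2') auto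
      finally have *: "2 powr (\<alpha> - 1) * a powr (1 - \<alpha>) \<le> b powr (1 - \<alpha>)" .
      have "1 \<le> a powr (1 - \<alpha>)"
        using powr_mono2'[of "1 - \<alpha>" a 1] ab assms by simp
      then have "c2 * 1 \<le> c2 * a powr (1 - \<alpha>)" using c2 by (intro mult_left_mono) auto
      then show ?thesis using * by (simp add: c2_def algebra_simps)
    qed
  qed
qed

lemma two_step_linear_decay:
  fixes r :: "nat \<Rightarrow> real"
  assumes anti: "antimono r" and nonneg: "\<And>k. 0 \<le> r k" and "C > 0"
    and step: "\<And>k. r (k + 2) \<le> C * (r k - r (k + 2))"
  obtains A \<rho> where "A > 0" "0 < \<rho>" "\<rho> < 1" "\<And>k. r k \<le> A * \<rho> ^ k"
proof -
  \<comment> \<open>The recursion contracts by \<open>C / (1 + C)\<close> over two indices, hence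
    the square root per index. In \<open>A\<close>, division by \<open>\<rho>\<close> pays for index
    1, and the added 1 keeps it positive if \<open>r 0 = 0\<close>.\<close>
  define \<rho> where "\<rho> = sqrt (C / (1 + C))"
  have \<rho>: "0 < \<rho>" "\<rho> < 1" "\<rho> ^ 2 = C / (1 + C)" using \<open>C > 0\<close> by (auto simp: \<rho>_def)
  define A where "A = (r 0 + 1) / \<rho>"
  have A: "A > 0" using nonneg[of 0] \<rho> by (auto simp: A_def)
  have two: "r (k + 2) \<le> \<rho> ^ 2 * r k" for k
    using step[of k] \<open>C > 0\<close> unfolding \<rho>(3) by (simp add: field_simps)
  have "r k \<le> A * \<rho> ^ k \<and> r (Suc k) \<le> A * \<rho> ^ Suc k" for k
  proof (induction k)
    case 0
    have "r 0 * \<rho> \<le> r 0 + 1" using mult_left_le[of \<rho> "r 0"] nonneg[of 0] \<rho> by simp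
    then have "r 0 \<le> A" using \<rho> by (simp add: A_def pos_le_divide_eq)
    moreover have "r (Suc 0) \<le> r 0" using anti by (simp add: antimonoD)
    ultimately show ?case using \<rho> by (simp add: A_def)
  next
    case (Suc k)
    have "r (Suc (Suc k)) \<le> \<rho> ^ 2 * r k" using two[of k] by simp
    also have "\<dots> \<le> \<rho> ^ 2 * (A * \<rho> ^ k)" using Suc by (intro mult_left_mono) auto
    finally show ?case using Suc by (simp add: power2_eq_square mult_ac)
  qed
  then show ?thesis using that A \<rho> by blast
qed

lemma two_step_sublinear_decay:
  fixes r :: "nat \<Rightarrow> real"
  assumes anti: "antimono r" and nonneg: "\<And>k. 0 \<le> r k" and le1: "r 0 \<le> 1"
    and "C > 0" "1 < \<alpha>"
    and step: "\<And>k. r (k + 2) powr \<alpha> \<le> C * (r k - r (k + 2))"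
  obtains c where "c > 0" "\<And>k. k > 0 \<Longrightarrow> r k \<le> (c * real k) powr (- (1 / (\<alpha> - 1)))"
proof -
  obtain c where c: "c > 0" and gap: "\<And>a b. \<lbrakk>0 < b; b \<le> a; a \<le> 1; b powr \<alpha> \<le> C * (a - b)\<rbrakk> \<Longrightarrow>
       a powr (1 - \<alpha>) + c \<le> b powr (1 - \<alpha>)"
    using powr_neg_diff_ge[OF \<open>1 < \<alpha>\<close> \<open>C > 0\<close>] by blast
  \<comment> \<open>Each gain \<open>c\<close> spans two indices, hence the half. The cap at 1
    serves the start at index 1, where only \<open>1 \<le> r 1 powr (1 - \<alpha>)\<close> is
    known.\<close>
  define c' where "c' = min c 2 / 2"
  have c': "c' > 0" "2 * c' \<le> c" "c' \<le> 1" using c by (auto simp: c'_def)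
  have le1': "r k \<le> 1" for k using antimonoD[OF anti, of 0 k] le1 by simp
  have pos: "r k > 0" if "r (k + i) > 0" for k i
    using antimonoD[OF anti, of k "k + i"] that by simp
  have ge1: "1 \<le> r k powr (1 - \<alpha>)" if "r k > 0" for k
    using powr_mono2'[of "1 - \<alpha>" "r k" 1] that le1'[of k] \<open>1 < \<alpha>\<close> by simp
  \<comment> \<open>The guards are essential since \<open>0 powr (1 - \<alpha>)\<close> is 0; a
    positive later entry forces the earlier ones to be positive.\<close>
  have *: "(r k > 0 \<longrightarrow> c' * real k \<le> r k powr (1 - \<alpha>)) \<and>
      (r (Suc k) > 0 \<longrightarrow> c' * real (Suc k) \<le> r (Suc k) powr (1 - \<alpha>))" for k
  proof (induction k)
    case 0
    show ?case using ge1[of "Suc 0"] c' by auto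
  next
    case (Suc k)
    have "c' * real (Suc (Suc k)) \<le> r (Suc (Suc k)) powr (1 - \<alpha>)" if h: "r (Suc (Suc k)) > 0"
    proof -
      have "r k powr (1 - \<alpha>) + c \<le> r (k + 2) powr (1 - \<alpha>)"
        using h antimonoD[OF anti, of k "k + 2"] le1'[of k] step[of k] by (intro gap) auto
      moreover have "c' * real k \<le> r k powr (1 - \<alpha>)"
        using pos[of k 2] h Suc by simp
      ultimately show ?thesis using c' by (simp add: algebra_simps)
    qed
    then show ?case using Suc by blast
  qed
  have "r k \<le> (c' * real k) powr (- (1 / (\<alpha> - 1)))" if "k > 0" for k
  proof (cases "r k > 0")
    case True
    have "(r k powr (1 - \<alpha>)) powr (- (1 / (\<alpha> - 1))) \<le> (c' * real k) powr (- (1 / (\<alpha> - 1)))"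
      using * True that c' \<open>1 < \<alpha>\<close> by (intro powr_mono2') auto
    moreover have "(1 - \<alpha>) * (- (1 / (\<alpha> - 1))) = 1" using \<open>1 < \<alpha>\<close> by (simp add: field_simps)
    ultimately show ?thesis using True by (simp add: powr_powr)
  next
    case False
    then show ?thesis using powr_ge_zero[of "c' * real k"] by (meson not_less order_trans)
  qed
  then show ?thesis using that c' by blast
qed

text \<open>The iterates close to \<open>z\<close> move by at most the decrease of \<open>r\<^sup>1\<^sup>-\<^sup>\<alpha>\<^sup>/\<^sup>2\<close>. Once \<open>r\<close> is small this
  keeps the sequence inside the ball where the recursion is available.\<close>

lemma descent_sequence_trapped:
  fixes x :: "nat \<Rightarrow> 'a::real_normed_vector" and r :: "nat \<Rightarrow> real"
  assumes anti: "antimono r" and lim: "r \<longlonglongrightarrow> 0"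
    and "c > 0" and descent: "\<And>k. c * (norm (x (Suc k) - x k))\<^sup>2 \<le> r k - r (Suc k)"
    and sub: "strict_mono \<sigma>" "(x \<circ> \<sigma>) \<longlonglongrightarrow> z"
    and \<alpha>: "1 \<le> \<alpha>" "\<alpha> < 2" and "C > 0" and "e > 0"
    and local: "\<And>k. \<lbrakk>k \<ge> K; norm (x (Suc k) - z) < e\<rbrakk> \<Longrightarrow>
                  r (k + 2) powr \<alpha> \<le> C * (r k - r (k + 2))"
  obtains N M where "M > 0" "r N \<le> 1"
    "\<forall>k\<ge>N. r (k + 2) powr \<alpha> \<le> C * (r k - r (k + 2))"
    "\<forall>k\<ge>N. norm (x (Suc k) - z) \<le> M * r k powr (1 - \<alpha> / 2)"
proof -
  define s where "s = 1 - \<alpha> / 2"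
  have s: "s > 0" using \<alpha> by (simp add: s_def)
  define \<psi> where "\<psi> k = r k powr s" for k
  have nonneg: "0 \<le> r k" for k
    by (rule LIMSEQ_le_const2[OF lim]) (use antimonoD[OF anti, of k] in blast)
  obtain M0 where M0: "M0 > 0" and gap:
    "\<And>a b. \<lbrakk>0 \<le> b; b \<le> a; a \<le> 1; b powr \<alpha> \<le> C * (a - b)\<rbrakk> \<Longrightarrow>
       sqrt (a - b) \<le> M0 * (a powr s - b powr s)"
    using sqrt_diff_le_powr_diff[OF \<alpha> \<open>C > 0\<close>] unfolding s_def by blast
  define M where "M = M0 / sqrt c"
  have M: "M > 0" using M0 \<open>c > 0\<close> by (simp add: M_def)
  have \<psi>_nonneg: "0 \<le> \<psi> k" for k by (simp add: \<psi>_def)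
  have \<psi>_anti: "\<psi> m \<le> \<psi> k" if "k \<le> m" for k m
    using powr_mono2[of s "r m" "r k"] antimonoD[OF anti that] nonneg s by (simp add: \<psi>_def)
  have step: "norm (x (k + 2) - x (Suc k)) \<le> M * (\<psi> k - \<psi> (k + 2))"
    if "r k \<le> 1" "r (k + 2) powr \<alpha> \<le> C * (r k - r (k + 2))" for k
  proof -
    have "sqrt c * norm (x (k + 2) - x (Suc k)) = sqrt (c * (norm (x (Suc (Suc k)) - x (Suc k)))\<^sup>2)"
      using \<open>c > 0\<close> by (simp add: real_sqrt_mult)
    also have "\<dots> \<le> sqrt (r k - r (k + 2))"
      using descent[of "Suc k"] antimonoD[OF anti, of k "Suc k"] by (intro real_sqrt_le_mono) auto
    also have "\<dots> \<le> M0 * (\<psi> k - \<psi> (k + 2))"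
      unfolding \<psi>_def using that nonneg antimonoD[OF anti, of k "k + 2"] by (intro gap) auto
    finally show ?thesis using \<open>c > 0\<close> by (simp add: M_def field_simps)
  qed
  have chain: "norm (x (Suc (k + m)) - x (Suc k)) \<le> 2 * M * \<psi> k"
    if rec: "\<And>i. i < m \<Longrightarrow> r (k + i) \<le> 1 \<and> r (k + i + 2) powr \<alpha> \<le> C * (r (k + i) - r (k + i + 2))"
    for k m
  proof -
    \<comment> \<open>Differences over two indices telescope to two leading and two trailing terms;
      this is the source of the factor 2.\<close>
    have "norm (x (Suc (k + m)) - x (Suc k)) \<le> M * (\<psi> k + \<psi> (Suc k) - \<psi> (k + m) - \<psi> (Suc (k + m)))"
      using rec
    proof (induction m)
      case (Suc m)
      have "norm (x (Suc (k + Suc m)) - x (Suc k))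
          \<le> norm (x (k + m + 2) - x (Suc (k + m))) + norm (x (Suc (k + m)) - x (Suc k))"
        using norm_triangle_ineq[of "x (k + m + 2) - x (Suc (k + m))" "x (Suc (k + m)) - x (Suc k)"]
        by simp
      also have "\<dots> \<le> M * (\<psi> (k + m) - \<psi> (k + m + 2))
          + M * (\<psi> k + \<psi> (Suc k) - \<psi> (k + m) - \<psi> (Suc (k + m)))"
        using Suc.prems[of m] by (intro add_mono step Suc.IH Suc.prems) auto
      finally show ?case by (simp add: algebra_simps)
    qed simp
    also have "\<dots> \<le> M * (2 * \<psi> k)"
    proof (rule mult_left_mono)
      show "\<psi> k + \<psi> (Suc k) - \<psi> (k + m) - \<psi> (Suc (k + m)) \<le> 2 * \<psi> k"
        using \<psi>_nonneg[of "k + m"] \<psi>_nonneg[of "Suc (k + m)"] \<psi>_anti[of k "Suc k"] by linarith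
    qed (use M in simp)
    finally show ?thesis by (simp add: mult_ac)
  qed
  have \<psi>_lim: "\<psi> \<longlonglongrightarrow> 0"
    unfolding \<psi>_def using tendsto_zero_powrI[OF lim tendsto_const[of s]] nonneg s by simp
  have "\<forall>\<^sub>F k in sequentially. r k < 1 \<and> 2 * M * \<psi> k < e / 2 \<and> k \<ge> K"
    using order_tendstoD(2)[OF lim, of 1] eventually_ge_at_top[of K]
      order_tendstoD(2)[OF tendsto_mult_right_zero[OF \<psi>_lim, of "2 * M"], of "e / 2"] \<open>e > 0\<close>
    by (auto simp: eventually_conj_iff)
  then obtain K1 where K1: "\<And>k. k \<ge> K1 \<Longrightarrow> r k < 1 \<and> 2 * M * \<psi> k < e / 2 \<and> k \<ge> K"
    by (auto simp: eventually_sequentially)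
  have "\<forall>\<^sub>F k in sequentially. dist (x (\<sigma> k)) z < e / 2"
    using tendstoD[OF sub(2), of "e / 2"] \<open>e > 0\<close> by simp
  then have "\<forall>\<^sub>F k in sequentially. dist (x (\<sigma> k)) z < e / 2 \<and> \<sigma> k \<ge> Suc K1"
    using filterlim_subseq[OF sub(1)] by (simp add: eventually_conj_iff filterlim_at_top)
  then obtain n where n: "dist (x (\<sigma> n)) z < e / 2" "\<sigma> n \<ge> Suc K1"
    by (auto simp: eventually_sequentially)
  \<comment> \<open>\<open>\<sigma> n\<close> is at least 1, so \<open>Suc N\<close> is
    \<open>\<sigma> n\<close>: the iterate that is close to \<open>z\<close> is the one tested by
    the recursion at \<open>N\<close>.\<close>
  define N where "N = \<sigma> n - 1"
  have N: "norm (x (Suc N) - z) < e / 2" "N \<ge> K1" using n by (auto simp: N_def dist_norm)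
  have trapped: "norm (x (Suc (N + m)) - z) < e" for m
  \<comment> \<open>Reaching offset \<open>m\<close> takes the recursion at all smaller offsets, and
    each of these is available because its iterate is already inside the ball.\<close>
  proof (induction m rule: less_induct)
    case (less m)
    have "norm (x (Suc (N + m)) - x (Suc N)) \<le> 2 * M * \<psi> N"
    proof (rule chain)
      fix i assume "i < m"
      then show "r (N + i) \<le> 1 \<and> r (N + i + 2) powr \<alpha> \<le> C * (r (N + i) - r (N + i + 2))"
        using less[of i] K1[of "N + i"] N local[of "N + i"] by auto
    qed
    also have "\<dots> < e / 2" using K1 N by blast
    finally show ?case
      using N(1) norm_triangle_ineq[of "x (Suc (N + m)) - x (Suc N)" "x (Suc N) - z"] by simp
  qed
  have rec: "r (k + 2) powr \<alpha> \<le> C * (r k - r (k + 2))" if "k \<ge> N" for k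
    using trapped[of "k - N"] that K1[of k] N by (intro local) auto
  have "norm (x (Suc k) - z) \<le> 2 * M * r k powr s" if "k \<ge> N" for k
  proof -
    \<comment> \<open>The length bound holds for every later \<open>j\<close>; letting
      \<open>j\<close> run along \<open>\<sigma>\<close> replaces \<open>x j\<close> by
      \<open>z\<close>.\<close>
    have "norm (x j - x (Suc k)) \<le> 2 * M * \<psi> k" if "j \<ge> Suc k" for j
      using chain[where k = k and m = "j - Suc k"] that \<open>k \<ge> N\<close> K1 N rec
      by (auto simp: less_imp_le)
    then have "\<forall>\<^sub>F i in sequentially. norm (x (\<sigma> i) - x (Suc k)) \<le> 2 * M * \<psi> k"
      using filterlim_subseq[OF sub(1)] unfolding filterlim_at_top
      by (auto elim!: allE[of _ "Suc k"] eventually_mono)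
    moreover have "(\<lambda>i. norm (x (\<sigma> i) - x (Suc k))) \<longlonglongrightarrow> norm (z - x (Suc k))"
      using sub(2) by (intro tendsto_intros) (simp add: o_def)
    ultimately have "norm (z - x (Suc k)) \<le> 2 * M * \<psi> k"
      by (intro tendsto_upperbound[where F = sequentially]) auto
    then show ?thesis by (simp add: \<psi>_def norm_minus_commute)
  qed
  then show ?thesis
    using that[of "2 * M" N] M K1[of N] N rec by (auto simp: s_def)
qed

text \<open>The KL bound speaks only of values above the limit, hence the premise
  \<open>0 < h\<close>. The factor 4 bounds \<open>2 powr \<alpha>\<close> when
  \<open>r2 / 2 \<le> h\<close>; otherwise \<open>r1 - h\<close> is at least \<open>r2 / 2\<close>,
  and averaging gives \<open>2 / q\<close>. The bound \<open>r2 \<le> 1\<close> carries the linear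
  estimate over to the power \<open>\<alpha>\<close>.\<close>

lemma nonmonotone_recursion:
  fixes \<alpha> :: real
  assumes r: "0 \<le> r2" "r2 \<le> r1" "r1 \<le> r0" "r2 \<le> 1" and \<alpha>: "1 \<le> \<alpha>" "\<alpha> \<le> 2" and q: "0 < q"
    and avg: "q * (r1 - h) \<le> r1 - r2" and A: "0 \<le> A"
    and h: "0 < h \<Longrightarrow> h powr \<alpha> \<le> A * (r0 - r2)"
  shows "r2 powr \<alpha> \<le> (4 * A + 2 / q) * (r0 - r2)"
proof -
  have nonneg: "0 \<le> 4 * A * (r0 - r2)" "0 \<le> 2 / q * (r0 - r2)" using r A q by auto
  consider "r2 = 0" | "r2 > 0" "r2 / 2 \<le> h" | "r2 > 0" "h < r2 / 2" using r by linarith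
  then show ?thesis
  proof cases
    case 1
    then show ?thesis using nonneg by (simp add: distrib_right)
  next
    case 2
    have "2 powr \<alpha> \<le> 2 powr 2" using \<alpha> by (intro powr_mono) auto
    moreover have "r2 powr \<alpha> = 2 powr \<alpha> * (r2 / 2) powr \<alpha>" using 2 by (simp add: powr_divide)
    moreover have "(r2 / 2) powr \<alpha> \<le> h powr \<alpha>" using 2 \<alpha> by (intro powr_mono2) auto
    moreover have "h powr \<alpha> \<le> A * (r0 - r2)" using 2 by (intro h) auto
    ultimately have "r2 powr \<alpha> \<le> 4 * (A * (r0 - r2))"
      using mult_mono[of "2 powr \<alpha>" 4 "(r2 / 2) powr \<alpha>" "A * (r0 - r2)"] by simp
    then show ?thesis using nonneg by (simp add: distrib_right)
  next
    case 3
    have "r2 powr \<alpha> \<le> r2 powr 1" using 3 r \<alpha> by (intro powr_mono') auto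
    moreover have "q * (r2 / 2) \<le> q * (r1 - h)" using 3 r q by (intro mult_left_mono) auto
    then have "r2 \<le> 2 / q * (r0 - r2)" using avg r q by (simp add: field_simps)
    ultimately show ?thesis using 3 nonneg by (simp add: distrib_right)
  qed
qed

lemma linear_rate_of_recursion:
  fixes x :: "nat \<Rightarrow> 'a::real_normed_vector" and r :: "nat \<Rightarrow> real"
  assumes anti: "antimono r" and nonneg: "\<And>k. 0 \<le> r k" and "C > 0" "M > 0"
    and rec: "\<And>k. k \<ge> N \<Longrightarrow> r (k + 2) \<le> C * (r k - r (k + 2))"
    and bound: "\<And>k. k \<ge> N \<Longrightarrow> norm (x (Suc k) - z) \<le> M * r k powr (1 / 2)"
  shows "\<exists>d>0. \<exists>\<rho>\<in>{0<..<1}. \<forall>\<^sub>F k in sequentially. norm (x k - z) \<le> d * \<rho> ^ k"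
proof -
  have "antimono (\<lambda>k. r (N + k))" using anti by (simp add: antimono_def)
  moreover have "r (N + (k + 2)) \<le> C * (r (N + k) - r (N + (k + 2)))" for k
    using rec[of "N + k"] by (simp add: add.assoc)
  ultimately obtain A \<rho> where A: "A > 0" "0 < \<rho>" "\<rho> < 1" and decay: "\<And>k. r (N + k) \<le> A * \<rho> ^ k"
    using two_step_linear_decay[of "\<lambda>k. r (N + k)" C] nonneg \<open>C > 0\<close> by blast
  \<comment> \<open>Distances behave like square roots of \<open>r\<close>, so the ratio becomes
    \<open>sqrt \<rho>\<close>; the denominator undoes the index shift by
    \<open>Suc N\<close>.\<close>
  define d where "d = M * sqrt A / sqrt \<rho> ^ Suc N"
  have "norm (x k - z) \<le> d * sqrt \<rho> ^ k" if k: "k \<ge> Suc N" for k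
  proof -
    obtain i where i: "k = Suc (N + i)" using le_Suc_ex[OF k] by auto
    have "norm (x k - z) \<le> M * r (N + i) powr (1 / 2)" using bound[of "N + i"] i by simp
    also have "\<dots> = M * sqrt (r (N + i))" using nonneg by (simp add: powr_half_sqrt)
    also have "\<dots> \<le> M * sqrt (A * \<rho> ^ i)" using decay[of i] \<open>M > 0\<close> by simp
    also have "\<dots> = d * sqrt \<rho> ^ k"
      using A by (simp add: d_def i real_sqrt_mult real_sqrt_power power_add)
    finally show ?thesis .
  qed
  then have "\<forall>\<^sub>F k in sequentially. norm (x k - z) \<le> d * sqrt \<rho> ^ k"
    by (rule eventually_sequentiallyI)
  moreover have "d > 0" using A \<open>M > 0\<close> by (simp add: d_def)
  moreover have "sqrt \<rho> \<in> {0<..<1}" using A by simp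
  ultimately show ?thesis by blast
qed

lemma sublinear_rate_of_recursion:
  fixes x :: "nat \<Rightarrow> 'a::real_normed_vector" and r :: "nat \<Rightarrow> real"
  assumes anti: "antimono r" and nonneg: "\<And>k. 0 \<le> r k" and "C > 0" "M > 0" "r N \<le> 1" "1 < \<alpha>" "\<alpha> < 2"
    and rec: "\<And>k. k \<ge> N \<Longrightarrow> r (k + 2) powr \<alpha> \<le> C * (r k - r (k + 2))"
    and bound: "\<And>k. k \<ge> N \<Longrightarrow> norm (x (Suc k) - z) \<le> M * r k powr (1 - \<alpha> / 2)"
  shows "\<exists>d>0. \<forall>\<^sub>F k in sequentially. norm (x k - z) \<le> d * real k powr (- ((1 - \<alpha> / 2) / (\<alpha> - 1)))"
proof -
  have "antimono (\<lambda>k. r (N + k))" using anti by (simp add: antimono_def)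
  moreover have "r (N + (k + 2)) powr \<alpha> \<le> C * (r (N + k) - r (N + (k + 2)))" for k
    using rec[of "N + k"] by (simp add: add.assoc)
  ultimately obtain c where c: "c > 0"
    and decay: "\<And>k. k > 0 \<Longrightarrow> r (N + k) \<le> (c * real k) powr (- (1 / (\<alpha> - 1)))"
    using two_step_sublinear_decay[of "\<lambda>k. r (N + k)" C \<alpha>] nonneg \<open>C > 0\<close> \<open>1 < \<alpha>\<close> \<open>r N \<le> 1\<close> by auto
  define s where "s = 1 - \<alpha> / 2"
  define q where "q = s / (\<alpha> - 1)"
  have s: "s > 0" and q: "q > 0" using \<open>\<alpha> < 2\<close> \<open>1 < \<alpha>\<close> by (auto simp: s_def q_def)
  define d where "d = M * (c / 2) powr (- q)"
  \<comment> \<open>From \<open>2 * N + 3\<close> on, the shifted index \<open>i\<close> is positive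
    and at least \<open>k / 2\<close>, so the shift costs only a constant factor.\<close>
  have "norm (x k - z) \<le> d * real k powr (- q)" if k: "k \<ge> 2 * N + 3" for k
  proof -
    define i where "i = k - Suc N"
    have i: "k = Suc (N + i)" using k by (simp add: i_def)
    have i': "i > 0" "real k / 2 \<le> real i" using k i by linarith+
    have "norm (x k - z) \<le> M * r (N + i) powr s" using bound[of "N + i"] i by (simp add: s_def)
    also have "\<dots> \<le> M * ((c * real i) powr (- (1 / (\<alpha> - 1)))) powr s"
      using decay[OF i'(1)] nonneg s \<open>M > 0\<close> by (intro mult_left_mono powr_mono2) auto
    also have "\<dots> = M * (c * real i) powr (- q)" by (simp add: powr_powr q_def)
    also have "\<dots> \<le> M * (c * (real k / 2)) powr (- q)"
      using i' c q k \<open>M > 0\<close> by (intro mult_left_mono powr_mono2') auto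
    also have "c * (real k / 2) = c / 2 * real k" by simp
    also have "M * (c / 2 * real k) powr (- q) = d * real k powr (- q)"
      unfolding d_def using c by (simp only: powr_mult mult.assoc)
    finally show ?thesis .
  qed
  then have "\<forall>\<^sub>F k in sequentially. norm (x k - z) \<le> d * real k powr (- q)"
    by (rule eventually_sequentiallyI)
  moreover have "d > 0" using c \<open>M > 0\<close> by (simp add: d_def)
  ultimately show ?thesis unfolding q_def s_def by blast
qed

section \<open>The proximal subproblem and the line search\<close>

lemma continuous_on_UNIV_bounded_cball:
  fixes h :: "'a::heine_borel \<Rightarrow> 'b::real_normed_vector"
  assumes "continuous_on UNIV h"
  shows "\<exists>B. \<forall>w\<in>cball z r. norm (h w) \<le> B"
proof -
  have "bounded (h ` cball z r)"
    using continuous_on_subset[OF assms subset_UNIV]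
    by (intro compact_imp_bounded compact_continuous_image) auto
  then show ?thesis unfolding bounded_iff by blast
qed

lemma lower_semicontinuous_tendsto_le:
  assumes lsc: "lower_semicontinuous h" and X: "X \<longlonglongrightarrow> x" and lim: "(\<lambda>n. h (X n)) \<longlonglongrightarrow> l"
  shows "h x \<le> l"
proof (rule ccontr)
  assume "\<not> h x \<le> l"
  then obtain c where c: "l < c" "c < h x" using dense not_le by metis
  have "\<forall>\<^sub>F z in at x. c < h z"
    using lsc c(2) unfolding lower_semicontinuous_def le_Liminf_iff by blast
  \<comment> \<open>The definition sees punctured neighbourhoods, but the sequence may hit
    \<open>x\<close>; the level \<open>c\<close> lies below \<open>h x\<close> as well.\<close>
  then have "\<forall>\<^sub>F z in nhds x. c < h z"
    using c(2) by (auto simp: eventually_at_filter elim!: eventually_mono)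
  then have "\<forall>\<^sub>F n in sequentially. c < h (X n)"
    by (rule eventually_compose_filterlim) (rule X)
  moreover have "\<forall>\<^sub>F n in sequentially. h (X n) < c"
    using order_tendstoD(2)[OF lim c(1)] .
  ultimately have "\<forall>\<^sub>F n in sequentially. False"
    by eventually_elim auto
  then show False by simp
qed

text \<open>Expanding \<open>norm z\<close> around \<open>y\<close> costs \<open>g\<close>, and
  splitting the linear term into squares costs \<open>1 / 2\<close>, so the model is coercive as
  soon as \<open>\<gamma> > 2 * g + 1\<close>.\<close>

lemma prox_model_lower_bound:
  fixes v y z :: "'a::euclidean_space"
  assumes P1: "\<And>z. ereal (c - g / 2 * (norm z)\<^sup>2) \<le> P1 z" and g: "g \<ge> 0"
  shows "ereal (c - g * (norm y)\<^sup>2 - (norm (grad_f y - \<xi>))\<^sup>2 / 2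
                + (\<gamma> / 2 - g - 1 / 2) * (norm (z - y))\<^sup>2)
           \<le> prox_model grad_f P1 \<xi> y \<gamma> z"
proof -
  have "norm z \<le> norm (z - y) + norm y"
    using norm_triangle_ineq[of "z - y" y] by simp
  then have "(norm z)\<^sup>2 \<le> (norm (z - y) + norm y)\<^sup>2" by (intro power_mono) auto
  also have "\<dots> \<le> 2 * (norm (z - y))\<^sup>2 + 2 * (norm y)\<^sup>2"
    using sum_squares_bound[of "norm (z - y)" "norm y"] by (simp add: power2_sum)
  finally have "g / 2 * (norm z)\<^sup>2 \<le> g / 2 * (2 * (norm (z - y))\<^sup>2 + 2 * (norm y)\<^sup>2)"
    using g by (intro mult_left_mono) auto
  moreover have "- ((norm (grad_f y - \<xi>))\<^sup>2 / 2 + (norm (z - y))\<^sup>2 / 2) \<le> (grad_f y - \<xi>) \<bullet> (z - y)"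
    using Cauchy_Schwarz_ineq2[of "grad_f y - \<xi>" "z - y"]
      sum_squares_bound[of "norm (grad_f y - \<xi>)" "norm (z - y)"] by linarith
  ultimately have "c - g * (norm y)\<^sup>2 - (norm (grad_f y - \<xi>))\<^sup>2 / 2
        + (\<gamma> / 2 - g - 1 / 2) * (norm (z - y))\<^sup>2
      \<le> ((grad_f y - \<xi>) \<bullet> (z - y) + \<gamma> / 2 * (norm (z - y))\<^sup>2) + (c - g / 2 * (norm z)\<^sup>2)"
    by (simp add: algebra_simps)
  then have "ereal (c - g * (norm y)\<^sup>2 - (norm (grad_f y - \<xi>))\<^sup>2 / 2
        + (\<gamma> / 2 - g - 1 / 2) * (norm (z - y))\<^sup>2)
      \<le> ereal ((grad_f y - \<xi>) \<bullet> (z - y) + \<gamma> / 2 * (norm (z - y))\<^sup>2) + ereal (c - g / 2 * (norm z)\<^sup>2)"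
    by simp
  also have "\<dots> \<le> prox_model grad_f P1 \<xi> y \<gamma> z"
    unfolding prox_model_def by (intro add_left_mono P1)
  finally show ?thesis .
qed

lemma prox_minimizer_exists:
  fixes y :: "'a::euclidean_space"
  assumes lsc: "lower_semicontinuous P1" and proper: "proper_fun P1"
    and P1: "\<And>z. ereal (c - g / 2 * (norm z)\<^sup>2) \<le> P1 z" and g: "g \<ge> 0" "\<gamma> > 2 * g + 1"
  shows "\<exists>z. is_arg_min (prox_model grad_f P1 \<xi> y \<gamma>) (\<lambda>_. True) z"
proof -
  define \<phi> where "\<phi> = prox_model grad_f P1 \<xi> y \<gamma>"
  define q where "q z = (grad_f y - \<xi>) \<bullet> (z - y) + \<gamma> / 2 * (norm (z - y))\<^sup>2" for z
  define b where "b = c - g * (norm y)\<^sup>2 - (norm (grad_f y - \<xi>))\<^sup>2 / 2"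
  define a where "a = \<gamma> / 2 - g - 1 / 2"
  have a: "a > 0" using g by (simp add: a_def)
  have \<phi>: "\<phi> z = ereal (q z) + P1 z" for z by (simp add: \<phi>_def prox_model_def q_def)
  have low: "ereal (b + a * (norm (z - y))\<^sup>2) \<le> \<phi> z" for z
    using prox_model_lower_bound[OF P1 g(1)] by (simp add: \<phi>_def b_def a_def)
  obtain z0 where z0: "P1 z0 < \<infinity>" "P1 z0 \<noteq> -\<infinity>"
    using proper unfolding proper_fun_def domain_of_def by blast
  then obtain p0 where "P1 z0 = ereal p0" by (cases "P1 z0") auto
  then obtain B where B: "\<phi> z0 = ereal B" by (simp add: \<phi>)
  have "range \<phi> \<noteq> {}" by simp
  from Inf_as_limit[OF this]
  obtain u where u: "\<forall>n. u n \<in> range \<phi>" "u \<longlonglongrightarrow> Inf (range \<phi>)"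
    by (elim exE conjE)
  have "\<forall>n. \<exists>w. u n = \<phi> w" using u(1) by blast
  then obtain Z0 where Z0: "\<And>n. u n = \<phi> (Z0 n)" by metis
  \<comment> \<open>Terms worse than \<open>z0\<close> are replaced by \<open>z0\<close>; every
    value is then at most the real \<open>B\<close>, and coercivity confines the sequence to a
    compact ball.\<close>
  define Z where "Z n = (if \<phi> (Z0 n) \<le> \<phi> z0 then Z0 n else z0)" for n
  have "(\<lambda>n. min (u n) (\<phi> z0)) \<longlonglongrightarrow> min (Inf (range \<phi>)) (\<phi> z0)"
    by (intro tendsto_min u tendsto_const)
  moreover have "min (Inf (range \<phi>)) (\<phi> z0) = Inf (range \<phi>)"
    by (simp add: Inf_lower min_absorb1)
  moreover have "min (u n) (\<phi> z0) = \<phi> (Z n)" for n by (simp add: Z_def Z0 min_def)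
  ultimately have lim: "(\<lambda>n. \<phi> (Z n)) \<longlonglongrightarrow> Inf (range \<phi>)" by simp
  have "Z n \<in> cball y (sqrt ((B - b) / a))" for n
  proof -
    have "ereal (b + a * (norm (Z n - y))\<^sup>2) \<le> \<phi> (Z n)" by (rule low)
    also have "\<dots> \<le> ereal B" by (simp add: Z_def B)
    finally have "(norm (Z n - y))\<^sup>2 \<le> (B - b) / a" using a by (simp add: field_simps)
    then show ?thesis using real_le_rsqrt by (simp add: dist_norm norm_minus_commute)
  qed
  then obtain z s where s: "strict_mono s" "(Z \<circ> s) \<longlonglongrightarrow> z"
    using compact_cball[of y "sqrt ((B - b) / a)"] unfolding compact_def by meson
  have lim': "(\<lambda>n. \<phi> ((Z \<circ> s) n)) \<longlonglongrightarrow> Inf (range \<phi>)"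
    using LIMSEQ_subseq_LIMSEQ[OF lim s(1)] by (simp add: o_def)
  have "ereal b \<le> Inf (range \<phi>)"
  proof (rule Inf_greatest)
    fix t assume "t \<in> range \<phi>"
    then obtain z where "t = \<phi> z" by auto
    then show "ereal b \<le> t" using order_trans[OF _ low[of z], of "ereal b"] a by simp
  qed
  moreover have "Inf (range \<phi>) \<le> ereal B" using B by (metis Inf_lower rangeI)
  ultimately obtain m where m: "Inf (range \<phi>) = ereal m" by (cases "Inf (range \<phi>)") auto
  have qlim: "(\<lambda>n. q ((Z \<circ> s) n)) \<longlonglongrightarrow> q z"
    unfolding q_def by (intro tendsto_intros s(2))
  \<comment> \<open>Subtracting the continuous quadratic isolates \<open>P1\<close>, to which lower
    semicontinuity applies directly.\<close>
  have "(\<lambda>n. \<phi> ((Z \<circ> s) n) + ereal (- q ((Z \<circ> s) n))) \<longlonglongrightarrow> ereal m + ereal (- q z)"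
    using lim' m qlim by (intro tendsto_add_ereal) (auto intro: tendsto_intros)
  moreover have "\<phi> w + ereal (- q w) = P1 w" for w
    unfolding \<phi> by (cases "P1 w") auto
  ultimately have "P1 z \<le> ereal (m - q z)"
    using lower_semicontinuous_tendsto_le[OF lsc s(2)] by simp
  then have "\<phi> z \<le> ereal (q z) + ereal (m - q z)" unfolding \<phi> by (rule add_left_mono)
  then have "\<phi> z \<le> Inf (range \<phi>)" by (simp add: m)
  then have "is_arg_min \<phi> (\<lambda>_. True) z"
    unfolding is_arg_min_def by (meson Inf_lower leD order_trans rangeI)
  then show ?thesis unfolding \<phi>_def by blast
qed

lemma prox_minimizer_le:
  assumes "is_arg_min (prox_model grad_f P1 \<xi> y \<gamma>) (\<lambda>_. True) z"
  shows "prox_model grad_f P1 \<xi> y \<gamma> z \<le> prox_model grad_f P1 \<xi> y \<gamma> u"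
  using assms by (auto simp: is_arg_min_def not_less)

lemma prox_minimizer_finite:
  assumes "proper_fun P1" "is_arg_min (prox_model grad_f P1 \<xi> y \<gamma>) (\<lambda>_. True) z"
  shows "\<bar>P1 z\<bar> \<noteq> \<infinity>"
proof -
  obtain u where "P1 u < \<infinity>" and nm: "\<And>z. P1 z \<noteq> -\<infinity>"
    using assms(1) unfolding proper_fun_def domain_of_def by auto
  then have "prox_model grad_f P1 \<xi> y \<gamma> u < \<infinity>" unfolding prox_model_def by auto
  then have "prox_model grad_f P1 \<xi> y \<gamma> z < \<infinity>"
    using prox_minimizer_le[OF assms(2)] order_le_less_trans by blast
  then have "P1 z \<noteq> \<infinity>" unfolding prox_model_def by auto
  then show ?thesis using nm by auto
qed

text \<open>Zero is a Frechet subgradient of the model at its minimiser; subtracting the smooth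
  quadratic part leaves \<open>P1\<close>.\<close>

lemma prox_minimizer_subgradient:
  fixes y :: "'a::euclidean_space"
  assumes "proper_fun P1" "is_arg_min (prox_model grad_f P1 \<xi> y \<gamma>) (\<lambda>_. True) z"
  shows "- (grad_f y - \<xi> + \<gamma> *\<^sub>R (z - y)) \<in> frechet_subdiff P1 z"
proof -
  define q where "q z = (grad_f y - \<xi>) \<bullet> (z - y) + \<gamma> / 2 * ((z - y) \<bullet> (z - y))" for z
  have model: "prox_model grad_f P1 \<xi> y \<gamma> = (\<lambda>z. ereal (q z) + P1 z)"
    by (auto simp: prox_model_def q_def dot_square_norm)
  have "\<bar>prox_model grad_f P1 \<xi> y \<gamma> z\<bar> \<noteq> \<infinity>"
    using prox_minimizer_finite[OF assms] unfolding model by auto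
  then have "0 \<in> frechet_subdiff (prox_model grad_f P1 \<xi> y \<gamma>) z"
    using prox_minimizer_le[OF assms(2)] by (intro frechet_subdiff_global_min) auto
  moreover have "GDERIV (\<lambda>z. - q z) z :> - (grad_f y - \<xi> + \<gamma> *\<^sub>R (z - y))"
    unfolding q_def gderiv_def
    by (auto intro!: derivative_eq_intros simp: fun_eq_iff algebra_simps inner_commute)
  ultimately have "0 + - (grad_f y - \<xi> + \<gamma> *\<^sub>R (z - y))
      \<in> frechet_subdiff (\<lambda>z. prox_model grad_f P1 \<xi> y \<gamma> z + ereal (- q z)) z"
    by (rule frechet_subdiff_add_smooth)
  moreover have "prox_model grad_f P1 \<xi> y \<gamma> u + ereal (- q u) = P1 u" for u
    unfolding model by (cases "P1 u") auto
  ultimately show ?thesis by simp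
qed

lemma prox_bounded_quadratic_minorant:
  assumes "prox_bounded P1"
  obtains c g where "g \<ge> 0" "\<And>z. ereal (c - g / 2 * (norm z)\<^sup>2) \<le> P1 z"
proof -
  obtain g where g: "g > 0" "(INF x. P1 x + ereal (g / 2 * (norm x)\<^sup>2)) > -\<infinity>"
    using assms unfolding prox_bounded_def by blast
  then obtain c where c: "ereal c < (INF x. P1 x + ereal (g / 2 * (norm x)\<^sup>2))"
    using less_ereal.simps ereal_dense2 by blast
  have "ereal (c - g / 2 * (norm z)\<^sup>2) \<le> P1 z" for z
  proof -
    have "ereal c < P1 z + ereal (g / 2 * (norm z)\<^sup>2)"
      using c by (rule less_INF_D) simp
    then show ?thesis by (cases "P1 z") auto
  qed
  then show ?thesis using that[of g c] g(1) by auto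
qed

text \<open>The mean value theorem at one point of the segment gives the constant \<open>L\<close>
  where integration would give \<open>L / 2\<close>; the loss is absorbed by asking for
  \<open>\<gamma> \<ge> 4 * L\<close> in the line search.\<close>

lemma lipschitz_gradient_linearization:
  fixes f :: "'a::euclidean_space \<Rightarrow> real"
  assumes f: "\<And>z. GDERIV f z :> grad_f z" and lip: "L-lipschitz_on U grad_f" and "convex U"
    and yz: "y \<in> U" "z \<in> U"
  shows "\<bar>f z - f y - grad_f y \<bullet> (z - y)\<bar> \<le> L * (norm (z - y))\<^sup>2"
proof -
  have "((\<lambda>t. f (y + t *\<^sub>R (z - y))) has_real_derivative (z - y) \<bullet> grad_f (y + t *\<^sub>R (z - y))) (at t)" for t
  proof -
    have "(f has_derivative (\<lambda>h. h \<bullet> grad_f (y + t *\<^sub>R (z - y)))) (at (y + t *\<^sub>R (z - y)))"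
      using f unfolding gderiv_def by blast
    moreover have "((\<lambda>t. y + t *\<^sub>R (z - y)) has_derivative (\<lambda>h. h *\<^sub>R (z - y))) (at t)"
      by (auto intro!: derivative_eq_intros)
    ultimately have "((\<lambda>t. f (y + t *\<^sub>R (z - y))) has_derivative
        (\<lambda>h. (h *\<^sub>R (z - y)) \<bullet> grad_f (y + t *\<^sub>R (z - y)))) (at t)"
      by (rule has_derivative_compose[rotated])
    then show ?thesis by (simp add: has_field_derivative_def mult_commute_abs)
  qed
  then obtain t where t: "0 < t" "t < 1"
    "f (y + 1 *\<^sub>R (z - y)) - f (y + 0 *\<^sub>R (z - y)) = (1 - 0) * ((z - y) \<bullet> grad_f (y + t *\<^sub>R (z - y)))"
    using MVT2[of 0 1 "\<lambda>t. f (y + t *\<^sub>R (z - y))" "\<lambda>t. (z - y) \<bullet> grad_f (y + t *\<^sub>R (z - y))"]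
    by auto
  define w where "w = y + t *\<^sub>R (z - y)"
  have "w = (1 - t) *\<^sub>R y + t *\<^sub>R z" by (simp add: w_def algebra_simps)
  then have w: "w \<in> U" using \<open>convex U\<close> yz t by (simp add: convexD_alt)
  have L: "L \<ge> 0" using lip by (rule lipschitz_on_nonneg)
  have "f z - f y - grad_f y \<bullet> (z - y) = (grad_f w - grad_f y) \<bullet> (z - y)"
    using t(3) by (simp add: w_def inner_diff_left inner_diff_right inner_commute)
  then have "\<bar>f z - f y - grad_f y \<bullet> (z - y)\<bar> \<le> norm (grad_f w - grad_f y) * norm (z - y)"
    using Cauchy_Schwarz_ineq2 by metis
  also have "\<dots> \<le> (L * norm (w - y)) * norm (z - y)"
    using lipschitz_on_normD[OF lip w yz(1)] by (intro mult_right_mono) auto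
  also have "\<dots> \<le> (L * norm (z - y)) * norm (z - y)"
    using t L by (intro mult_right_mono mult_left_mono) (auto simp: w_def mult_left_le_one_le)
  finally show ?thesis by (simp add: power2_eq_square mult_ac)
qed

text \<open>Minimality against \<open>u\<close> leaves a surplus of \<open>\<gamma> / 2 - L\<close>
  times the squared distance of \<open>z\<close> and \<open>y\<close>, and an error of
  \<open>\<gamma> / 2 + L\<close> times that of \<open>u\<close> and \<open>y\<close>. Measuring the
  surplus from \<open>u\<close> adds another \<open>\<gamma> / 2 - L\<close> to the error, which
  totals \<open>\<gamma> * (norm (u - y))\<^sup>2\<close>, and \<open>\<gamma> \<ge> 4 * L\<close>
  keeps \<open>\<gamma> / 8\<close> of the surplus.\<close>

lemma line_search_acceptance:
  fixes f :: "'a::euclidean_space \<Rightarrow> real"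
  assumes f: "\<And>z. GDERIV f z :> grad_f z" and lip: "L-lipschitz_on U grad_f" and U: "convex U"
    and mem: "u \<in> U" "y \<in> U" "z \<in> U"
    and P1: "proper_fun P1" and u: "P1 u = ereal pu"
    and sub: "\<And>z. P2 u + \<xi> \<bullet> (z - u) \<le> P2 z"
    and min: "is_arg_min (prox_model grad_f P1 \<xi> y \<gamma>) (\<lambda>_. True) z"
    and \<gamma>: "\<gamma> \<ge> 4 * L"
    and R: "f u + pu - P2 u + \<gamma> * (norm (u - y))\<^sup>2 \<le> R"
  shows "line_search (objective f P1 P2) \<delta> R \<gamma> u z"
proof -
  obtain pz where pz: "P1 z = ereal pz"
    using prox_minimizer_finite[OF P1 min] by auto
  define v where "v = grad_f y - \<xi>"
  have L: "L \<ge> 0" using lip by (rule lipschitz_on_nonneg)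
  have m: "v \<bullet> (z - y) + \<gamma> / 2 * (norm (z - y))\<^sup>2 + pz \<le> v \<bullet> (u - y) + \<gamma> / 2 * (norm (u - y))\<^sup>2 + pu"
    using prox_minimizer_le[OF min, of u] by (simp add: prox_model_def pz u v_def)
  have 1: "f z \<le> f y + grad_f y \<bullet> (z - y) + L * (norm (z - y))\<^sup>2"
    using lipschitz_gradient_linearization[OF f lip U mem(2,3)] by linarith
  have 2: "f u \<ge> f y + grad_f y \<bullet> (u - y) - L * (norm (u - y))\<^sup>2"
    using lipschitz_gradient_linearization[OF f lip U mem(2,1)] by linarith
  have 3: "P2 u + \<xi> \<bullet> (z - u) \<le> P2 z" by (rule sub)
  have "norm (z - u) \<le> norm (z - y) + norm (u - y)"
    using norm_triangle_ineq4[of "z - y" "u - y"] by simp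
  then have "(norm (z - u))\<^sup>2 \<le> (norm (z - y) + norm (u - y))\<^sup>2" by (intro power_mono) auto
  also have "\<dots> \<le> 2 * (norm (z - y))\<^sup>2 + 2 * (norm (u - y))\<^sup>2"
    using sum_squares_bound[of "norm (z - y)" "norm (u - y)"] by (simp add: power2_sum)
  finally have "(\<gamma> / 2 - L) * (norm (z - u))\<^sup>2 \<le> (\<gamma> / 2 - L) * (2 * (norm (z - y))\<^sup>2 + 2 * (norm (u - y))\<^sup>2)"
    using \<gamma> L by (intro mult_left_mono) auto
  moreover have "\<gamma> / 4 * (norm (z - u))\<^sup>2 \<le> (\<gamma> / 2 - L) * (norm (z - u))\<^sup>2"
    using \<gamma> by (intro mult_right_mono) auto
  ultimately have 4: "\<gamma> / 8 * (norm (z - u))\<^sup>2 \<le> (\<gamma> / 2 - L) * (norm (z - y))\<^sup>2 + (\<gamma> / 2 - L) * (norm (u - y))\<^sup>2"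
    by (simp add: algebra_simps)
  have 5: "v \<bullet> (u - y) - v \<bullet> (z - y) + grad_f y \<bullet> (z - y) - grad_f y \<bullet> (u - y) = \<xi> \<bullet> (z - u)"
    by (simp add: v_def inner_diff_left inner_diff_right)
  have "f z + pz - P2 z + \<gamma> / 8 * (norm (z - u))\<^sup>2 \<le> f u + pu - P2 u + \<gamma> * (norm (u - y))\<^sup>2"
    using m 1 2 3 4 5 by (simp add: algebra_simps)
  \<comment> \<open>The decrease splits into the share \<open>\<delta>\<close> stored in the
    potential and the share \<open>1 - \<delta>\<close> demanded by the line search.\<close>
  moreover have "\<delta> * \<gamma> / 8 * (norm (z - u))\<^sup>2
      = \<gamma> / 8 * (norm (z - u))\<^sup>2 - (1 - \<delta>) * \<gamma> / 8 * (norm (z - u))\<^sup>2"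
    by (simp add: field_simps)
  ultimately have "f z + pz - P2 z + \<delta> * \<gamma> / 8 * (norm (z - u))\<^sup>2 - R \<le> - ((1 - \<delta>) * \<gamma> / 8 * (norm (z - u))\<^sup>2)"
    using R by linarith
  then show ?thesis by (simp add: line_search_def potential_def objective_def pz)
qed

section \<open>Runs of nexPGA\<close>

text \<open>Fixing the choices of one run as parameters makes its reference values, step sizes and
  trial points available by name; the accepted trial is identified with \<open>x (Suc k)\<close>
  throughout.\<close>

locale nexpga_run =
  fixes f P2 :: "'a::euclidean_space \<Rightarrow> real" and P1 :: "'a \<Rightarrow> ereal" and grad_f :: "'a \<Rightarrow> 'a"
    and \<gamma>min \<gamma>max \<beta>max pmin \<delta> \<tau> \<eta> :: real and x \<xi> :: "nat \<Rightarrow> 'a"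
    and \<beta>0 \<gamma>0 p R :: "nat \<Rightarrow> real" and j :: "nat \<Rightarrow> nat" and xt :: "nat \<Rightarrow> nat \<Rightarrow> 'a"
  assumes f_grad: "\<And>z. GDERIV f z :> grad_f z"
    and f_C1: "continuous_on UNIV grad_f"
    and f_lip: "locally_lipschitz_on UNIV grad_f"
    and P1_proper: "proper_fun P1"
    and P1_closed: "lower_semicontinuous P1"
    and P1_prox_bounded: "prox_bounded P1"
    and P2_convex: "convex_on UNIV P2"
    and F_bounded_below: "\<exists>m::real. \<forall>z\<in>domain_of P1. ereal m \<le> objective f P1 P2 z"
    and \<gamma>min_pos: "0 < \<gamma>min"
    and \<beta>max_nonneg: "0 \<le> \<beta>max"
    and pmin: "0 < pmin"
    and \<delta>: "0 \<le> \<delta>" "\<delta> < 1"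
    and \<tau>: "1 < \<tau>"
    and \<eta>: "0 < \<eta>" "\<eta> < 1 / sqrt \<tau>"
    and x0: "x 0 \<in> domain_of P1"
    and R0: "ereal (R 0) = objective f P1 P2 (x 0)"
    and \<xi>: "\<And>k. \<xi> k \<in> limiting_subdiff (\<lambda>z. ereal (P2 z)) (x k)"
    and \<beta>0: "\<And>k. 0 \<le> \<beta>0 k" "\<And>k. \<beta>0 k \<le> \<delta> * \<beta>max"
    and \<gamma>0: "\<And>k. \<gamma>min \<le> \<gamma>0 k" "\<And>k. \<gamma>0 k \<le> \<gamma>max"
    and failed: "\<And>k i. i < j k \<Longrightarrow>
        (\<nexists>z. is_arg_min (prox_model grad_f P1 (\<xi> k) (x k + (\<eta> ^ i * \<beta>0 k) *\<^sub>R (x k - x (k - 1)))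
               (\<tau> ^ i * \<gamma>0 k)) (\<lambda>_. True) z) \<or>
        (is_arg_min (prox_model grad_f P1 (\<xi> k) (x k + (\<eta> ^ i * \<beta>0 k) *\<^sub>R (x k - x (k - 1)))
               (\<tau> ^ i * \<gamma>0 k)) (\<lambda>_. True) (xt k i) \<and>
         \<not> line_search (objective f P1 P2) \<delta> (R k) (\<tau> ^ i * \<gamma>0 k) (x k) (xt k i))"
    and minimizer: "\<And>k. is_arg_min (prox_model grad_f P1 (\<xi> k)
          (x k + (\<eta> ^ j k * \<beta>0 k) *\<^sub>R (x k - x (k - 1))) (\<tau> ^ j k * \<gamma>0 k)) (\<lambda>_. True) (x (Suc k))"
    and accepted: "\<And>k. line_search (objective f P1 P2) \<delta> (R k) (\<tau> ^ j k * \<gamma>0 k) (x k) (x (Suc k))"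
    and p: "\<And>k. pmin \<le> p (Suc k)" "\<And>k. p (Suc k) \<le> 1"
    and R_Suc_ereal: "\<And>k. ereal (R (Suc k)) = ereal ((1 - p (Suc k)) * R k) +
        ereal (p (Suc k)) * potential (objective f P1 P2) \<delta> (x (Suc k), x k, \<tau> ^ j k * \<gamma>0 k)"
begin

section \<open>Merit values along the run\<close>

abbreviation F :: "'a \<Rightarrow> ereal" where "F \<equiv> objective f P1 P2"

definition stepsize :: "nat \<Rightarrow> real" where "stepsize k = \<tau> ^ j k * \<gamma>0 k"

definition extrap :: "nat \<Rightarrow> 'a" where
  "extrap k = x k + (\<eta> ^ j k * \<beta>0 k) *\<^sub>R (x k - x (k - 1))"

definition gap :: "nat \<Rightarrow> real" where "gap k = norm (x k - x (k - 1))"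

definition P1val :: "nat \<Rightarrow> real" where "P1val k = real_of_ereal (P1 (x k))"

definition Fval :: "nat \<Rightarrow> real" where "Fval k = f (x k) + P1val k - P2 (x k)"

text \<open>\<open>Hval (Suc k)\<close> is the paper's \<open>H\<^sub>\<delta>(x\<^sup>k\<^sup>+\<^sup>1, x\<^sup>k, \<gamma>\<^sub>k)\<close>; for index 0 the \<open>gap\<close> vanishes.\<close>

definition Hval :: "nat \<Rightarrow> real" where
  "Hval k = Fval k + \<delta> * stepsize (k - 1) / 8 * (gap k)\<^sup>2"

lemma minimizer': "is_arg_min (prox_model grad_f P1 (\<xi> k) (extrap k) (stepsize k)) (\<lambda>_. True) (x (Suc k))"
  using minimizer by (simp add: extrap_def stepsize_def)

lemma P1_x: "P1 (x k) = ereal (P1val k)"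
proof -
  have "\<bar>P1 (x k)\<bar> \<noteq> \<infinity>"
  proof (cases k)
    case 0
    then show ?thesis using x0 P1_proper by (auto simp: domain_of_def proper_fun_def)
  next
    case (Suc i)
    show ?thesis unfolding Suc by (rule prox_minimizer_finite[OF P1_proper minimizer])
  qed
  then show ?thesis by (simp add: P1val_def ereal_real)
qed

lemma F_x: "F (x k) = ereal (Fval k)"
  by (simp add: objective_def P1_x Fval_def)

lemma potential_x: "potential F \<delta> (x (Suc k), x k, stepsize k) = ereal (Hval (Suc k))"
  by (simp add: potential_def F_x Hval_def gap_def)

lemma stepsize_ge: "\<gamma>min \<le> stepsize k"
proof -
  have "1 * \<gamma>min \<le> \<tau> ^ j k * \<gamma>0 k"
    using \<gamma>0(1)[of k] \<tau> \<gamma>min_pos by (intro mult_mono) (auto simp: one_le_power)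
  then show ?thesis by (simp add: stepsize_def)
qed

lemma stepsize_pos: "0 < stepsize k"
  using stepsize_ge[of k] \<gamma>min_pos by linarith

lemma R_zero: "R 0 = Fval 0"
  using R0 by (simp add: F_x)

lemma Hval_Suc_le: "Hval (Suc k) \<le> R k - (1 - \<delta>) * stepsize k / 8 * (gap (Suc k))\<^sup>2"
  using accepted[of k] potential_x[of k]
  by (simp add: line_search_def stepsize_def[symmetric] gap_def)

lemma R_Suc: "R (Suc k) = (1 - p (Suc k)) * R k + p (Suc k) * Hval (Suc k)"
  using R_Suc_ereal[of k] potential_x[of k] by (simp add: stepsize_def[symmetric])

lemma Hval_Suc_le_R: "Hval (Suc k) \<le> R k"
proof -
  have "0 \<le> (1 - \<delta>) * stepsize k / 8 * (gap (Suc k))\<^sup>2"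
    using \<delta> stepsize_pos[of k] by simp
  then show ?thesis using Hval_Suc_le[of k] by linarith
qed

text \<open>\<open>R (Suc i)\<close> is a convex combination of \<open>Hval (Suc i)\<close> and the
  larger \<open>R i\<close>.\<close>

lemma Hval_le_R: "Hval k \<le> R k"
proof (cases k)
  case 0
  then show ?thesis by (simp add: R_zero Hval_def gap_def)
next
  case (Suc i)
  have "0 \<le> (1 - p (Suc i)) * (R i - Hval (Suc i))"
    using Hval_Suc_le_R[of i] p(2)[of i] by simp
  then show ?thesis by (simp add: Suc R_Suc algebra_simps)
qed

lemma Fval_le_Hval: "Fval k \<le> Hval k"
  using \<delta> stepsize_pos[of "k - 1"] by (simp add: Hval_def)

text \<open>The distance term is the reserve in \<open>R k\<close> that later pays for
  extrapolation; using \<open>\<gamma>min\<close> makes it independent of the backtracking in the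
  preceding iteration.\<close>

lemma Fval_add_gap_le_R: "Fval k + \<delta> * \<gamma>min / 8 * (gap k)\<^sup>2 \<le> R k"
proof -
  have "\<delta> * \<gamma>min / 8 * (gap k)\<^sup>2 \<le> \<delta> * stepsize (k - 1) / 8 * (gap k)\<^sup>2"
    using \<delta> stepsize_ge[of "k - 1"] by (intro mult_right_mono divide_right_mono mult_left_mono) auto
  then show ?thesis using Hval_le_R[of k] by (simp add: Hval_def)
qed

text \<open>Averaging keeps at least the fraction \<open>pmin\<close> of the line search decrease,
  and \<open>\<gamma>min\<close> bounds every step size from below.\<close>

definition rate :: real where "rate = pmin * (1 - \<delta>) * \<gamma>min / 8"

lemma rate_pos: "rate > 0"
  using pmin \<delta> \<gamma>min_pos by (simp add: rate_def)

lemma R_diff_ge: "pmin * (R k - Hval (Suc k)) \<le> R k - R (Suc k)"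
proof -
  have "pmin * (R k - Hval (Suc k)) \<le> p (Suc k) * (R k - Hval (Suc k))"
    using p(1)[of k] Hval_Suc_le_R[of k] by (intro mult_right_mono) auto
  then show ?thesis by (simp add: R_Suc algebra_simps)
qed

lemma R_descent: "rate * (gap (Suc k))\<^sup>2 \<le> R k - R (Suc k)"
proof -
  have "rate * (gap (Suc k))\<^sup>2 = pmin * ((1 - \<delta>) * \<gamma>min / 8 * (gap (Suc k))\<^sup>2)"
    by (simp add: rate_def)
  also have "\<dots> \<le> pmin * ((1 - \<delta>) * stepsize k / 8 * (gap (Suc k))\<^sup>2)"
    using pmin \<delta> stepsize_ge[of k]
    by (intro mult_right_mono divide_right_mono mult_left_mono) auto
  also have "\<dots> \<le> pmin * (R k - Hval (Suc k))"
    using Hval_Suc_le[of k] pmin by (intro mult_left_mono) auto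
  finally show ?thesis using R_diff_ge[of k] by linarith
qed

lemma R_antimono: "antimono R"
proof (rule decseq_SucI)
  fix k
  have "0 \<le> rate * (gap (Suc k))\<^sup>2" using rate_pos by simp
  then show "R (Suc k) \<le> R k" using R_descent[of k] by linarith
qed

section \<open>Limits of the merit values\<close>

definition Rlim :: real where "Rlim = lim R"

lemma R_tendsto: "R \<longlonglongrightarrow> Rlim"
proof -
  obtain m where m: "\<And>z. z \<in> domain_of P1 \<Longrightarrow> ereal m \<le> F z" using F_bounded_below by blast
  have "m \<le> R k" for k
  proof -
    have "ereal m \<le> F (x k)" by (rule m) (simp add: domain_of_def P1_x)
    then show ?thesis using Fval_le_Hval[of k] Hval_le_R[of k] by (simp add: F_x)
  qed
  then obtain L where "R \<longlonglongrightarrow> L" using decseq_convergent[OF R_antimono] by blast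
  then show ?thesis unfolding Rlim_def by (simp add: limI)
qed

lemma R_diff_tendsto: "(\<lambda>k. R k - R (Suc k)) \<longlonglongrightarrow> 0"
  using tendsto_diff[OF R_tendsto LIMSEQ_Suc[OF R_tendsto]] by simp

lemma R_Hval_tendsto: "(\<lambda>k. R k - Hval (Suc k)) \<longlonglongrightarrow> 0"
proof (rule tendsto_sandwich[OF _ _ tendsto_const])
  show "(\<lambda>k. (R k - R (Suc k)) / pmin) \<longlonglongrightarrow> 0"
    using tendsto_divide[OF R_diff_tendsto tendsto_const[of pmin]] pmin by simp
  show "\<forall>\<^sub>F k in sequentially. R k - Hval (Suc k) \<le> (R k - R (Suc k)) / pmin"
    using R_diff_ge pmin by (auto simp: field_simps)
qed (use Hval_Suc_le_R in auto)

lemma Hval_tendsto: "(\<lambda>k. Hval (Suc k)) \<longlonglongrightarrow> Rlim"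
  using tendsto_diff[OF R_tendsto R_Hval_tendsto] by simp

lemma gap_tendsto: "gap \<longlonglongrightarrow> 0"
proof -
  have "(\<lambda>k. (gap (Suc k))\<^sup>2) \<longlonglongrightarrow> 0"
  proof (rule tendsto_sandwich[OF _ _ tendsto_const])
    show "(\<lambda>k. (R k - R (Suc k)) / rate) \<longlonglongrightarrow> 0"
      using tendsto_divide[OF R_diff_tendsto tendsto_const[of rate]] rate_pos by simp
    show "\<forall>\<^sub>F k in sequentially. (gap (Suc k))\<^sup>2 \<le> (R k - R (Suc k)) / rate"
      using R_descent rate_pos by (auto simp: field_simps)
  qed auto
  then have "(\<lambda>k. sqrt ((gap (Suc k))\<^sup>2)) \<longlonglongrightarrow> sqrt 0" by (rule tendsto_real_sqrt)
  then have "(\<lambda>k. gap (Suc k)) \<longlonglongrightarrow> 0" by (simp add: gap_def)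
  then show ?thesis by (rule LIMSEQ_imp_Suc)
qed

text \<open>Step sizes are not known to be bounded along the whole sequence, so vanishing gaps alone
  do not remove the distance term. The line search bounds it by
  \<open>\<delta> / (1 - \<delta>)\<close> times \<open>R k - Hval (Suc k)\<close>.\<close>

lemma Fval_tendsto: "(\<lambda>k. Fval (Suc k)) \<longlonglongrightarrow> Rlim"
proof -
  have "(\<lambda>k. Hval (Suc k) - Fval (Suc k)) \<longlonglongrightarrow> 0"
  proof (rule tendsto_sandwich[OF _ _ tendsto_const])
    show "(\<lambda>k. \<delta> / (1 - \<delta>) * (R k - Hval (Suc k))) \<longlonglongrightarrow> 0"
      by (rule tendsto_mult_right_zero[OF R_Hval_tendsto])
    show "\<forall>\<^sub>F k in sequentially. Hval (Suc k) - Fval (Suc k) \<le> \<delta> / (1 - \<delta>) * (R k - Hval (Suc k))"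
    proof (intro always_eventually allI)
      fix k
      have "\<delta> / (1 - \<delta>) * ((1 - \<delta>) * stepsize k / 8 * (gap (Suc k))\<^sup>2)
          \<le> \<delta> / (1 - \<delta>) * (R k - Hval (Suc k))"
        using Hval_Suc_le[of k] \<delta> by (intro mult_left_mono) auto
      then show "Hval (Suc k) - Fval (Suc k) \<le> \<delta> / (1 - \<delta>) * (R k - Hval (Suc k))"
        using \<delta> by (simp add: Hval_def)
    qed
  qed (use Fval_le_Hval in auto)
  from tendsto_diff[OF Hval_tendsto this] show ?thesis by simp
qed

lemma \<xi>_convex: "P2 (x k) + \<xi> k \<bullet> (z - x k) \<le> P2 z"
  using \<xi>[of k] limiting_subdiff_convex_iff[OF P2_convex] by blast

section \<open>Local bounds and finite backtracking\<close>

lemma extrapolation_le: "norm ((\<eta> ^ i * \<beta>0 k) *\<^sub>R (x k - x (k - 1))) \<le> \<delta> * \<beta>max * gap k"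
proof -
  have "\<eta> * sqrt \<tau> < 1" using \<eta> \<tau> by (simp add: field_simps)
  moreover have "\<eta> * 1 \<le> \<eta> * sqrt \<tau>" using \<eta> \<tau> by (intro mult_left_mono) auto
  ultimately have "\<eta> \<le> 1" by linarith
  then have "\<eta> ^ i \<le> 1" using \<eta> by (simp add: power_le_one)
  then have "\<eta> ^ i * \<beta>0 k \<le> 1 * (\<delta> * \<beta>max)"
    using \<beta>0[of k] \<eta> by (intro mult_mono) auto
  then show ?thesis
    using \<beta>0[of k] \<eta> by (simp add: gap_def abs_mult mult_right_mono)
qed

lemma extrap_diff_le: "norm (extrap k - x k) \<le> \<delta> * \<beta>max * gap k"
  using extrapolation_le[of "j k" k] by (simp add: extrap_def)

lemma \<xi>_locally_bounded: "\<exists>B. \<forall>k. norm (x k - z) < 1 \<longrightarrow> norm (\<xi> k) \<le> B"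
proof -
  obtain B where B: "\<forall>w\<in>cball z 2. norm (P2 w) \<le> B"
    using continuous_on_UNIV_bounded_cball[OF convex_on_continuous[OF open_UNIV P2_convex], where z = z and r = 2] by blast
  have "norm (\<xi> k) \<le> 2 * B" if k: "norm (x k - z) < 1" for k
  proof (rule convex_subgradient_norm_le[OF \<xi>_convex])
    fix w assume "norm (w - x k) \<le> 1"
    then have "norm (w - z) \<le> 2"
      using k norm_triangle_ineq[of "w - x k" "x k - z"] by simp
    then have "w \<in> cball z 2" by (simp add: dist_norm norm_minus_commute)
    then show "\<bar>P2 w\<bar> \<le> B" using B by auto
  qed
  then show ?thesis by blast
qed

lemma gap_eventually_small:
  assumes "e > 0"
  shows "\<forall>\<^sub>F k in sequentially. gap k < e \<and> \<delta> * \<beta>max * gap k < e \<and> gap (Suc k) < e"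
  by (intro eventually_conj order_tendstoD(2)[OF gap_tendsto] order_tendstoD(2)[OF LIMSEQ_Suc[OF gap_tendsto]]
      order_tendstoD(2)[OF tendsto_mult_right_zero[OF gap_tendsto]] assms)

text \<open>Trial \<open>I\<close> of the inner loop succeeds near \<open>z\<close> if \<open>\<tau>\<^sup>I\<close> is so large that the trial point stays
  near \<open>z\<close> and dominates the Lipschitz constant, and \<open>(\<tau>\<eta>\<^sup>2)\<^sup>I\<close> is so small that the extrapolation
  error is paid for by the distance term contained in \<open>R k\<close>.\<close>

lemma stepsize_locally_bounded:
  "\<exists>e>0. \<exists>\<Gamma> K. \<forall>k\<ge>K. norm (x k - z) < e \<longrightarrow> stepsize k \<le> \<Gamma>"
proof -
  obtain u L where u: "u > 0" and "L-lipschitz_on (cball z u \<inter> UNIV) grad_f"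
    using f_lip unfolding locally_lipschitz_on_def by blast
  define e where "e = min u 1"
  have e: "e > 0" "e \<le> 1" using u by (auto simp: e_def)
  have lip: "L-lipschitz_on (cball z e) grad_f"
    using \<open>L-lipschitz_on (cball z u \<inter> UNIV) grad_f\<close> by (rule lipschitz_on_subset) (auto simp: e_def)

  have "continuous_on UNIV f"
    by (intro continuous_at_imp_continuous_on ballI has_derivative_continuous[OF f_grad[unfolded gderiv_def]])
  from continuous_on_UNIV_bounded_cball[OF this] obtain Bf where Bf: "\<forall>w\<in>cball z 1. norm (f w) \<le> Bf" by blast
  obtain B2 where B2: "\<forall>w\<in>cball z 1. norm (P2 w) \<le> B2"
    using continuous_on_UNIV_bounded_cball[OF convex_on_continuous[OF open_UNIV P2_convex], where z = z and r = 1] by blast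
  obtain Bg where Bg: "\<forall>w\<in>cball z 1. norm (grad_f w) \<le> Bg"
    using continuous_on_UNIV_bounded_cball[OF f_C1, where z = z and r = 1] by blast
  obtain B\<xi> where B\<xi>: "\<forall>k. norm (x k - z) < 1 \<longrightarrow> norm (\<xi> k) \<le> B\<xi>"
    using \<xi>_locally_bounded[of z] by blast
  obtain c g where g: "g \<ge> 0" and minorant: "\<And>z. ereal (c - g / 2 * (norm z)\<^sup>2) \<le> P1 z"
    by (rule prox_bounded_quadratic_minorant[OF P1_prox_bounded]) blast
  define V where "V = Bg + B\<xi>"
  \<comment> \<open>\<open>W\<close> bounds the coercive term of the model at the trial point by
    comparison with \<open>x k\<close>: it collects bounds for the linear term, the extrapolation
    error and \<open>P1val k\<close>, minus the constant of the lower bound. \<open>G\<close> makes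
    \<open>\<gamma>\<close> large enough for acceptance (\<open>4 * L\<close>) and for pulling the
    trial point to within \<open>e / 4\<close> of \<open>y\<close>.\<close>
  define W where "W = V + \<delta> * \<gamma>min / 8 + (R 0 + Bf + B2) - (c - g * (norm z + 1)\<^sup>2 - V\<^sup>2 / 2)"
  define G where "G = max (4 * L) (2 * g + 2 + 2 * (\<bar>W\<bar> / (e / 4)\<^sup>2))"
  have "\<forall>\<^sub>F i in sequentially. \<tau> ^ i > G / \<gamma>min"
  proof -
    obtain n where "G / \<gamma>min < \<tau> ^ n" using real_arch_pow[OF \<tau>] by blast
    then have "G / \<gamma>min < \<tau> ^ i" if "i \<ge> n" for i
      using power_increasing[OF that, of \<tau>] \<tau> by linarith
    then show ?thesis by (rule eventually_sequentiallyI)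
  qed
  moreover have "\<forall>\<^sub>F i in sequentially. (\<tau> * \<eta>\<^sup>2) ^ i * (\<gamma>max * \<delta> * \<beta>max\<^sup>2) < \<gamma>min / 8"
  proof -
    have "\<eta>\<^sup>2 < (1 / sqrt \<tau>)\<^sup>2" using \<eta> by (intro power_strict_mono) auto
    then have "\<tau> * \<eta>\<^sup>2 < 1" using \<tau> by (simp add: power_divide field_simps)
    then have "(\<lambda>i. (\<tau> * \<eta>\<^sup>2) ^ i * (\<gamma>max * \<delta> * \<beta>max\<^sup>2)) \<longlonglongrightarrow> 0"
      using \<tau> by (intro tendsto_mult_left_zero LIMSEQ_realpow_zero) auto
    then show ?thesis using \<gamma>min_pos by (intro order_tendstoD(2)) auto
  qed
  ultimately have "\<forall>\<^sub>F i in sequentially. \<tau> ^ i > G / \<gamma>min \<and> (\<tau> * \<eta>\<^sup>2) ^ i * (\<gamma>max * \<delta> * \<beta>max\<^sup>2) < \<gamma>min / 8"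
    by (rule eventually_conj)
  then obtain I where I: "\<tau> ^ I > G / \<gamma>min" "(\<tau> * \<eta>\<^sup>2) ^ I * (\<gamma>max * \<delta> * \<beta>max\<^sup>2) < \<gamma>min / 8"
    by (auto simp: eventually_sequentially)
  obtain K where K: "\<And>k. k \<ge> K \<Longrightarrow> gap k < e / 4 \<and> \<delta> * \<beta>max * gap k < e / 4"
    using gap_eventually_small[of "e / 4"] e by (auto simp: eventually_sequentially)
  have "stepsize k \<le> \<tau> ^ I * \<gamma>max" if k: "k \<ge> K" "norm (x k - z) < e / 2" for k
  proof -
    \<comment> \<open>Trial \<open>I\<close> cannot fail. The radii add up to \<open>e\<close>:
      \<open>e / 2\<close> for the iterate, \<open>e / 4\<close> for extrapolation and
      \<open>e / 4\<close> for the trial step.\<close>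
    have "j k \<le> I"
    proof (rule ccontr)
      assume "\<not> j k \<le> I"
      then have Ij: "I < j k" by simp
      define \<gamma> where "\<gamma> = \<tau> ^ I * \<gamma>0 k"
      define \<beta> where "\<beta> = \<eta> ^ I * \<beta>0 k"
      define y where "y = x k + \<beta> *\<^sub>R (x k - x (k - 1))"
      define v where "v = grad_f y - \<xi> k"
      have "G < \<tau> ^ I * \<gamma>min" using I(1) \<gamma>min_pos by (simp add: field_simps)
      also have "\<dots> \<le> \<gamma>" unfolding \<gamma>_def using \<gamma>0 \<tau> by (intro mult_left_mono) auto
      finally have \<gamma>: "\<gamma> \<ge> 4 * L" "\<gamma> > 2 * g + 2 + 2 * (\<bar>W\<bar> / (e / 4)\<^sup>2)" by (auto simp: G_def)
      have ratio: "0 \<le> \<bar>W\<bar> / (e / 4)\<^sup>2" by simp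
      have y: "norm (x k - y) < e / 4"
        using extrapolation_le[of I k] K[OF k(1)] unfolding y_def \<beta>_def by simp
      have yz: "norm (y - z) < 3 * e / 4"
        using norm_triangle_ineq[of "y - x k" "x k - z"] y k(2) by (simp add: norm_minus_commute)
      have "\<gamma> * \<beta>\<^sup>2 = (\<tau> * \<eta>\<^sup>2) ^ I * (\<gamma>0 k * (\<beta>0 k)\<^sup>2)"
        by (simp add: \<gamma>_def \<beta>_def power2_eq_square power_mult_distrib mult_ac)
      also have "\<dots> \<le> (\<tau> * \<eta>\<^sup>2) ^ I * (\<gamma>max * (\<delta> * \<beta>max)\<^sup>2)"
        using \<gamma>0[of k] \<beta>0[of k] \<gamma>min_pos \<tau> by (intro mult_left_mono mult_mono power_mono) auto
      \<comment> \<open>One \<open>\<delta>\<close> is split off so that the error fits the reserve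
        \<open>\<delta> * \<gamma>min / 8\<close>, which carries this factor itself; for
        \<open>\<delta> = 0\<close> both vanish.\<close>
      also have "\<dots> = \<delta> * ((\<tau> * \<eta>\<^sup>2) ^ I * (\<gamma>max * \<delta> * \<beta>max\<^sup>2))"
        by (simp add: power_mult_distrib power2_eq_square mult_ac)
      also have "\<dots> \<le> \<delta> * (\<gamma>min / 8)" using I(2) \<delta> by (intro mult_left_mono) auto
      finally have "\<gamma> * \<beta>\<^sup>2 * (gap k)\<^sup>2 \<le> \<delta> * (\<gamma>min / 8) * (gap k)\<^sup>2" by (intro mult_right_mono) auto
      then have err: "\<gamma> * (norm (x k - y))\<^sup>2 \<le> \<delta> * \<gamma>min / 8 * (gap k)\<^sup>2"
        by (simp add: y_def gap_def power_mult_distrib mult.assoc)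
      have "gap k \<le> 1" using K[OF k(1)] e by linarith
      then have "(gap k)\<^sup>2 \<le> 1" by (simp add: gap_def power_le_one)
      then have "\<delta> * \<gamma>min / 8 * (gap k)\<^sup>2 \<le> \<delta> * \<gamma>min / 8"
        using \<delta> \<gamma>min_pos by (intro mult_left_le) auto
      with err have err1: "\<gamma> * (norm (x k - y))\<^sup>2 \<le> \<delta> * \<gamma>min / 8" by linarith
      have v: "norm v \<le> V"
        unfolding v_def V_def
      proof -
        have "y \<in> cball z 1" using yz e by (simp add: dist_norm norm_minus_commute)
        then have "norm (grad_f y) \<le> Bg" using Bg by blast
        moreover have "norm (\<xi> k) \<le> B\<xi>" using B\<xi> k e by simp
        ultimately show "norm (grad_f y - \<xi> k) \<le> Bg + B\<xi>"
          using norm_triangle_ineq4[of "grad_f y" "\<xi> k"] by linarith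
      qed
      have "\<exists>w. is_arg_min (prox_model grad_f P1 (\<xi> k) y \<gamma>) (\<lambda>_. True) w"
      proof (rule prox_minimizer_exists[OF P1_closed P1_proper minorant g])
        show "2 * g + 1 < \<gamma>" using \<gamma>(2) ratio by linarith
      qed
      then have w: "is_arg_min (prox_model grad_f P1 (\<xi> k) y \<gamma>) (\<lambda>_. True) (xt k I)"
        and rejected: "\<not> line_search F \<delta> (R k) \<gamma> (x k) (xt k I)"
        using failed[OF Ij] unfolding y_def[symmetric] \<beta>_def[symmetric] \<gamma>_def[symmetric] by blast+
      have "ereal (c - g * (norm y)\<^sup>2 - (norm v)\<^sup>2 / 2 + (\<gamma> / 2 - g - 1 / 2) * (norm (xt k I - y))\<^sup>2)
          \<le> prox_model grad_f P1 (\<xi> k) y \<gamma> (xt k I)"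
        unfolding v_def by (rule prox_model_lower_bound[OF minorant g])
      also have "\<dots> \<le> prox_model grad_f P1 (\<xi> k) y \<gamma> (x k)" by (rule prox_minimizer_le[OF w])
      also have "\<dots> = ereal (v \<bullet> (x k - y) + \<gamma> / 2 * (norm (x k - y))\<^sup>2 + P1val k)"
        by (simp add: prox_model_def P1_x v_def)
      finally have "c - g * (norm y)\<^sup>2 - (norm v)\<^sup>2 / 2 + (\<gamma> / 2 - g - 1 / 2) * (norm (xt k I - y))\<^sup>2
          \<le> v \<bullet> (x k - y) + \<gamma> / 2 * (norm (x k - y))\<^sup>2 + P1val k" by simp
      moreover have "v \<bullet> (x k - y) \<le> V"
      proof -
        have "v \<bullet> (x k - y) \<le> norm v * norm (x k - y)" by (rule norm_cauchy_schwarz)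
        also have "\<dots> \<le> V * 1"
          using v y e order_trans[OF norm_ge_zero v] by (intro mult_mono) auto
        finally show ?thesis by simp
      qed
      moreover have "P1val k \<le> R 0 + Bf + B2"
      proof -
        have "Fval k \<le> R 0"
          using Fval_le_Hval[of k] Hval_le_R[of k] antimonoD[OF R_antimono, of 0 k] by simp
        moreover have "x k \<in> cball z 1" using k e by (simp add: dist_norm norm_minus_commute)
        then have "\<bar>f (x k)\<bar> \<le> Bf" "\<bar>P2 (x k)\<bar> \<le> B2" using Bf B2 unfolding real_norm_def by blast+
        ultimately show ?thesis by (simp add: Fval_def)
      qed
      moreover have "g * (norm y)\<^sup>2 \<le> g * (norm z + 1)\<^sup>2"
        using norm_triangle_ineq[of "y - z" z] yz e g by (intro mult_left_mono power_mono) auto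
      moreover have "(norm v)\<^sup>2 \<le> V\<^sup>2" using v by (intro power_mono) auto
      moreover have "\<gamma> / 2 * (norm (x k - y))\<^sup>2 \<le> \<delta> * \<gamma>min / 8"
      proof -
        have "\<gamma> / 2 * (norm (x k - y))\<^sup>2 \<le> \<gamma> * (norm (x k - y))\<^sup>2"
          using \<gamma>(2) g ratio by (intro mult_right_mono) (linarith, simp)
        then show ?thesis using err1 by linarith
      qed
      ultimately have "(\<gamma> / 2 - g - 1 / 2) * (norm (xt k I - y))\<^sup>2 \<le> W"
        unfolding W_def by linarith
      moreover have "\<bar>W\<bar> / (e / 4)\<^sup>2 * (norm (xt k I - y))\<^sup>2 + 1 / 2 * (norm (xt k I - y))\<^sup>2 \<le> (\<gamma> / 2 - g - 1 / 2) * (norm (xt k I - y))\<^sup>2"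
        unfolding distrib_right[symmetric] using \<gamma>(2) by (intro mult_right_mono) auto
      ultimately have bnd: "\<bar>W\<bar> / (e / 4)\<^sup>2 * (norm (xt k I - y))\<^sup>2 + 1 / 2 * (norm (xt k I - y))\<^sup>2 \<le> \<bar>W\<bar>"
        by linarith
      \<comment> \<open>The extra half of the squared distance in \<open>bnd\<close> keeps the
        contradiction strict when \<open>W = 0\<close>.\<close>
      have "norm (xt k I - y) \<le> e / 4"
      proof (rule ccontr)
        assume "\<not> ?thesis"
        then have "(e / 4)\<^sup>2 < (norm (xt k I - y))\<^sup>2" using e by (intro power_strict_mono) auto
        moreover have "\<bar>W\<bar> / (e / 4)\<^sup>2 * (e / 4)\<^sup>2 = \<bar>W\<bar>" using e by simp
        moreover have "\<bar>W\<bar> / (e / 4)\<^sup>2 * (e / 4)\<^sup>2 \<le> \<bar>W\<bar> / (e / 4)\<^sup>2 * (norm (xt k I - y))\<^sup>2"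
          using calculation ratio by (intro mult_left_mono) auto
        ultimately show False using bnd zero_le_power2[of "e / 4"] by linarith
      qed
      then have wz: "norm (xt k I - z) \<le> e"
        using norm_triangle_ineq[of "xt k I - y" "y - z"] yz by simp
      have "line_search F \<delta> (R k) \<gamma> (x k) (xt k I)"
      proof (rule line_search_acceptance[OF f_grad lip convex_cball _ _ _ P1_proper P1_x \<xi>_convex w \<gamma>(1)])
        show "f (x k) + P1val k - P2 (x k) + \<gamma> * (norm (x k - y))\<^sup>2 \<le> R k"
          using Fval_add_gap_le_R[of k] err by (simp add: Fval_def)
      qed (use k yz wz e in \<open>simp_all add: dist_norm norm_minus_commute[of z]\<close>)
      then show False using rejected by simp
    qed
    then have "\<tau> ^ j k * \<gamma>0 k \<le> \<tau> ^ I * \<gamma>max"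
      using \<tau> \<gamma>0[of k] \<gamma>min_pos by (intro mult_mono power_increasing) auto
    then show ?thesis by (simp add: stepsize_def)
  qed
  then show ?thesis
    using e by (intro exI[of _ "e / 2"] exI[of _ "\<tau> ^ I * \<gamma>max"] exI[of _ K] conjI) auto
qed

section \<open>Subgradients of the size of two steps\<close>

lemma extrap_step_le: "norm (x (Suc k) - extrap k) \<le> gap (Suc k) + \<delta> * \<beta>max * gap k"
  using norm_triangle_ineq4[of "x (Suc k) - x k" "extrap k - x k"] extrap_diff_le[of k]
  by (simp add: gap_def)

text \<open>The optimality condition at \<open>x (Suc k)\<close> involves a gradient at
  \<open>extrap k\<close> and a subgradient at \<open>x k\<close>; adding the gradients at
  \<open>x (Suc k)\<close> leaves gradient differences and the proximal term, all controlled by the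
  two latest gaps.\<close>

lemma frechet_subgradient_small:
  assumes N: "open N" "z \<in> N" and P2: "\<And>w. w \<in> N \<Longrightarrow> GDERIV P2 w :> grad_P2 w"
    and lip2: "locally_lipschitz_on N grad_P2"
  obtains e C \<Gamma> K where "e > 0" "C > 0"
    "\<forall>k\<ge>K. norm (x k - z) < e \<longrightarrow> stepsize k \<le> \<Gamma> \<and>
       (\<exists>d\<in>frechet_subdiff F (x (Suc k)). norm d \<le> C * (gap (Suc k) + gap k))"
proof -
  obtain e0 \<Gamma> K0 where e0: "e0 > 0" and \<Gamma>: "\<And>k. \<lbrakk>k \<ge> K0; norm (x k - z) < e0\<rbrakk> \<Longrightarrow> stepsize k \<le> \<Gamma>"
    using stepsize_locally_bounded[of z] by metis
  obtain e1 L1 where e1: "e1 > 0" and lip1: "L1-lipschitz_on (cball z e1 \<inter> UNIV) grad_f"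
    using f_lip unfolding locally_lipschitz_on_def by blast
  obtain e2 L2 where e2: "e2 > 0" and lip2: "L2-lipschitz_on (cball z e2 \<inter> N) grad_P2"
    using lip2 N(2) unfolding locally_lipschitz_on_def by blast
  obtain e3 where e3: "e3 > 0" "cball z e3 \<subseteq> N"
    using N open_contains_cball by blast
  \<comment> \<open>The half leaves room: from an iterate within \<open>e\<close> of
    \<open>z\<close>, the next iterate and the extrapolated point stay within \<open>2 * e\<close>,
    where the Lipschitz estimates hold.\<close>
  define e where "e = min (min e0 e1) (min e2 e3) / 2"
  have e: "e > 0" "e < e0" "2 * e \<le> e1" "2 * e \<le> e2" "2 * e \<le> e3"
    using e0 e1 e2 e3 by (auto simp: e_def)
  obtain K1 where K1: "\<And>k. k \<ge> K1 \<Longrightarrow> gap k < e \<and> \<delta> * \<beta>max * gap k < e \<and> gap (Suc k) < e"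
    using gap_eventually_small[OF e(1)] by (auto simp: eventually_sequentially)
  define C where "C = (L1 + \<bar>\<Gamma>\<bar>) * (1 + \<delta> * \<beta>max) + L2 + 1"
  have L: "L1 \<ge> 0" "L2 \<ge> 0" using lip1 lip2 lipschitz_on_nonneg by auto
  have \<delta>\<beta>: "0 \<le> \<delta> * \<beta>max" using \<delta> \<beta>max_nonneg by simp
  have "0 \<le> (L1 + \<bar>\<Gamma>\<bar>) * (1 + \<delta> * \<beta>max)" using L \<delta>\<beta> by (intro mult_nonneg_nonneg) auto
  then have C: "C > 0" using L by (simp add: C_def)
  show ?thesis
  proof (rule that[OF e(1) C], intro allI impI)
    fix k assume k: "max K0 K1 \<le> k" "norm (x k - z) < e"
    have \<Gamma>k: "stepsize k \<le> \<Gamma>" using \<Gamma>[of k] k e by simp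
    have xk: "x k \<in> cball z (2 * e)" using k e by (simp add: dist_norm norm_minus_commute)
    have "norm (x (Suc k) - z) \<le> 2 * e"
      using norm_triangle_ineq[of "x (Suc k) - x k" "x k - z"] k(2) K1[of k] k(1) by (simp add: gap_def)
    then have xs: "x (Suc k) \<in> cball z (2 * e)" by (simp add: dist_norm norm_minus_commute)
    have "norm (extrap k - z) \<le> 2 * e"
      using norm_triangle_ineq[of "extrap k - x k" "x k - z"] k(2) K1[of k] k(1) extrap_diff_le[of k] by simp
    then have ek: "extrap k \<in> cball z (2 * e)" by (simp add: dist_norm norm_minus_commute)
    have sub: "cball z (2 * e) \<subseteq> cball z e1 \<inter> UNIV" "cball z (2 * e) \<subseteq> cball z e2 \<inter> N"
      using e e3(2) by auto
    have P2k: "GDERIV P2 (x k) :> grad_P2 (x k)" and P2s: "GDERIV P2 (x (Suc k)) :> grad_P2 (x (Suc k))"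
      using P2 xk xs sub(2) by auto
    have \<xi>k: "\<xi> k = grad_P2 (x k)"
      by (rule convex_subgradient_eq_gradient[OF \<xi>_convex P2k])
    define d where "d = - (grad_f (extrap k) - \<xi> k + stepsize k *\<^sub>R (x (Suc k) - extrap k))
        + (grad_f (x (Suc k)) - grad_P2 (x (Suc k)))"
    have "d \<in> frechet_subdiff F (x (Suc k))"
      unfolding d_def
      by (rule objective_frechet_subgradient[OF prox_minimizer_subgradient[OF P1_proper minimizer'] f_grad P2s])
    moreover have "norm d \<le> C * (gap (Suc k) + gap k)"
    proof -
      define n where "n = norm (x (Suc k) - extrap k)"
      have "d = (grad_f (x (Suc k)) - grad_f (extrap k)) - (grad_P2 (x (Suc k)) - grad_P2 (x k))
          - stepsize k *\<^sub>R (x (Suc k) - extrap k)"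
        by (simp add: d_def \<xi>k)
      then have "norm d \<le> norm (grad_f (x (Suc k)) - grad_f (extrap k))
          + norm (grad_P2 (x (Suc k)) - grad_P2 (x k)) + norm (stepsize k *\<^sub>R (x (Suc k) - extrap k))"
        by (metis norm_triangle_le_diff add_mono norm_triangle_ineq4 order_refl)
      also have "\<dots> \<le> L1 * n + L2 * gap (Suc k) + \<Gamma> * n"
      proof (intro add_mono)
        show "norm (grad_f (x (Suc k)) - grad_f (extrap k)) \<le> L1 * n"
          unfolding n_def using xs ek sub by (intro lipschitz_on_normD[OF lip1]) auto
        have "norm (grad_P2 (x (Suc k)) - grad_P2 (x k)) \<le> L2 * norm (x (Suc k) - x k)"
          using xs xk sub by (intro lipschitz_on_normD[OF lip2]) auto
        then show "norm (grad_P2 (x (Suc k)) - grad_P2 (x k)) \<le> L2 * gap (Suc k)" by (simp add: gap_def)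
        show "norm (stepsize k *\<^sub>R (x (Suc k) - extrap k)) \<le> \<Gamma> * n"
          using \<Gamma>k stepsize_pos[of k] by (simp add: n_def mult_right_mono)
      qed
      also have "\<dots> \<le> (L1 + \<bar>\<Gamma>\<bar>) * n + L2 * gap (Suc k)"
        using mult_right_mono[of \<Gamma> "\<bar>\<Gamma>\<bar>" n] by (simp add: n_def algebra_simps)
      also have "(L1 + \<bar>\<Gamma>\<bar>) * n \<le> (L1 + \<bar>\<Gamma>\<bar>) * ((1 + \<delta> * \<beta>max) * (gap (Suc k) + gap k))"
      proof (rule mult_left_mono)
        have "0 \<le> \<delta> * \<beta>max * gap (Suc k)" "0 \<le> gap k" using \<delta>\<beta> by (simp_all add: gap_def)
        then show "n \<le> (1 + \<delta> * \<beta>max) * (gap (Suc k) + gap k)"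
          using extrap_step_le[of k] by (simp add: n_def algebra_simps)
      qed (use L in simp)
      also have "L2 * gap (Suc k) \<le> (L2 + 1) * (gap (Suc k) + gap k)"
        using L by (intro mult_mono) (auto simp: gap_def)
      finally show ?thesis by (simp add: C_def algebra_simps)
    qed
    ultimately show "stepsize k \<le> \<Gamma> \<and>
       (\<exists>d\<in>frechet_subdiff F (x (Suc k)). norm d \<le> C * (gap (Suc k) + gap k))"
      using \<Gamma>k by blast
  qed
qed

section \<open>Limits along a convergent subsequence\<close>

context
  fixes \<sigma> :: "nat \<Rightarrow> nat" and z :: 'a
  assumes \<sigma>: "strict_mono \<sigma>" and \<sigma>_lim: "(x \<circ> \<sigma>) \<longlonglongrightarrow> z"
begin

lemma gap_subseq: "(\<lambda>n. gap (\<sigma> n)) \<longlonglongrightarrow> 0" "(\<lambda>n. gap (Suc (\<sigma> n))) \<longlonglongrightarrow> 0"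
  using LIMSEQ_subseq_LIMSEQ[OF gap_tendsto \<sigma>] LIMSEQ_subseq_LIMSEQ[OF LIMSEQ_Suc[OF gap_tendsto] \<sigma>]
  by (simp_all add: o_def)

lemma x_subseq: "(\<lambda>n. x (\<sigma> n)) \<longlonglongrightarrow> z"
  using \<sigma>_lim by (simp add: o_def)

lemma Suc_subseq: "(\<lambda>n. x (Suc (\<sigma> n))) \<longlonglongrightarrow> z"
proof -
  have "(\<lambda>n. x (Suc (\<sigma> n)) - x (\<sigma> n)) \<longlonglongrightarrow> 0"
    using gap_subseq(2) by (intro tendsto_norm_zero_cancel[of "\<lambda>n. x (Suc (\<sigma> n)) - x (\<sigma> n)"]) (simp add: gap_def)
  from tendsto_add[OF this x_subseq] show ?thesis by simp
qed

lemma extrap_subseq: "(\<lambda>n. extrap (\<sigma> n)) \<longlonglongrightarrow> z"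
proof -
  have "(\<lambda>n. extrap (\<sigma> n) - x (\<sigma> n)) \<longlonglongrightarrow> 0"
  proof (rule Lim_null_comparison)
    show "\<forall>\<^sub>F n in sequentially. norm (extrap (\<sigma> n) - x (\<sigma> n)) \<le> \<delta> * \<beta>max * gap (\<sigma> n)"
      using extrap_diff_le by simp
    show "(\<lambda>n. \<delta> * \<beta>max * gap (\<sigma> n)) \<longlonglongrightarrow> 0"
      by (rule tendsto_mult_right_zero[OF gap_subseq(1)])
  qed
  from tendsto_add[OF this x_subseq] show ?thesis by simp
qed

lemma P1val_subseq: "(\<lambda>n. P1val (Suc (\<sigma> n))) \<longlonglongrightarrow> Rlim - f z + P2 z"
proof -
  have f: "(\<lambda>n. f (x (Suc (\<sigma> n)))) \<longlonglongrightarrow> f z"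
    using has_derivative_continuous[OF f_grad[unfolded gderiv_def, of z]] Suc_subseq
    by (rule isCont_tendsto_compose)
  have "isCont P2 z"
    using convex_on_continuous[OF open_UNIV P2_convex] by (simp add: continuous_on_eq_continuous_at)
  then have P2: "(\<lambda>n. P2 (x (Suc (\<sigma> n)))) \<longlonglongrightarrow> P2 z"
    using Suc_subseq by (rule isCont_tendsto_compose)
  have "(\<lambda>n. Fval (Suc (\<sigma> n))) \<longlonglongrightarrow> Rlim"
    using LIMSEQ_subseq_LIMSEQ[OF Fval_tendsto \<sigma>] by (simp add: o_def)
  from tendsto_add[OF tendsto_diff[OF this f] P2] show ?thesis by (simp add: Fval_def)
qed

lemma stepsize_subseq_bounded: "\<exists>\<Gamma>. \<forall>\<^sub>F n in sequentially. stepsize (\<sigma> n) \<le> \<Gamma>"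
proof -
  obtain e \<Gamma> K where e: "e > 0" and \<Gamma>: "\<And>k. \<lbrakk>k \<ge> K; norm (x k - z) < e\<rbrakk> \<Longrightarrow> stepsize k \<le> \<Gamma>"
    using stepsize_locally_bounded[of z] by metis
  have "\<forall>\<^sub>F n in sequentially. \<sigma> n \<ge> K"
    using filterlim_subseq[OF \<sigma>] by (simp add: filterlim_at_top)
  moreover have "\<forall>\<^sub>F n in sequentially. dist (x (\<sigma> n)) z < e"
    using tendstoD[OF x_subseq e] .
  ultimately have "\<forall>\<^sub>F n in sequentially. stepsize (\<sigma> n) \<le> \<Gamma>"
    by eventually_elim (simp add: \<Gamma> dist_norm)
  then show ?thesis by blast
qed

lemma stepsize_scaled_subseq: "(\<lambda>n. stepsize (\<sigma> n) *\<^sub>R (x (Suc (\<sigma> n)) - extrap (\<sigma> n))) \<longlonglongrightarrow> 0"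
proof -
  obtain \<Gamma> where \<Gamma>: "\<forall>\<^sub>F n in sequentially. stepsize (\<sigma> n) \<le> \<Gamma>"
    using stepsize_subseq_bounded by blast
  show ?thesis
  proof (rule Lim_null_comparison)
    show "\<forall>\<^sub>F n in sequentially. norm (stepsize (\<sigma> n) *\<^sub>R (x (Suc (\<sigma> n)) - extrap (\<sigma> n)))
        \<le> \<Gamma> * norm (x (Suc (\<sigma> n)) - extrap (\<sigma> n))"
      using \<Gamma> by eventually_elim (simp add: mult_right_mono less_imp_le[OF stepsize_pos] abs_of_pos[OF stepsize_pos])
    have "(\<lambda>n. x (Suc (\<sigma> n)) - extrap (\<sigma> n)) \<longlonglongrightarrow> 0"
      using tendsto_diff[OF Suc_subseq extrap_subseq] by simp
    then show "(\<lambda>n. \<Gamma> * norm (x (Suc (\<sigma> n)) - extrap (\<sigma> n))) \<longlonglongrightarrow> 0"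
      by (intro tendsto_mult_right_zero tendsto_norm_zero)
  qed
qed

lemma \<xi>_subseq_bounded: "\<exists>B. \<forall>\<^sub>F n in sequentially. norm (\<xi> (\<sigma> n)) \<le> B"
proof -
  obtain B where B: "\<forall>k. norm (x k - z) < 1 \<longrightarrow> norm (\<xi> k) \<le> B"
    using \<xi>_locally_bounded[of z] by blast
  have "\<forall>\<^sub>F n in sequentially. dist (x (\<sigma> n)) z < 1"
    using tendstoD[OF x_subseq] by simp
  then have "\<forall>\<^sub>F n in sequentially. norm (\<xi> (\<sigma> n)) \<le> B"
    by eventually_elim (use B in \<open>simp add: dist_norm\<close>)
  then show ?thesis by blast
qed

text \<open>Closedness of \<open>P1\<close> gives only one inequality. For the other,
  \<open>z\<close> competes with the minimiser \<open>x (Suc (\<sigma> n))\<close> in its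
  subproblem, and bounded step sizes make the price of this comparison vanish.\<close>

lemma P1_accumulation: "P1 z = ereal (Rlim - f z + P2 z)"
proof (rule antisym)
  have lim: "(\<lambda>n. P1 (x (Suc (\<sigma> n)))) \<longlonglongrightarrow> ereal (Rlim - f z + P2 z)"
    using P1val_subseq by (simp add: P1_x)
  show "P1 z \<le> ereal (Rlim - f z + P2 z)"
    by (rule lower_semicontinuous_tendsto_le[OF P1_closed Suc_subseq lim])
  then obtain pz where pz: "P1 z = ereal pz"
    using P1_proper by (cases "P1 z") (auto simp: proper_fun_def)
  obtain B where B: "\<forall>\<^sub>F n in sequentially. norm (\<xi> (\<sigma> n)) \<le> B" using \<xi>_subseq_bounded by blast
  obtain \<Gamma> where \<Gamma>: "\<forall>\<^sub>F n in sequentially. stepsize (\<sigma> n) \<le> \<Gamma>" using stepsize_subseq_bounded by blast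
  let ?s = "\<lambda>n. norm (z - x (Suc (\<sigma> n)))" and ?t = "\<lambda>n. norm (z - extrap (\<sigma> n))"
  have st: "?s \<longlonglongrightarrow> 0" "?t \<longlonglongrightarrow> 0"
    using tendsto_diff[OF tendsto_const Suc_subseq, of z] tendsto_diff[OF tendsto_const extrap_subseq, of z]
    by (auto intro: tendsto_norm_zero)
  have grad: "(\<lambda>n. grad_f (extrap (\<sigma> n))) \<longlonglongrightarrow> grad_f z"
    using f_C1 extrap_subseq by (auto simp: continuous_on_eq_continuous_at intro: isCont_tendsto_compose)
  have "\<forall>\<^sub>F n in sequentially. P1val (Suc (\<sigma> n))
      \<le> pz + (norm (grad_f (extrap (\<sigma> n))) + B) * ?s n + \<Gamma> / 2 * (?t n)\<^sup>2"
    using B \<Gamma>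
  proof eventually_elim
    case (elim n)
    define v where "v = grad_f (extrap (\<sigma> n)) - \<xi> (\<sigma> n)"
    have "v \<bullet> (x (Suc (\<sigma> n)) - extrap (\<sigma> n)) + stepsize (\<sigma> n) / 2 * (norm (x (Suc (\<sigma> n)) - extrap (\<sigma> n)))\<^sup>2
        + P1val (Suc (\<sigma> n)) \<le> v \<bullet> (z - extrap (\<sigma> n)) + stepsize (\<sigma> n) / 2 * (?t n)\<^sup>2 + pz"
      using prox_minimizer_le[OF minimizer'[of "\<sigma> n"], of z] by (simp add: prox_model_def P1_x pz v_def)
    moreover have "0 \<le> stepsize (\<sigma> n) / 2 * (norm (x (Suc (\<sigma> n)) - extrap (\<sigma> n)))\<^sup>2"
      using stepsize_pos[of "\<sigma> n"] by simp
    moreover have "stepsize (\<sigma> n) / 2 * (?t n)\<^sup>2 \<le> \<Gamma> / 2 * (?t n)\<^sup>2"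
      using elim by (intro mult_right_mono) auto
    moreover have "v \<bullet> (z - extrap (\<sigma> n)) - v \<bullet> (x (Suc (\<sigma> n)) - extrap (\<sigma> n)) = v \<bullet> (z - x (Suc (\<sigma> n)))"
      by (simp add: inner_diff_right)
    moreover have "v \<bullet> (z - x (Suc (\<sigma> n))) \<le> (norm (grad_f (extrap (\<sigma> n))) + B) * ?s n"
    proof -
      have "norm v \<le> norm (grad_f (extrap (\<sigma> n))) + B"
        using norm_triangle_ineq4[of "grad_f (extrap (\<sigma> n))" "\<xi> (\<sigma> n)"] elim by (simp add: v_def)
      then have "norm v * ?s n \<le> (norm (grad_f (extrap (\<sigma> n))) + B) * ?s n"
        by (intro mult_right_mono) auto
      then show ?thesis using norm_cauchy_schwarz[of v "z - x (Suc (\<sigma> n))"] by linarith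
    qed
    ultimately show ?case by linarith
  qed
  moreover have "(\<lambda>n. pz + (norm (grad_f (extrap (\<sigma> n))) + B) * ?s n + \<Gamma> / 2 * (?t n)\<^sup>2)
      \<longlonglongrightarrow> pz + (norm (grad_f z) + B) * 0 + \<Gamma> / 2 * 0\<^sup>2"
    by (intro tendsto_intros grad st)
  ultimately have "Rlim - f z + P2 z \<le> pz"
    using tendsto_le[OF sequentially_bot _ P1val_subseq] by simp
  then show "ereal (Rlim - f z + P2 z) \<le> P1 z" by (simp add: pz)
qed

lemma F_accumulation: "F z = ereal Rlim"
  by (simp add: objective_def P1_accumulation)

text \<open>Only convexity of \<open>P2\<close> may be used, because smoothness is given around
  stationary points alone and this result is what places \<open>z\<close> there. Local boundedness
  of \<open>\<xi>\<close> lets a further subsequence converge.\<close>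

lemma accumulation_stationary: "z \<in> stationary_points f grad_f P1 P2"
proof -
  obtain B where "\<forall>\<^sub>F n in sequentially. norm (\<xi> (\<sigma> n)) \<le> B" using \<xi>_subseq_bounded by blast
  then obtain n0 where n0: "\<And>n. n \<ge> n0 \<Longrightarrow> norm (\<xi> (\<sigma> n)) \<le> B" by (auto simp: eventually_sequentially)
  have "\<forall>n. \<xi> (\<sigma> (n + n0)) \<in> cball 0 B" using n0 by simp
  then obtain w s where s: "strict_mono s" and w: "((\<lambda>n. \<xi> (\<sigma> (n + n0))) \<circ> s) \<longlonglongrightarrow> w"
    using compact_cball[of 0 B] unfolding compact_def by metis
  define \<kappa> where "\<kappa> n = s n + n0" for n
  have \<kappa>: "strict_mono \<kappa>" using s by (simp add: \<kappa>_def strict_mono_def)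
  have sub: "(\<lambda>n. X (\<kappa> n)) \<longlonglongrightarrow> l" if "X \<longlonglongrightarrow> l" for X :: "nat \<Rightarrow> 'b::topological_space" and l
    using LIMSEQ_subseq_LIMSEQ[OF that \<kappa>] by (simp add: o_def)
  have w: "(\<lambda>n. \<xi> (\<sigma> (\<kappa> n))) \<longlonglongrightarrow> w" using w by (simp add: \<kappa>_def o_def)
  have "P2 z + w \<bullet> (u - z) \<le> P2 u" for u
  proof -
    have "isCont P2 z"
      using convex_on_continuous[OF open_UNIV P2_convex] by (simp add: continuous_on_eq_continuous_at)
    then have "(\<lambda>n. P2 (x (\<sigma> n))) \<longlonglongrightarrow> P2 z"
      using x_subseq by (rule isCont_tendsto_compose)
    then have "(\<lambda>n. P2 (x (\<sigma> (\<kappa> n))) + \<xi> (\<sigma> (\<kappa> n)) \<bullet> (u - x (\<sigma> (\<kappa> n)))) \<longlonglongrightarrow> P2 z + w \<bullet> (u - z)"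
      by (intro tendsto_intros w sub[OF x_subseq] sub)
    then show ?thesis by (rule LIMSEQ_le_const2) (use \<xi>_convex in blast)
  qed
  then have w_sub: "w \<in> limiting_subdiff (\<lambda>z. ereal (P2 z)) z"
    using limiting_subdiff_convex_iff[OF P2_convex] by blast
  define D where "D n = - (grad_f (extrap (\<sigma> n)) - \<xi> (\<sigma> n) + stepsize (\<sigma> n) *\<^sub>R (x (Suc (\<sigma> n)) - extrap (\<sigma> n)))" for n
  have "(\<lambda>n. grad_f (extrap (\<sigma> n))) \<longlonglongrightarrow> grad_f z"
    using f_C1 extrap_subseq by (auto simp: continuous_on_eq_continuous_at intro: isCont_tendsto_compose)
  then have "(\<lambda>n. D (\<kappa> n)) \<longlonglongrightarrow> - (grad_f z - w + 0)"
    unfolding D_def by (intro tendsto_intros w sub[OF stepsize_scaled_subseq] sub)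
  moreover have "D n \<in> frechet_subdiff P1 (x (Suc (\<sigma> n)))" for n
    unfolding D_def by (rule prox_minimizer_subgradient[OF P1_proper minimizer'])
  moreover have "(\<lambda>n. P1 (x (Suc (\<sigma> n)))) \<longlonglongrightarrow> P1 z"
    using P1val_subseq by (simp add: P1_x P1_accumulation)
  ultimately have "w - grad_f z \<in> limiting_subdiff P1 z"
    using sub[OF Suc_subseq]
    by (intro limiting_subdiffI[where X = "\<lambda>n. x (Suc (\<sigma> (\<kappa> n)))" and D = "\<lambda>n. D (\<kappa> n)"])
      (auto simp: P1_accumulation intro: sub[of "\<lambda>n. P1 (x (Suc (\<sigma> n)))"])
  moreover have "0 = grad_f z + (w - grad_f z) - w" by simp
  moreover have "z \<in> domain_of F" by (simp add: domain_of_def F_accumulation)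
  ultimately show ?thesis unfolding stationary_points_def using w_sub by blast
qed

end

section \<open>The KL inequality along the run\<close>

lemma potential_limiting_subgradient_zero:
  assumes small: "\<And>k. \<lbrakk>k \<ge> K; norm (x k - z) < e\<rbrakk> \<Longrightarrow>
       \<exists>d\<in>frechet_subdiff F (x (Suc k)). norm d \<le> C * (gap (Suc k) + gap k)"
    and e: "e > 0" and \<sigma>: "strict_mono \<sigma>" "(x \<circ> \<sigma>) \<longlonglongrightarrow> z"
  shows "0 \<in> limiting_subdiff (potential F \<delta>) (z, z, \<gamma>)"
proof -
  have "\<forall>\<^sub>F n in sequentially. \<sigma> n \<ge> K \<and> dist (x (\<sigma> n)) z < e"
    using filterlim_subseq[OF \<sigma>(1)] tendstoD[OF x_subseq[OF \<sigma>] e]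
    by (simp add: filterlim_at_top eventually_conj_iff)
  then obtain n0 where n0: "\<And>n. n \<ge> n0 \<Longrightarrow> \<sigma> n \<ge> K \<and> dist (x (\<sigma> n)) z < e"
    by (auto simp: eventually_sequentially)
  define \<kappa> where "\<kappa> n = \<sigma> (n + n0)" for n
  have \<kappa>: "strict_mono \<kappa>" using \<sigma>(1) by (simp add: \<kappa>_def strict_mono_def)
  have \<kappa>_lim: "(x \<circ> \<kappa>) \<longlonglongrightarrow> z"
    using LIMSEQ_ignore_initial_segment[OF x_subseq[OF \<sigma>], of n0] by (simp add: \<kappa>_def o_def)
  have "\<forall>n. \<exists>d. d \<in> frechet_subdiff F (x (Suc (\<kappa> n))) \<and> norm d \<le> C * (gap (Suc (\<kappa> n)) + gap (\<kappa> n))"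
    using small n0 by (auto simp: \<kappa>_def dist_norm Bex_def)
  then obtain d where d: "\<And>n. d n \<in> frechet_subdiff F (x (Suc (\<kappa> n)))"
    and d_le: "\<And>n. norm (d n) \<le> C * (gap (Suc (\<kappa> n)) + gap (\<kappa> n))" by metis
  have d_lim: "d \<longlonglongrightarrow> 0"
  proof (rule Lim_null_comparison)
    show "\<forall>\<^sub>F n in sequentially. norm (d n) \<le> C * (gap (Suc (\<kappa> n)) + gap (\<kappa> n))"
      using d_le by simp
    show "(\<lambda>n. C * (gap (Suc (\<kappa> n)) + gap (\<kappa> n))) \<longlonglongrightarrow> 0"
      using tendsto_add[OF gap_subseq(2)[OF \<kappa> \<kappa>_lim] gap_subseq(1)[OF \<kappa> \<kappa>_lim]]
      by (intro tendsto_mult_right_zero) simp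
  qed
  have "(\<lambda>n. Fval (Suc (\<kappa> n))) \<longlonglongrightarrow> Rlim"
    using LIMSEQ_subseq_LIMSEQ[OF Fval_tendsto \<kappa>] by (simp add: o_def)
  then have F_lim: "(\<lambda>n. F (x (Suc (\<kappa> n)))) \<longlonglongrightarrow> F z"
    by (simp add: F_x F_accumulation[OF \<sigma>])
  show ?thesis
  proof (rule limiting_subdiffI)
    \<comment> \<open>Approaching along the diagonal with fixed \<open>\<gamma>\<close> kills every
      derivative of the distance term and leaves \<open>(d n, 0, 0)\<close>; a nonempty limiting
      subdifferential is what makes KL applicable at the limit.\<close>
    show "(\<lambda>n. (x (Suc (\<kappa> n)), x (Suc (\<kappa> n)), \<gamma>)) \<longlonglongrightarrow> (z, z, \<gamma>)"
      by (intro tendsto_intros Suc_subseq[OF \<kappa> \<kappa>_lim])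
    show "(\<lambda>n. (d n, 0, 0 :: real)) \<longlonglongrightarrow> (0 :: 'a \<times> 'a \<times> real)"
      unfolding zero_prod_def by (intro tendsto_intros d_lim)
    show "\<bar>potential F \<delta> (z, z, \<gamma>)\<bar> \<noteq> \<infinity>"
      by (simp add: potential_def F_accumulation[OF \<sigma>])
    show "(\<lambda>n. potential F \<delta> (x (Suc (\<kappa> n)), x (Suc (\<kappa> n)), \<gamma>)) \<longlonglongrightarrow> potential F \<delta> (z, z, \<gamma>)"
      using F_lim by (simp add: potential_def zero_ereal_def[symmetric])
    show "(d n, 0, 0) \<in> frechet_subdiff (potential F \<delta>) (x (Suc (\<kappa> n)), x (Suc (\<kappa> n)), \<gamma>)" for n
      using potential_frechet_subgradient[OF d[of n], where v = "x (Suc (\<kappa> n))"] by simp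
  qed
qed

text \<open>KL is evaluated at \<open>(x (k + 2), x (Suc k), stepsize (Suc k))\<close>. The
  subgradient there costs the gaps with indices \<open>Suc k\<close> and \<open>k + 2\<close>, and
  two descent steps turn their squares into \<open>R k - R (k + 2)\<close>.\<close>

lemma local_recursion:
  assumes \<sigma>: "strict_mono \<sigma>" "(x \<circ> \<sigma>) \<longlonglongrightarrow> z"
    and N: "open N" "z \<in> N" and P2: "\<And>w. w \<in> N \<Longrightarrow> GDERIV P2 w :> grad_P2 w"
    and lip2: "locally_lipschitz_on N grad_P2"
    and KL: "KL_function_exponent_on (UNIV \<times> UNIV \<times> {0<..}) (potential F \<delta>) \<theta>"
    and \<theta>: "\<theta> < 1" and \<alpha>: "1 \<le> \<alpha>" "2 * \<theta> \<le> \<alpha>" "\<alpha> \<le> 2"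
  obtains e A K where "e > 0" "A > 0"
    "\<forall>k\<ge>K. norm (x (Suc k) - z) < e \<longrightarrow>
       (R (k + 2) - Rlim) powr \<alpha> \<le> A * ((R k - Rlim) - (R (k + 2) - Rlim))"
proof -
  obtain e1 C \<Gamma> K1 where e1: "e1 > 0" and C: "C > 0" and small:
    "\<forall>k\<ge>K1. norm (x k - z) < e1 \<longrightarrow> stepsize k \<le> \<Gamma> \<and>
       (\<exists>d\<in>frechet_subdiff F (x (Suc k)). norm d \<le> C * (gap (Suc k) + gap k))"
    by (rule frechet_subgradient_small[OF N P2 lip2])
  define S where "S = (\<lambda>\<gamma>. (z, z, \<gamma>)) ` {\<gamma>min..\<Gamma>}"
  have S: "compact S" unfolding S_def by (intro compact_continuous_image continuous_intros compact_Icc)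
  have S_sub: "S \<subseteq> UNIV \<times> UNIV \<times> {0<..}" using \<gamma>min_pos by (auto simp: S_def)
  have S_subdiff: "limiting_subdiff (potential F \<delta>) s \<noteq> {}" if sS: "s \<in> S" for s
  proof -
    obtain \<gamma> where "s = (z, z, \<gamma>)" using sS by (auto simp: S_def)
    moreover have "0 \<in> limiting_subdiff (potential F \<delta>) (z, z, \<gamma>)" for \<gamma>
      by (rule potential_limiting_subgradient_zero[OF _ e1 \<sigma>, of K1 C]) (use small in blast)
    ultimately show ?thesis by blast
  qed
  have S_val: "potential F \<delta> s = ereal Rlim" if "s \<in> S" for s
    using that by (auto simp: S_def potential_def F_accumulation[OF \<sigma>])
  obtain \<epsilon> M where \<epsilon>: "\<epsilon> > 0" and M: "M > 0" and ineq:
    "\<forall>s y t d. s \<in> S \<and> dist y s < \<epsilon> \<and> potential F \<delta> y = ereal t \<and> Rlim < t \<and> t < Rlim + \<epsilon> \<and>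
        d \<in> limiting_subdiff (potential F \<delta>) y \<longrightarrow> (t - Rlim) powr \<theta> \<le> M * norm d"
    by (rule KL_exponent_uniform[OF KL \<theta> S S_sub S_subdiff S_val])
  \<comment> \<open>Against the point of \<open>S\<close> with the same step size, the coordinates
    contribute less than \<open>2 * e\<close>, less than \<open>e\<close>, and 0, which stays below
    \<open>\<epsilon>\<close>.\<close>
  define e where "e = min e1 (\<epsilon> / 4)"
  have e: "e > 0" "e \<le> e1" "e \<le> \<epsilon> / 4" using e1 \<epsilon> by (auto simp: e_def)
  have "\<forall>\<^sub>F k in sequentially. gap k < min 1 e \<and> \<delta> * \<beta>max * gap k < min 1 e \<and> gap (Suc k) < min 1 e"
    using e by (intro gap_eventually_small) auto
  moreover have "\<forall>\<^sub>F k in sequentially. Hval (Suc k) < Rlim + min 1 \<epsilon>"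
    using \<epsilon> by (intro order_tendstoD(2)[OF Hval_tendsto]) auto
  moreover have "\<forall>\<^sub>F k in sequentially. R k < Rlim + 1"
    by (intro order_tendstoD(2)[OF R_tendsto]) auto
  ultimately have "\<forall>\<^sub>F k in sequentially. (gap k < min 1 e \<and> \<delta> * \<beta>max * gap k < min 1 e \<and> gap (Suc k) < min 1 e)
      \<and> Hval (Suc k) < Rlim + min 1 \<epsilon> \<and> R k < Rlim + 1"
    by eventually_elim blast
  then obtain K2 where K2: "\<And>k. k \<ge> K2 \<Longrightarrow> gap k < min 1 e \<and> gap (Suc k) < min 1 e
      \<and> Hval (Suc k) < Rlim + min 1 \<epsilon> \<and> R k < Rlim + 1"
    unfolding eventually_sequentially by blast
  \<comment> \<open>\<open>C\<close> comes from \<open>F\<close>, the middle term from the two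
    opposite point components of the gradient of the distance term, and 1 from its step size
    component, which is quadratic in a gap below 1.\<close>
  define C1 where "C1 = C + \<delta> * \<bar>\<Gamma>\<bar> / 2 + 1"
  have C1: "C1 > 0" using C \<delta> by (auto simp: C1_def intro!: add_nonneg_pos add_nonneg_nonneg)
  \<comment> \<open>The KL bound is squared; 2 stems from
    \<open>(g2 + g1)\<^sup>2 \<le> 2 * (g2\<^sup>2 + g1\<^sup>2)\<close> and \<open>rate\<close>
    from the descent estimate.\<close>
  define A0 where "A0 = (M * C1)\<^sup>2 * (2 / rate)"
  have A0: "A0 > 0" using M C1 rate_pos by (simp add: A0_def)
  have Rlim_le: "Rlim \<le> R k" for k
    by (rule LIMSEQ_le_const2[OF R_tendsto]) (use antimonoD[OF R_antimono, of k] in blast)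
  show ?thesis
  proof (rule that[OF e(1)])
    show "4 * A0 + 2 / pmin > 0" using A0 pmin by (simp add: add_pos_pos)
    show "\<forall>k\<ge>max K1 K2. norm (x (Suc k) - z) < e \<longrightarrow>
       (R (k + 2) - Rlim) powr \<alpha> \<le> (4 * A0 + 2 / pmin) * ((R k - Rlim) - (R (k + 2) - Rlim))"
    proof (intro allI impI)
      fix k assume k: "max K1 K2 \<le> k" "norm (x (Suc k) - z) < e"
      have anti: "R (k + 2) \<le> R (Suc k)" "R (Suc k) \<le> R k"
        using antimonoD[OF R_antimono, of "Suc k" "k + 2"] antimonoD[OF R_antimono, of k "Suc k"] by auto
      define g1 where "g1 = gap (Suc k)"
      define g2 where "g2 = gap (k + 2)"
      have g: "0 \<le> g1" "0 \<le> g2" "g1 < e" "g2 < e" "g2 < 1"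
        using K2[of "Suc k"] k(1) by (auto simp: g1_def g2_def gap_def)
      define h where "h = Hval (k + 2) - Rlim"
      have h: "h < \<epsilon>" "h < 1" using K2[of "Suc k"] k(1) by (auto simp: h_def)
      have "h powr \<alpha> \<le> A0 * ((R k - Rlim) - (R (k + 2) - Rlim))" if "0 < h"
      proof -
        have step: "stepsize (Suc k) \<le> \<Gamma>"
          using small[rule_format, of "Suc k"] k e by simp
        obtain d where d: "d \<in> frechet_subdiff F (x (k + 2))" "norm d \<le> C * (g2 + g1)"
          using small[rule_format, of "Suc k"] k e by (auto simp: g1_def g2_def)
        define u where "u = x (k + 2) - x (Suc k)"
        have u: "norm u = g2" by (simp add: u_def g2_def gap_def)
        define D where "D = (d + (\<delta> * stepsize (Suc k) / 4) *\<^sub>R u, - ((\<delta> * stepsize (Suc k) / 4) *\<^sub>R u),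
            \<delta> / 8 * (norm u)\<^sup>2)"
        have D: "D \<in> limiting_subdiff (potential F \<delta>) (x (k + 2), x (Suc k), stepsize (Suc k))"
          unfolding D_def u_def
          using potential_frechet_subgradient[OF d(1)] frechet_subdiff_subset_limiting by blast
        have "norm D \<le> C1 * (g2 + g1)"
        proof -
          have c: "0 \<le> \<delta> * stepsize (Suc k) / 4" "\<delta> * stepsize (Suc k) / 4 \<le> \<delta> * \<bar>\<Gamma>\<bar> / 4"
            using \<delta> stepsize_pos[of "Suc k"] step by (auto intro!: divide_right_mono mult_left_mono)
          have cu: "norm ((\<delta> * stepsize (Suc k) / 4) *\<^sub>R u) \<le> \<delta> * \<bar>\<Gamma>\<bar> / 4 * g2"
            using c g(2) u by (simp add: mult_right_mono)
          have "norm D \<le> norm (d + (\<delta> * stepsize (Suc k) / 4) *\<^sub>R u)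
              + (norm (- ((\<delta> * stepsize (Suc k) / 4) *\<^sub>R u)) + norm (\<delta> / 8 * (norm u)\<^sup>2))"
            unfolding D_def by (rule order_trans[OF norm_Pair_le add_left_mono[OF norm_Pair_le]])
          moreover have "norm (d + (\<delta> * stepsize (Suc k) / 4) *\<^sub>R u) \<le> C * (g2 + g1) + \<delta> * \<bar>\<Gamma>\<bar> / 4 * g2"
            using norm_triangle_ineq[of d "(\<delta> * stepsize (Suc k) / 4) *\<^sub>R u"] cu d(2) by linarith
          moreover have "norm (\<delta> / 8 * (norm u)\<^sup>2) \<le> 1 * g2"
          proof -
            have "\<delta> / 8 * g2 \<le> 1" using \<delta> g by (intro mult_le_one) auto
            then have "\<delta> / 8 * g2 * g2 \<le> 1 * g2" using g by (intro mult_right_mono) auto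
            then show ?thesis using \<delta> by (simp add: u power2_eq_square)
          qed
          moreover have "norm (- ((\<delta> * stepsize (Suc k) / 4) *\<^sub>R u)) \<le> \<delta> * \<bar>\<Gamma>\<bar> / 4 * g2"
            using cu by (simp only: norm_minus_cancel)
          ultimately have "norm D \<le> C * (g2 + g1) + (\<delta> * \<bar>\<Gamma>\<bar> / 2 + 1) * g2"
            by (simp add: algebra_simps)
          also have "\<dots> \<le> C * (g2 + g1) + (\<delta> * \<bar>\<Gamma>\<bar> / 2 + 1) * (g2 + g1)"
            using g \<delta> by (intro add_left_mono mult_left_mono) auto
          finally show ?thesis by (simp add: C1_def algebra_simps)
        qed
        moreover have "h powr \<theta> \<le> M * norm D"
          unfolding h_def
        proof (rule ineq[rule_format, OF conjI[OF _ conjI[OF _ conjI[OF _ conjI[OF _ conjI[OF _ D]]]]]])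
          show "(z, z, stepsize (Suc k)) \<in> S" using step stepsize_ge by (auto simp: S_def)
          have "norm (x (k + 2) - z) < \<epsilon> / 2"
            using norm_triangle_ineq[of u "x (Suc k) - z"] u g k e by (simp add: u_def)
          moreover have "norm (x (Suc k) - z) < \<epsilon> / 2" using k e by linarith
          moreover have "dist (x (k + 2), x (Suc k), stepsize (Suc k)) (z, z, stepsize (Suc k))
              \<le> norm (x (k + 2) - z) + (norm (x (Suc k) - z) + norm (0::real))"
            unfolding dist_norm diff_Pair diff_self
            by (rule order_trans[OF norm_Pair_le add_left_mono[OF norm_Pair_le]])
          ultimately show "dist (x (k + 2), x (Suc k), stepsize (Suc k)) (z, z, stepsize (Suc k)) < \<epsilon>"
            by simp
          show "potential F \<delta> (x (k + 2), x (Suc k), stepsize (Suc k)) = ereal (Hval (k + 2))"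
            using potential_x[of "Suc k"] by simp
        qed (use that h in \<open>auto simp: h_def\<close>)
        ultimately have "h powr \<theta> \<le> M * (C1 * (g2 + g1))"
          using M by (meson mult_left_mono less_imp_le order_trans)
        then have "(h powr \<theta>)\<^sup>2 \<le> (M * C1 * (g2 + g1))\<^sup>2"
          by (intro power_mono) (simp_all add: mult.assoc)
        also have "\<dots> = (M * C1)\<^sup>2 * (g2 + g1)\<^sup>2" by (simp add: power_mult_distrib)
        also have "(g2 + g1)\<^sup>2 \<le> 2 * (g2\<^sup>2 + g1\<^sup>2)"
          using sum_squares_bound[of g2 g1] by (simp add: power2_sum)
        also have "g2\<^sup>2 + g1\<^sup>2 \<le> (R k - R (k + 2)) / rate"
          using R_descent[of k] R_descent[of "Suc k"] rate_pos
          by (simp add: g1_def g2_def field_simps)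
        finally have "(h powr \<theta>)\<^sup>2 \<le> (M * C1)\<^sup>2 * (2 * ((R k - R (k + 2)) / rate))"
          by (simp add: mult_left_mono)
        also have "\<dots> = A0 * (R k - R (k + 2))" by (simp add: A0_def)
        finally have *: "(h powr \<theta>)\<^sup>2 \<le> A0 * (R k - R (k + 2))" .
        \<comment> \<open>\<open>h < 1\<close> allows trading \<open>2 * \<theta>\<close> for the
          possibly larger exponent \<open>\<alpha>\<close>.\<close>
        have "h powr \<alpha> \<le> h powr (2 * \<theta>)" using that h \<alpha> by (intro powr_mono') auto
        also have "\<dots> = (h powr \<theta>)\<^sup>2" using that by (simp add: power2_eq_square powr_add[symmetric])
        finally show ?thesis using * by simp
    qed
    moreover have "pmin * ((R (Suc k) - Rlim) - h) \<le> (R (Suc k) - Rlim) - (R (k + 2) - Rlim)"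
      using R_diff_ge[of "Suc k"] by (simp add: h_def)
    moreover have "R (k + 2) - Rlim \<le> 1" using K2[of k] k(1) anti by simp
    ultimately show "(R (k + 2) - Rlim) powr \<alpha> \<le> (4 * A0 + 2 / pmin) * ((R k - Rlim) - (R (k + 2) - Rlim))"
      using Rlim_le[of "k + 2"] anti \<alpha> pmin A0
      by (intro nonmonotone_recursion[where ?r1.0 = "R (Suc k) - Rlim" and h = h]) auto
    qed
  qed
qed

section \<open>Convergence rates\<close>

theorem convergence_rate:
  assumes \<sigma>: "strict_mono \<sigma>" "(x \<circ> \<sigma>) \<longlonglongrightarrow> z"
    and N: "open N" "stationary_points f grad_f P1 P2 \<subseteq> N" and P2: "\<And>w. w \<in> N \<Longrightarrow> GDERIV P2 w :> grad_P2 w"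
    and lip2: "locally_lipschitz_on N grad_P2"
    and KL: "KL_function_exponent_on (UNIV \<times> UNIV \<times> {0<..}) (potential F \<delta>) \<theta>"
    and \<theta>: "\<theta> < 1"
  shows "\<theta> \<le> 1 / 2 \<Longrightarrow> \<exists>d>0. \<exists>\<rho>\<in>{0<..<1}. \<forall>\<^sub>F k in sequentially. norm (x k - z) \<le> d * \<rho> ^ k"
    and "1 / 2 < \<theta> \<Longrightarrow> \<exists>d>0. \<forall>\<^sub>F k in sequentially.
           norm (x k - z) \<le> d * real k powr (- ((1 - \<theta>) / (2 * \<theta> - 1)))"
proof -
  define r where "r k = R k - Rlim" for k
  \<comment> \<open>\<open>\<theta> < 1\<close> keeps \<open>1 - \<alpha> / 2\<close> positive, and
    \<open>\<alpha> = 1\<close> holds exactly when \<open>\<theta> \<le> 1 / 2\<close>, which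
    separates the two rates.\<close>
  define \<alpha> where "\<alpha> = max 1 (2 * \<theta>)"
  have \<alpha>: "1 \<le> \<alpha>" "2 * \<theta> \<le> \<alpha>" "\<alpha> < 2" using \<theta> by (auto simp: \<alpha>_def)
  have z: "z \<in> N" using accumulation_stationary[OF \<sigma>] N(2) by blast
  obtain e A K where e: "e > 0" and A: "A > 0" and rec:
    "\<forall>k\<ge>K. norm (x (Suc k) - z) < e \<longrightarrow> r (k + 2) powr \<alpha> \<le> A * (r k - r (k + 2))"
    unfolding r_def
    by (rule local_recursion[OF \<sigma> N(1) z P2 lip2 KL \<theta> \<alpha>(1,2) less_imp_le[OF \<alpha>(3)]])
  have anti: "antimono r" using R_antimono by (auto simp: r_def antimono_def)
  have lim: "r \<longlonglongrightarrow> 0" using tendsto_diff[OF R_tendsto tendsto_const[of Rlim]] by (simp add: r_def[abs_def])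
  have nonneg: "0 \<le> r k" for k
    by (rule LIMSEQ_le_const2[OF lim]) (use antimonoD[OF anti, of k] in blast)
  have descent: "rate * (norm (x (Suc k) - x k))\<^sup>2 \<le> r k - r (Suc k)" for k
    using R_descent[of k] by (simp add: gap_def r_def)
  obtain N0 M where M: "M > 0" "r N0 \<le> 1"
    and tail: "\<forall>k\<ge>N0. r (k + 2) powr \<alpha> \<le> A * (r k - r (k + 2))"
      "\<forall>k\<ge>N0. norm (x (Suc k) - z) \<le> M * r k powr (1 - \<alpha> / 2)"
    by (rule descent_sequence_trapped[OF anti lim rate_pos descent \<sigma> \<alpha>(1,3) A e rec[rule_format]])
  show "\<exists>d>0. \<exists>\<rho>\<in>{0<..<1}. \<forall>\<^sub>F k in sequentially. norm (x k - z) \<le> d * \<rho> ^ k" if "\<theta> \<le> 1 / 2"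
  proof (rule linear_rate_of_recursion[OF anti nonneg A M(1)])
    have "\<alpha> = 1" using that by (simp add: \<alpha>_def)
    then show "r (k + 2) \<le> A * (r k - r (k + 2))" "norm (x (Suc k) - z) \<le> M * r k powr (1 / 2)" if "k \<ge> N0" for k
      using tail[rule_format, OF that] nonneg by auto
  qed
  show "\<exists>d>0. \<forall>\<^sub>F k in sequentially. norm (x k - z) \<le> d * real k powr (- ((1 - \<theta>) / (2 * \<theta> - 1)))"
    if "1 / 2 < \<theta>"
  proof -
    have \<alpha>_eq: "\<alpha> = 2 * \<theta>" using that by (simp add: \<alpha>_def)
    have "1 < \<alpha>" using that by (simp add: \<alpha>_eq)
    have "\<exists>d>0. \<forall>\<^sub>F k in sequentially. norm (x k - z) \<le> d * real k powr (- ((1 - \<alpha> / 2) / (\<alpha> - 1)))"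
      by (rule sublinear_rate_of_recursion[OF anti nonneg A M \<open>1 < \<alpha>\<close> \<alpha>(3) tail[rule_format]])
    then show ?thesis by (simp add: \<alpha>_eq)
  qed
qed

end

theorem theorem4p3:
  fixes f P2 :: "real ^ 'n \<Rightarrow> real"
    and P1 :: "real ^ 'n \<Rightarrow> ereal"
    and grad_f grad_P2 :: "real ^ 'n \<Rightarrow> real ^ 'n"
    and N_S :: "(real ^ 'n) set"
    and \<gamma>min \<gamma>max \<beta>max pmin \<delta> \<tau> \<eta> \<theta> :: real
    and x :: "nat \<Rightarrow> real ^ 'n"
    and xstar :: "real ^ 'n"
  assumes f_grad: "\<forall>z. GDERIV f z :> grad_f z"
    and f_C1: "continuous_on UNIV grad_f"
    and f_lip: "locally_lipschitz_on UNIV grad_f"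
    and P1_proper: "proper_fun P1"
    and P1_closed: "lower_semicontinuous P1"
    and P1_prox_bounded: "prox_bounded P1"
    and P2_convex: "convex_on UNIV P2"
    and F_bounded_below: "\<exists>m::real. \<forall>z\<in>domain_of P1. ereal m \<le> objective f P1 P2 z"
    and N_S_open: "open N_S"
    and N_S_contains: "stationary_points f grad_f P1 P2 \<subseteq> N_S"
    and P2_grad: "\<forall>z\<in>N_S. GDERIV P2 z :> grad_P2 z"
    and P2_C1: "continuous_on N_S grad_P2"
    and P2_lip: "locally_lipschitz_on N_S grad_P2"
    and \<gamma>_params: "0 < \<gamma>min" "\<gamma>min \<le> \<gamma>max"
    and \<beta>_param: "0 \<le> \<beta>max"
    and p_param: "0 < pmin" "pmin < 1"
    and \<delta>_param: "0 \<le> \<delta>" "\<delta> < 1"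
    and \<tau>_param: "1 < \<tau>"
    and \<eta>_param: "0 < \<eta>" "\<eta> < 1 / sqrt \<tau>"
    and x_generated: "nexPGA f grad_f P1 P2 \<gamma>min \<gamma>max \<beta>max pmin \<delta> \<tau> \<eta> x"
    and accumulation: "\<exists>r. strict_mono r \<and> (x \<circ> r) \<longlonglongrightarrow> xstar"
    and \<theta>_range: "0 \<le> \<theta>" "\<theta> < 1"
    and KL: "KL_function_exponent_on (UNIV \<times> UNIV \<times> {0<..})
               (potential (objective f P1 P2) \<delta>) \<theta>"
  shows "(\<theta> \<le> 1 / 2 \<longrightarrow>
            (\<exists>d1>0. \<exists>\<rho>\<in>{0<..<1}. \<forall>\<^sub>F k in sequentially.
               norm (x k - xstar) \<le> d1 * \<rho> ^ k)) \<and>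
         (1 / 2 < \<theta> \<longrightarrow>
            (\<exists>d2>0. \<forall>\<^sub>F k in sequentially.
               norm (x k - xstar) \<le> d2 * real k powr (- ((1 - \<theta>) / (2 * \<theta> - 1)))))"
proof -
  obtain \<xi> \<beta>0 \<gamma>0 p R j xt where init: "x 0 \<in> domain_of P1" "ereal (R 0) = objective f P1 P2 (x 0)"
    and run: "\<And>k. \<xi> k \<in> limiting_subdiff (\<lambda>z. ereal (P2 z)) (x k) \<and>
      \<beta>0 k \<in> {0..\<delta> * \<beta>max} \<and> \<gamma>0 k \<in> {\<gamma>min..\<gamma>max} \<and>
      (\<forall>i<j k.
        (\<nexists>z. is_arg_min (prox_model grad_f P1 (\<xi> k) (x k + (\<eta> ^ i * \<beta>0 k) *\<^sub>R (x k - x (k - 1)))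
               (\<tau> ^ i * \<gamma>0 k)) (\<lambda>_. True) z) \<or>
        (is_arg_min (prox_model grad_f P1 (\<xi> k) (x k + (\<eta> ^ i * \<beta>0 k) *\<^sub>R (x k - x (k - 1)))
               (\<tau> ^ i * \<gamma>0 k)) (\<lambda>_. True) (xt k i) \<and>
         \<not> line_search (objective f P1 P2) \<delta> (R k) (\<tau> ^ i * \<gamma>0 k) (x k) (xt k i))) \<and>
      is_arg_min (prox_model grad_f P1 (\<xi> k) (x k + (\<eta> ^ j k * \<beta>0 k) *\<^sub>R (x k - x (k - 1)))
        (\<tau> ^ j k * \<gamma>0 k)) (\<lambda>_. True) (xt k (j k)) \<and>
      line_search (objective f P1 P2) \<delta> (R k) (\<tau> ^ j k * \<gamma>0 k) (x k) (xt k (j k)) \<and>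
      x (Suc k) = xt k (j k) \<and> p (Suc k) \<in> {pmin..1} \<and>
      ereal (R (Suc k)) = ereal ((1 - p (Suc k)) * R k) +
        ereal (p (Suc k)) * potential (objective f P1 P2) \<delta> (x (Suc k), x k, \<tau> ^ j k * \<gamma>0 k)"
    using x_generated unfolding nexPGA_def Let_def by metis
  interpret nexpga_run f P2 P1 grad_f \<gamma>min \<gamma>max \<beta>max pmin \<delta> \<tau> \<eta> x \<xi> \<beta>0 \<gamma>0 p R j xt
  proof
    show "ereal (R 0) = objective f P1 P2 (x 0)" "x 0 \<in> domain_of P1" by (fact init)+
    fix k
    have step: "x (Suc k) = xt k (j k)" using run[of k] by blast
    show "is_arg_min (prox_model grad_f P1 (\<xi> k) (x k + (\<eta> ^ j k * \<beta>0 k) *\<^sub>R (x k - x (k - 1)))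
        (\<tau> ^ j k * \<gamma>0 k)) (\<lambda>_. True) (x (Suc k))"
      unfolding step using run[of k] by blast
    show "line_search (objective f P1 P2) \<delta> (R k) (\<tau> ^ j k * \<gamma>0 k) (x k) (x (Suc k))"
      unfolding step using run[of k] by blast
    show "ereal (R (Suc k)) = ereal ((1 - p (Suc k)) * R k) +
        ereal (p (Suc k)) * potential (objective f P1 P2) \<delta> (x (Suc k), x k, \<tau> ^ j k * \<gamma>0 k)"
      using run[of k] by blast
    show "\<xi> k \<in> limiting_subdiff (\<lambda>z. ereal (P2 z)) (x k)" using run[of k] by blast
    show "0 \<le> \<beta>0 k" "\<beta>0 k \<le> \<delta> * \<beta>max" "\<gamma>min \<le> \<gamma>0 k" "\<gamma>0 k \<le> \<gamma>max" "pmin \<le> p (Suc k)" "p (Suc k) \<le> 1"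
      using run[of k] by simp_all
    show "(\<nexists>z. is_arg_min (prox_model grad_f P1 (\<xi> k) (x k + (\<eta> ^ i * \<beta>0 k) *\<^sub>R (x k - x (k - 1)))
               (\<tau> ^ i * \<gamma>0 k)) (\<lambda>_. True) z) \<or>
        (is_arg_min (prox_model grad_f P1 (\<xi> k) (x k + (\<eta> ^ i * \<beta>0 k) *\<^sub>R (x k - x (k - 1)))
               (\<tau> ^ i * \<gamma>0 k)) (\<lambda>_. True) (xt k i) \<and>
         \<not> line_search (objective f P1 P2) \<delta> (R k) (\<tau> ^ i * \<gamma>0 k) (x k) (xt k i))" if "i < j k" for i
      using run[of k] that by blast
  qed (use assms in blast)+
  obtain \<sigma> where \<sigma>: "strict_mono \<sigma>" "(x \<circ> \<sigma>) \<longlonglongrightarrow> xstar" using accumulation by blast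
  note rate = convergence_rate[OF \<sigma> N_S_open N_S_contains P2_grad[rule_format] P2_lip KL \<theta>_range(2)]
  show ?thesis using rate by blast
qed

end
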